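(* Let $F$ be a number field with ring of integers $O_F$, $r_2(F)$ complex places and discriminant $D_{F/\mathbb{Q}}$; let $\overline{\mathbb{Z}}$ be the ring of all algebraic integers in an algebraic closure of $\mathbb{Q}$ containing $F$. Let $\mathcal{J}$ be a non-zero ideal of $O_F$ and let $t, a \in O_F$ with $\mathcal{J} + tO_F = O_F$. Suppose $X > 0$ and $Y > 1/3$ satisfy $$(\pi/2)^{3r_2(F)}\cdot 3^{-3[F:\mathbb{Q}]}\cdot |D_{F/\mathbb{Q}}|^{-3/2}\cdot \mathrm{Norm}_{F/\mathbb{Q}}(\mathcal{J}) > (XY)^{[F:\mathbb{Q}]}.$$ Then there exists a polynomial $g_1(x,y) = b_1x + b_2y + b_3 \in \mathcal{J}^{-1}\cdot O_F[x,y]$ with the following properties: (i) for all embeddings $\lambda:F \to \mathbb{C}$ one has $|\lambda(b_1)| < 1/(3X)$, $|\lambda(b_2)| < 1/(3Y)$ and $|\lambda(b_3)| < 1/3$; (ii) $g_1(x,y) = 0$ for every pair $(x,y)\in\overline{\mathbb{Z}}\times\overline{\mathbb{Z}}$ such that $x + ty + a \in \mathcal{J}\overline{\mathbb{Z}}$ and $|\lambda(x)| \le X$, $|\lambda(y)|\le Y$ for every ring embedding $\lambda:\overline{\mathbb{Z}}\to\mathbb{C}$; (iii) $b_1 \neq 0$ and $g_1(x,y) \equiv b_1(x + ty + a) \bmod O_F[x,y]$. Moreover, every such $g_1(x,y)$ (i.e. every polynomial in $\mathcal{J}^{-1}O_F[x,y]$ of this form satisfying (i)–(iii)) has the following two properties: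 (a) for all $x, y \in \overline{\mathbb{Z}}$ with $x + ty + a \in \mathcal{J}\overline{\mathbb{Z}}$, the value $g_1(x,y)$ lies in $\overline{\mathbb{Z}}$; (b) for all $x', y' \in \mathbb{C}$ with $|x'|\le X$ and $|y'| \le Y$ and every embedding $\lambda: F\to\mathbb{C}$, one has $|\lambda(g_1)(x',y')| < 1$, where $\lambda(g_1)\in\mathbb{C}[x,y]$ is obtained by applying $\lambda$ to the coefficients. *)

theory Defs
  imports
    Complex_Main
    "HOL-Library.FuncSet"
    "HOL-Computational_Algebra.Polynomial"
    "Jordan_Normal_Form.Determinant"
begin

text \<open>
  Throughout, \<open>'k\<close> is an arbitrary algebraically closed field of characteristic 0. The algebraic
  closure of the rationals is \<open>{x :: 'k. algebraic x}\<close>; number fields are subsets of \<open>'k\<close>,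
  hence automatically of this closure, and all algebraic integers of \<open>'k\<close> lie in it too.
\<close>

definition rat_scale :: "rat \<Rightarrow> 'k::field_char_0 \<Rightarrow> 'k" where
  "rat_scale q x = of_rat q * x"

definition number_field :: "'k::field_char_0 set \<Rightarrow> bool" where
  "number_field F \<longleftrightarrow>
     0 \<in> F \<and> 1 \<in> F \<and>
     (\<forall>x\<in>F. \<forall>y\<in>F. x + y \<in> F \<and> x * y \<in> F) \<and>
     (\<forall>x\<in>F. - x \<in> F \<and> inverse x \<in> F) \<and>
     (\<exists>B. finite B \<and> module.span rat_scale B = F)"

definition field_degree :: "'k::field_char_0 set \<Rightarrow> nat" where
  "field_degree F = vector_space.dim rat_scale F"

definition alg_integers :: "'k::field_char_0 set" where
  "alg_integers = {x. algebraic_int x}"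

definition ring_of_integers :: "'k::field_char_0 set \<Rightarrow> 'k set" where
  "ring_of_integers F = F \<inter> alg_integers"

text \<open>
  Embeddings are only relevant on their domain \<open>R\<close>; extensionality makes each of them a single
  HOL function, so that they can be counted.
\<close>

definition embeddings :: "'k::field_char_0 set \<Rightarrow> ('k \<Rightarrow> complex) set" where
  "embeddings R = {\<phi> \<in> extensional R.
     inj_on \<phi> R \<and> \<phi> 1 = 1 \<and>
     (\<forall>x\<in>R. \<forall>y\<in>R. \<phi> (x + y) = \<phi> x + \<phi> y \<and> \<phi> (x * y) = \<phi> x * \<phi> y)}"

text \<open>A complex place is a pair of complex conjugate non-real embeddings.\<close>

definition complex_places :: "'k::field_char_0 set \<Rightarrow> ('k \<Rightarrow> complex) set set" where
  "complex_places F =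
     {{\<phi>, restrict (cnj \<circ> \<phi>) F} | \<phi>. \<phi> \<in> embeddings F \<and> \<not> \<phi> ` F \<subseteq> \<real>}"

definition integral_basis :: "'k::field_char_0 set \<Rightarrow> 'k list \<Rightarrow> bool" where
  "integral_basis F \<omega> \<longleftrightarrow>
     set \<omega> \<subseteq> ring_of_integers F \<and>
     (\<forall>x \<in> ring_of_integers F. \<exists>!c :: int list.
        length c = length \<omega> \<and> x = (\<Sum>i<length \<omega>. of_int (c ! i) * \<omega> ! i))"

text \<open>
  The discriminant is the square of the determinant of all conjugates of an integral basis. It
  depends neither on the basis nor on the enumeration of the embeddings, and is a rational
  integer, here regarded as a complex number.
\<close>

definition field_disc :: "'k::field_char_0 set \<Rightarrow> complex" where
  "field_disc F =
     (let \<omega> = (SOME \<omega>. integral_basis F \<omega>);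
          \<sigma> = (SOME \<sigma>. distinct \<sigma> \<and> set \<sigma> = embeddings F);
          n = field_degree F
      in (det (mat n n (\<lambda>(i, j). (\<sigma> ! i) (\<omega> ! j))))\<^sup>2)"

definition is_ideal_of :: "'k::field_char_0 set \<Rightarrow> 'k set \<Rightarrow> bool" where
  "is_ideal_of R I \<longleftrightarrow>
     I \<subseteq> R \<and> 0 \<in> I \<and> (\<forall>x\<in>I. \<forall>y\<in>I. x + y \<in> I) \<and> (\<forall>r\<in>R. \<forall>x\<in>I. r * x \<in> I)"

definition ideal_norm :: "'k::field_char_0 set \<Rightarrow> 'k set \<Rightarrow> nat" where
  "ideal_norm F J =
     card (ring_of_integers F //
       {(x, y). x \<in> ring_of_integers F \<and> y \<in> ring_of_integers F \<and> x - y \<in> J})"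

definition ideal_inverse :: "'k::field_char_0 set \<Rightarrow> 'k set \<Rightarrow> 'k set" where
  "ideal_inverse F J = {x \<in> F. \<forall>y\<in>J. x * y \<in> ring_of_integers F}"

text \<open>The product of two additive subgroups: all finite sums of products.\<close>

definition sums_of_products :: "'r::comm_ring_1 set \<Rightarrow> 'r set \<Rightarrow> 'r set" where
  "sums_of_products A B =
     {\<Sum>i<n. f i * g i | (n::nat) f g. \<forall>i<n. f i \<in> A \<and> g i \<in> B}"

text \<open>
  A polynomial in two variables \<open>x\<close>, \<open>y\<close> is a polynomial in \<open>y\<close> whose coefficients are polynomials
  in \<open>x\<close>; the coefficient of \<open>x ^ i * y ^ j\<close> in \<open>g\<close> is \<open>coeff (coeff g j) i\<close>.
\<close>

definition bipolys :: "'r::comm_ring_1 set \<Rightarrow> 'r poly poly set" where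
  "bipolys R = {g. \<forall>i j. coeff (coeff g j) i \<in> R}"

definition bieval :: "'r::comm_ring_1 poly poly \<Rightarrow> 'r \<Rightarrow> 'r \<Rightarrow> 'r" where
  "bieval g x y = poly (poly g [:y:]) x"

definition map_bipoly :: "('r::comm_ring_1 \<Rightarrow> 's::comm_ring_1) \<Rightarrow> 'r poly poly \<Rightarrow> 's poly poly" where
  "map_bipoly h = map_poly (map_poly h)"

text \<open>The polynomial \<open>b1 * x + b2 * y + b3\<close>.\<close>

definition lin_bipoly :: "'r::comm_ring_1 \<Rightarrow> 'r \<Rightarrow> 'r \<Rightarrow> 'r poly poly" where
  "lin_bipoly b1 b2 b3 = [:[:b3, b1:], [:b2:]:]"

definition inverse_ideal_bipolys :: "'k::field_char_0 set \<Rightarrow> 'k set \<Rightarrow> 'k poly poly set" where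
  "inverse_ideal_bipolys F J =
     sums_of_products ((\<lambda>c. [:[:c:]:]) ` ideal_inverse F J) (bipolys (ring_of_integers F))"

definition admissible ::
  "'k::field_char_0 set \<Rightarrow> 'k set \<Rightarrow> 'k \<Rightarrow> 'k \<Rightarrow> real \<Rightarrow> real \<Rightarrow> 'k \<Rightarrow> 'k \<Rightarrow> 'k \<Rightarrow> bool" where
  "admissible F J t a X Y b1 b2 b3 \<longleftrightarrow>
     lin_bipoly b1 b2 b3 \<in> inverse_ideal_bipolys F J \<and>
     (\<forall>\<phi> \<in> embeddings F.
        cmod (\<phi> b1) < 1 / (3 * X) \<and> cmod (\<phi> b2) < 1 / (3 * Y) \<and> cmod (\<phi> b3) < 1 / 3) \<and>
     (\<forall>x \<in> alg_integers. \<forall>y \<in> alg_integers.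
        x + t * y + a \<in> sums_of_products J alg_integers \<and>
        (\<forall>\<phi> \<in> embeddings (alg_integers :: 'k set). cmod (\<phi> x) \<le> X \<and> cmod (\<phi> y) \<le> Y)
        \<longrightarrow> bieval (lin_bipoly b1 b2 b3) x y = 0) \<and>
     b1 \<noteq> 0 \<and>
     lin_bipoly b1 b2 b3 - [:[:b1:]:] * lin_bipoly 1 t a \<in> bipolys (ring_of_integers F)"

end

theory Submission
  imports "HOL-Analysis.Ball_Volume" Defs
    "Jordan_Normal_Form.Char_Poly" "HOL-Computational_Algebra.Computational_Algebra"
begin

text \<open>
  The triples \<open>(b1, b2, b3)\<close> with \<open>b1 \<in> J\<^sup>-\<^sup>1\<close>, \<open>b2 \<equiv> t * b1\<close> and \<open>b3 \<equiv> a * b1\<close> modulo \<open>O\<close> form a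
  lattice of rank \<open>3 * [F : \<rat>]\<close> that contains \<open>O\<^sup>3\<close> with index \<open>N(J)\<close>. The conjugates allowed by
  condition (i) form a product of intervals and discs, and the hypothesis on \<open>X * Y\<close> says that its
  volume is large enough for Minkowski's theorem to provide a non-zero triple. If \<open>x + t * y + a\<close>
  lies in the ideal generated by \<open>J\<close>, then \<open>b1 * x + b2 * y + b3\<close> is an algebraic integer; under the
  bounds on \<open>x\<close> and \<open>y\<close> all its conjugates have absolute value below 1, so it vanishes. In the same
  way \<open>b1 = 0\<close> would make \<open>b2\<close> and \<open>b3\<close> integers with small conjugates (here \<open>Y > 1 / 3\<close> is used),
  hence zero.
\<close>

section \<open>Volumes in real coordinate space\<close>

unbundle no vec_syntax

text \<open>No basis of the group of triples is ever built. Minkowski's theorem is proved for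
  integer vectors shifted by differences from a finite set of pairwise incongruent vectors, so all
  that is asked of \<open>J\<close> is \<open>ideal_norm F J\<close> elements of
  \<open>ideal_inverse F J\<close> that are distinct modulo integers. This rests on the
  invertibility of ideals, where finiteness of the residues modulo a rational integer takes the
  place of the noetherian condition. The constants: the radii in (i) multiply to
  \<open>1 / (27 * (X * Y))\<close>, whence the power of 3. The conjugates of a triple are given by
  three copies of the matrix whose squared determinant is the discriminant, whence the exponent 3/2.
  For a pair of complex embeddings a disc replaces its circumscribed square, a factor
  \<open>pi / 4\<close>; passing to real and imaginary parts gives 2, together
  \<open>pi / 2\<close>. In (ii) the values \<open>x\<close> and \<open>y\<close> need not lie in
  \<open>F\<close>. The argument needs all roots of a minimal polynomial, whereas bounds are given
  for embeddings; each root is therefore realised by an embedding of the field of all algebraic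
  numbers, found with Zorn's lemma.\<close>

abbreviation lborel_PiM :: "'i set \<Rightarrow> ('i \<Rightarrow> real) measure" where
  "lborel_PiM I \<equiv> Pi\<^sub>M I (\<lambda>_. lborel)"

interpretation lborel_PiM: product_sigma_finite "\<lambda>_. lborel :: real measure"
  by (simp add: product_sigma_finite_def sigma_finite_lborel)

text \<open>Fubini isolates coordinate \<open>i\<close>. Since \<open>g\<close> does not depend on
  it, \<open>g x\<close> is a constant for the inner integral, to which the one-dimensional affine
  substitution applies. Scalings and shears are thus treated together.\<close>

lemma nn_integral_affine_coordinate:
  fixes f :: "('i \<Rightarrow> real) \<Rightarrow> ennreal"
  assumes I: "finite I" "i \<in> I" and a: "a \<noteq> 0"
    and f[measurable]: "f \<in> borel_measurable (lborel_PiM I)"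
    and g[measurable]: "g \<in> borel_measurable (lborel_PiM I)"
    and g_upd: "\<And>x y. g (x(i := y)) = g x"
  shows "(\<integral>\<^sup>+x. f (x(i := a * x i + g x)) \<partial>lborel_PiM I) =
         ennreal (1 / \<bar>a\<bar>) * (\<integral>\<^sup>+x. f x \<partial>lborel_PiM I)"
proof -
  define J where "J = I - {i}"
  have J: "finite J" "i \<notin> J" and IJ: "I = insert i J"
    using I by (auto simp: J_def)
  have upd: "(\<lambda>x. x(i := a * x i + g x)) \<in>
      measurable (lborel_PiM I) (lborel_PiM I)"
    by (rule measurable_fun_upd[where J = I]) (use I in auto)
  have F: "(\<lambda>x. f (x(i := a * x i + g x))) \<in> borel_measurable (lborel_PiM I)"
    using measurable_compose[OF upd f] .
  have inner: "(\<integral>\<^sup>+y. f (x(i := a * y + g x)) \<partial>lborel) =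
      ennreal (1 / \<bar>a\<bar>) * (\<integral>\<^sup>+y. f (x(i := y)) \<partial>lborel)"
    if x: "x \<in> space (lborel_PiM J)" for x
  proof -
    have "(\<lambda>y. x(i := y)) \<in> measurable lborel (lborel_PiM I)"
      by (rule measurable_fun_upd[where J = J]) (use x IJ in auto)
    from measurable_compose[OF this f]
    have m: "(\<lambda>y. f (x(i := y))) \<in> borel_measurable borel" by simp
    from nn_integral_real_affine[OF this, of a "g x"] a
    have "(\<integral>\<^sup>+y. f (x(i := y)) \<partial>lborel) =
        ennreal \<bar>a\<bar> * (\<integral>\<^sup>+y. f (x(i := a * y + g x)) \<partial>lborel)"
      by (simp add: add.commute)
    then have "ennreal (1 / \<bar>a\<bar>) * (\<integral>\<^sup>+y. f (x(i := y)) \<partial>lborel) =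
        (ennreal (1 / \<bar>a\<bar>) * ennreal \<bar>a\<bar>) * (\<integral>\<^sup>+y. f (x(i := a * y + g x)) \<partial>lborel)"
      by (simp add: mult.assoc)
    also have "ennreal (1 / \<bar>a\<bar>) * ennreal \<bar>a\<bar> = 1"
      using a by (simp add: ennreal_mult'[symmetric])
    finally show ?thesis unfolding mult_1 by (rule sym)
  qed
  have m2: "(\<lambda>x. \<integral>\<^sup>+y. f (x(i := y)) \<partial>lborel) \<in> borel_measurable (lborel_PiM J)"
  proof -
    have "(\<lambda>(x, y). x(i := y)) \<in>
        measurable (lborel_PiM J \<Otimes>\<^sub>M lborel) (lborel_PiM I)"
      unfolding IJ using measurable_add_dim[of i J "\<lambda>_. lborel :: real measure"] by simp
    from measurable_compose[OF this f]
    have "(\<lambda>(x, y). f (x(i := y))) \<in> borel_measurable (lborel_PiM J \<Otimes>\<^sub>M lborel)"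
      by (simp add: case_prod_beta)
    then show ?thesis
      by (rule lborel.borel_measurable_nn_integral)
  qed
  have "(\<integral>\<^sup>+x. f (x(i := a * x i + g x)) \<partial>lborel_PiM I) =
        (\<integral>\<^sup>+x. \<integral>\<^sup>+y. f (x(i := a * y + g x)) \<partial>lborel \<partial>lborel_PiM J)"
    using F J unfolding IJ by (subst lborel_PiM.product_nn_integral_insert) (auto simp: g_upd)
  also have "\<dots> = (\<integral>\<^sup>+x. ennreal (1 / \<bar>a\<bar>) * (\<integral>\<^sup>+y. f (x(i := y)) \<partial>lborel) \<partial>lborel_PiM J)"
    by (rule nn_integral_cong) (rule inner)
  also have "\<dots> = ennreal (1 / \<bar>a\<bar>) *
      (\<integral>\<^sup>+x. \<integral>\<^sup>+y. f (x(i := y)) \<partial>lborel \<partial>lborel_PiM J)"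
    by (rule nn_integral_cmult[OF m2])
  also have "(\<integral>\<^sup>+x. \<integral>\<^sup>+y. f (x(i := y)) \<partial>lborel \<partial>lborel_PiM J) =
      (\<integral>\<^sup>+x. f x \<partial>lborel_PiM I)"
    using f J unfolding IJ by (subst lborel_PiM.product_nn_integral_insert) auto
  finally show ?thesis .
qed

text \<open>Coordinates are translated one at a time; \<open>S\<close> collects those already
  treated. Measurability is carried through the induction because the next substitution requires
  it.\<close>

lemma nn_integral_translate_PiM:
  fixes f :: "('i \<Rightarrow> real) \<Rightarrow> ennreal"
  assumes I: "finite I" and f: "f \<in> borel_measurable (lborel_PiM I)"
  shows "(\<integral>\<^sup>+x. f (\<lambda>p\<in>I. x p + b p) \<partial>lborel_PiM I) = (\<integral>\<^sup>+x. f x \<partial>lborel_PiM I)"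
proof -
  have "finite S \<Longrightarrow> S \<subseteq> I \<Longrightarrow>
      (\<lambda>x. f (\<lambda>p\<in>I. x p + (if p \<in> S then b p else 0))) \<in> borel_measurable (lborel_PiM I) \<and>
      (\<integral>\<^sup>+x. f (\<lambda>p\<in>I. x p + (if p \<in> S then b p else 0)) \<partial>lborel_PiM I) =
      (\<integral>\<^sup>+x. f x \<partial>lborel_PiM I)" for S
  proof (induction S rule: finite_induct)
    case empty
    have eq: "f (\<lambda>p\<in>I. x p + (if p \<in> {} then b p else 0)) = f x"
      if "x \<in> space (lborel_PiM I)" for x
      using that by (intro arg_cong[where f = f]) (auto simp: space_PiM PiE_def extensional_def fun_eq_iff)
    show ?case
    proof
      show "(\<lambda>x. f (\<lambda>p\<in>I. x p + (if p \<in> {} then b p else 0))) \<in> borel_measurable (lborel_PiM I)"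
        by (rule measurable_cong[THEN iffD2, OF eq f])
    qed (rule nn_integral_cong[OF eq])
  next
    case (insert i S)
    define h where "h = (\<lambda>x. f (\<lambda>p\<in>I. x p + (if p \<in> S then b p else 0)))"
    have h: "h \<in> borel_measurable (lborel_PiM I)"
      "(\<integral>\<^sup>+x. h x \<partial>lborel_PiM I) = (\<integral>\<^sup>+x. f x \<partial>lborel_PiM I)"
      using insert.IH insert.prems unfolding h_def by blast+
    have eq: "f (\<lambda>p\<in>I. x p + (if p \<in> insert i S then b p else 0)) = h (x(i := 1 * x i + b i))" for x
      unfolding h_def using insert by (intro arg_cong[where f = f]) (auto simp: fun_eq_iff)
    have upd: "(\<lambda>x. x(i := 1 * x i + b i)) \<in>
        measurable (lborel_PiM I) (lborel_PiM I)"
      by (rule measurable_fun_upd[where J = I]) (use insert in auto)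
    show ?case
      unfolding eq using measurable_compose[OF upd h(1)]
        nn_integral_affine_coordinate[OF I, of i 1 h "\<lambda>_. b i"] h insert.prems
      by auto
  qed
  from conjunct2[OF this[OF I subset_refl]]
  have "(\<integral>\<^sup>+x. f (\<lambda>p\<in>I. x p + (if p \<in> I then b p else 0)) \<partial>lborel_PiM I) =
      (\<integral>\<^sup>+x. f x \<partial>lborel_PiM I)" .
  moreover have "(\<lambda>p\<in>I. x p + (if p \<in> I then b p else 0)) = (\<lambda>p\<in>I. x p + b p)" for x
    by (auto simp: fun_eq_iff)
  ultimately show ?thesis by (simp only:)
qed

section \<open>Linear substitutions and determinants\<close>

definition lin_image :: "nat \<Rightarrow> real mat \<Rightarrow> (nat \<Rightarrow> real) \<Rightarrow> nat \<Rightarrow> real" where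
  "lin_image m A x = (\<lambda>p\<in>{..<m}. \<Sum>q<m. A $$ (p, q) * x q)"

text \<open>Elementary in two senses: as a linear map it changes only coordinate \<open>k\<close>,
  which becomes a linear form, and multiplication by it on the right is a column operation.\<close>

definition row_replacement :: "nat \<Rightarrow> nat \<Rightarrow> (nat \<Rightarrow> 'a) \<Rightarrow> 'a::comm_ring_1 mat" where
  "row_replacement m k v = mat m m (\<lambda>(p, q). if p = k then v q else if p = q then 1 else 0)"

lemma row_replacement_carrier [simp]: "row_replacement m k v \<in> carrier_mat m m"
  by (simp add: row_replacement_def)

text \<open>A permutation other than the identity moves some index different from \<open>k\<close>.
  In that row the matrix agrees with the identity, so the Leibniz term contains a zero
  factor.\<close>

lemma det_row_replacement:
  fixes v :: "nat \<Rightarrow> 'a::comm_ring_1"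
  assumes k: "k < m"
  shows "det (row_replacement m k v) = v k"
proof -
  have "det (row_replacement m k v) =
      (\<Sum>p\<in>{p. p permutes {0..<m}}. signof p * (\<Prod>i=0..<m. row_replacement m k v $$ (i, p i)))"
    by (rule det_def') simp
  also have "\<dots> = (\<Sum>p\<in>{p. p permutes {0..<m}}. if p = id then v k else 0)"
  proof (rule sum.cong[OF refl])
    fix p assume "p \<in> {p. p permutes {0..<m}}"
    then have p: "p permutes {0..<m}" by simp
    show "signof p * (\<Prod>i=0..<m. row_replacement m k v $$ (i, p i)) = (if p = id then v k else 0)"
    proof (cases "p = id")
      case True
      have "(\<Prod>i=0..<m. row_replacement m k v $$ (i, p i)) = (\<Prod>i=0..<m. if i = k then v k else 1)"
        using True by (intro prod.cong) (auto simp: row_replacement_def)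
      then show ?thesis using True k by (simp add: sign_id)
    next
      case False
      have "\<exists>i. i \<noteq> k \<and> p i \<noteq> i"
      proof (rule ccontr)
        assume neg: "\<not> ?thesis"
        then have "p k = k" using permutes_inj[OF p] by (metis injD)
        with neg have "p = id" by (auto simp: fun_eq_iff)
        with False show False by simp
      qed
      then obtain i where i: "i \<noteq> k" "p i \<noteq> i" by blast
      then have "i \<in> {0..<m}" "p i \<in> {0..<m}"
        using p permutes_not_in[OF p, of i] permutes_in_image[OF p, of i] by auto
      then have "row_replacement m k v $$ (i, p i) = 0"
        using i by (auto simp: row_replacement_def)
      then have "(\<Prod>i=0..<m. row_replacement m k v $$ (i, p i)) = 0"
        using \<open>i \<in> _\<close> by (intro prod_zero) auto
      then show ?thesis using False by simp
    qed
  qed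
  also have "\<dots> = v k"
    using permutes_id[of "{0..<m}"] by (simp add: finite_permutations)
  finally show ?thesis .
qed

lemma index_mult_row_replacement:
  fixes v :: "nat \<Rightarrow> 'a::comm_ring_1"
  assumes A: "A \<in> carrier_mat m m" and k: "k < m" and p: "p < m" and q: "q < m"
  shows "(A * row_replacement m k v) $$ (p, q) = A $$ (p, k) * v q + (if q = k then 0 else A $$ (p, q))"
proof -
  have "(A * row_replacement m k v) $$ (p, q) =
      (\<Sum>r<m. A $$ (p, r) * (if r = k then v q else if r = q then 1 else 0))"
    using A p q unfolding row_replacement_def
    by (auto simp: scalar_prod_def lessThan_atLeast0 intro!: sum.cong)
  also have "\<dots> = (\<Sum>r<m. (if r = k then A $$ (p, k) * v q else 0) +
      (if r = q then (if q = k then 0 else A $$ (p, q)) else 0))"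
    by (rule sum.cong) auto
  also have "\<dots> = A $$ (p, k) * v q + (if q = k then 0 else A $$ (p, q))"
    using k q by (simp add: sum.distrib)
  finally show ?thesis .
qed

lemma lin_image_mult_row_replacement:
  assumes A: "A \<in> carrier_mat m m" and k: "k < m"
  shows "lin_image m (A * row_replacement m k v) x = lin_image m A (x(k := \<Sum>q<m. v q * x q))"
proof -
  have "(\<Sum>q<m. (A * row_replacement m k v) $$ (p, q) * x q) =
      (\<Sum>q<m. A $$ (p, q) * (x(k := \<Sum>q<m. v q * x q)) q)" if p: "p < m" for p
  proof -
    have "(\<Sum>q<m. (A * row_replacement m k v) $$ (p, q) * x q) =
       (\<Sum>q<m. A $$ (p, k) * (v q * x q) + (if q = k then 0 else A $$ (p, q) * x q))"
      using A k p
      by (intro sum.cong refl) (simp add: index_mult_row_replacement algebra_simps del: index_mult_mat)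
    also have "\<dots> = A $$ (p, k) * (\<Sum>q<m. v q * x q) + (\<Sum>q<m. if q = k then 0 else A $$ (p, q) * x q)"
      by (simp add: sum.distrib sum_distrib_left)
    also have "\<dots> = (\<Sum>q<m. (if q = k then A $$ (p, k) * (\<Sum>q<m. v q * x q) else 0) +
        (if q = k then 0 else A $$ (p, q) * x q))"
      using k by (simp add: sum.distrib)
    also have "\<dots> = (\<Sum>q<m. A $$ (p, q) * (x(k := \<Sum>q<m. v q * x q)) q)"
      by (rule sum.cong) auto
    finally show ?thesis .
  qed
  then show ?thesis by (auto simp: lin_image_def fun_eq_iff)
qed

lemma measurable_lin_image [measurable]:
  "lin_image m A \<in> measurable (lborel_PiM {..<m}) (lborel_PiM {..<m})"
  unfolding lin_image_def by measurable

text \<open>The change of variables formula, stated for integrands and not for sets so that an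
  integrand may itself contain a further substitution.\<close>

definition scales_volume :: "nat \<Rightarrow> real mat \<Rightarrow> bool" where
  "scales_volume m A \<longleftrightarrow> (\<forall>f \<in> borel_measurable (lborel_PiM {..<m}).
     (\<integral>\<^sup>+x. f (lin_image m A x) \<partial>lborel_PiM {..<m}) =
     ennreal (1 / \<bar>det A\<bar>) * (\<integral>\<^sup>+x. f x \<partial>lborel_PiM {..<m}))"

text \<open>The elementary factor alters a single coordinate, so it contributes exactly
  \<open>1 / \<bar>v k\<bar>\<close>, which can be divided out. This carries the formula from a
  matrix simplified by a column operation back to the original one.\<close>

lemma scales_volume_cancel_row_replacement:
  assumes A: "A \<in> carrier_mat m m" and k: "k < m" and vk: "v k \<noteq> 0"
    and good: "scales_volume m (A * row_replacement m k v)"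
  shows "scales_volume m A"
  unfolding scales_volume_def
proof
  fix f :: "(nat \<Rightarrow> real) \<Rightarrow> ennreal"
  assume f: "f \<in> borel_measurable (lborel_PiM {..<m})"
  let ?L = "lborel_PiM {..<m}"
  have det: "det (A * row_replacement m k v) = det A * v k"
    using det_mult[OF A row_replacement_carrier] det_row_replacement[OF k, of v] by simp
  define g where "g = (\<lambda>x :: nat \<Rightarrow> real. \<Sum>q\<in>{..<m} - {k}. v q * x q)"
  have split: "(\<Sum>q<m. v q * x q) = v k * x k + g x" for x
    unfolding g_def using k by (subst sum.remove[of _ k]) auto
  have g: "g \<in> borel_measurable ?L" unfolding g_def by measurable
  have g_upd: "g (x(k := y)) = g x" for x y
    unfolding g_def by (rule sum.cong) auto
  have mf: "(\<lambda>x. f (lin_image m A x)) \<in> borel_measurable ?L"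
    using measurable_compose[OF measurable_lin_image f] .
  have "ennreal (1 / \<bar>det A * v k\<bar>) * (\<integral>\<^sup>+x. f x \<partial>?L) =
      (\<integral>\<^sup>+x. f (lin_image m A (x(k := v k * x k + g x))) \<partial>?L)"
    using good f unfolding scales_volume_def det lin_image_mult_row_replacement[OF A k] split by simp
  also have "\<dots> = ennreal (1 / \<bar>v k\<bar>) * (\<integral>\<^sup>+x. f (lin_image m A x) \<partial>?L)"
    using nn_integral_affine_coordinate[OF _ _ vk mf g g_upd] k by simp
  finally have eq: "ennreal (1 / \<bar>v k\<bar>) * (\<integral>\<^sup>+x. f (lin_image m A x) \<partial>?L) =
      ennreal (1 / \<bar>det A * v k\<bar>) * (\<integral>\<^sup>+x. f x \<partial>?L)" ..
  have "ennreal \<bar>v k\<bar> * ennreal (1 / \<bar>v k\<bar>) = 1"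
    using vk by (simp add: ennreal_mult'[symmetric])
  moreover have "ennreal \<bar>v k\<bar> * ennreal (1 / \<bar>det A * v k\<bar>) = ennreal (1 / \<bar>det A\<bar>)"
    using vk by (simp add: ennreal_mult'[symmetric] abs_mult)
  ultimately show "(\<integral>\<^sup>+x. f (lin_image m A x) \<partial>?L) = ennreal (1 / \<bar>det A\<bar>) * (\<integral>\<^sup>+x. f x \<partial>?L)"
    using arg_cong[OF eq, of "\<lambda>z. ennreal \<bar>v k\<bar> * z"] by (simp add: mult.assoc[symmetric])
qed

lemma scales_volume_one: "scales_volume m (1\<^sub>m m)"
proof -
  have "lin_image m (1\<^sub>m m) x = x" if "x \<in> space (lborel_PiM {..<m})" for x
  proof -
    have "(\<Sum>q<m. 1\<^sub>m m $$ (p, q) * x q) = x p" if "p < m" for p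
    proof -
      have "(\<Sum>q<m. 1\<^sub>m m $$ (p, q) * x q) = (\<Sum>q<m. if q = p then x p else 0)"
        using that by (intro sum.cong) auto
      then show ?thesis using that by simp
    qed
    then show ?thesis
      using that by (auto simp: lin_image_def fun_eq_iff space_PiM PiE_def extensional_def)
  qed
  then show ?thesis
    unfolding scales_volume_def by (auto cong: nn_integral_cong_simp)
qed

text \<open>Column operations turn the rows of the matrix into unit vectors one at a time.\<close>

lemma scales_volume_if_unit_rows:
  assumes "k \<le> m" "A \<in> carrier_mat m m" "det A \<noteq> 0"
    and "\<And>i j. i < k \<Longrightarrow> j < m \<Longrightarrow> A $$ (i, j) = (if i = j then 1 else 0)"
  shows "scales_volume m A"
  using assms
proof (induction k arbitrary: A rule: inc_induct)
  case base
  then have "A = 1\<^sub>m m" by (intro eq_matI) auto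
  then show ?case by (simp add: scales_volume_one)
next
  case (step k)
  note k = \<open>k < m\<close> and A = \<open>A \<in> carrier_mat m m\<close>
  have *: "scales_volume m A"
    if A: "A \<in> carrier_mat m m" "det A \<noteq> 0"
      and unit: "\<And>i j. i < k \<Longrightarrow> j < m \<Longrightarrow> A $$ (i, j) = (if i = j then 1 else 0)"
      and pivot: "A $$ (k, k) \<noteq> 0" for A
  proof -
    \<comment> \<open>Column \<open>k\<close> is divided by the pivot, and multiples of it are
      subtracted from the other columns, so that row \<open>k\<close> becomes a unit vector.\<close>
    define v where "v = (\<lambda>q. if q = k then 1 / A $$ (k, k) else - A $$ (k, q) / A $$ (k, k))"
    have "scales_volume m (A * row_replacement m k v)"
    proof (rule step.IH)
      show "A * row_replacement m k v \<in> carrier_mat m m"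
        using A(1) row_replacement_carrier by (rule mult_carrier_mat)
      show "det (A * row_replacement m k v) \<noteq> 0"
        using A pivot det_mult[OF A(1) row_replacement_carrier] det_row_replacement[OF k, of v]
        by (simp add: v_def)
      show "(A * row_replacement m k v) $$ (i, j) = (if i = j then 1 else 0)"
        if "i < Suc k" "j < m" for i j
        using that k pivot unit[of i]
        by (cases "i = k") (auto simp: index_mult_row_replacement[OF A(1) k] v_def simp del: index_mult_mat)
    qed
    then show ?thesis
      using pivot by (intro scales_volume_cancel_row_replacement[OF A(1) k]) (auto simp: v_def)
  qed
  show ?case
  proof (cases "A $$ (k, k) = 0")
    case False
    with * step.prems show ?thesis by blast
  next
    case True
    have "\<exists>j<m. k < j \<and> A $$ (k, j) \<noteq> 0"
    proof (rule ccontr)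
      assume neg: "\<not> ?thesis"
      \<comment> \<open>If row \<open>k\<close> vanished from the diagonal on, it would be a
        combination of the unit rows above it; \<open>w\<close> records this dependence as a kernel
        vector of the transpose.\<close>
      define w where "w = vec m (\<lambda>i. if i = k then 1 else if i < k then - A $$ (k, i) else 0)"
      have "transpose_mat A *\<^sub>v w = 0\<^sub>v m"
      proof (rule eq_vecI)
        fix j assume "j < dim_vec (0\<^sub>v m)"
        then have j: "j < m" by simp
        have "(transpose_mat A *\<^sub>v w) $ j = (\<Sum>i<m. A $$ (i, j) * w $ i)"
          using A j by (auto simp: scalar_prod_def w_def lessThan_atLeast0 intro!: sum.cong)
        also have "\<dots> = (\<Sum>i<m. (if i = k then A $$ (k, j) else 0) +
            (if i = j then (if j < k then - A $$ (k, j) else 0) else 0))"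
          using j step.prems(3) by (intro sum.cong) (auto simp: w_def)
        also have "\<dots> = A $$ (k, j) + (if j < k then - A $$ (k, j) else 0)"
          using j k by (simp add: sum.distrib)
        also have "\<dots> = 0" using neg j True by (cases j k rule: linorder_cases) auto
        finally show "(transpose_mat A *\<^sub>v w) $ j = 0\<^sub>v m $ j" using j by simp
      qed (use A in auto)
      moreover have "w \<in> carrier_vec m" "w \<noteq> 0\<^sub>v m"
      proof -
        show "w \<in> carrier_vec m" by (simp add: w_def)
        have "w $ k \<noteq> 0\<^sub>v m $ k" using k by (simp add: w_def)
        then show "w \<noteq> 0\<^sub>v m" by metis
      qed
      ultimately have "det (transpose_mat A) = 0"
        using det_0_iff_vec_prod_zero[of "transpose_mat A" m] A by auto
      then show False using det_transpose[OF A] step.prems by simp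
    qed
    then obtain j where j: "j < m" "k < j" "A $$ (k, j) \<noteq> 0" by blast
    \<comment> \<open>Right multiplication with this choice adds column \<open>j\<close> to column
      \<open>k\<close>. The pivot becomes non-zero, and the unit rows above are unaffected because
      \<open>j\<close> lies to the right of their ones.\<close>
    define v where "v = (\<lambda>q. if q = j \<or> q = k then 1 else 0 :: real)"
    let ?B = "A * row_replacement m j v"
    have B: "?B \<in> carrier_mat m m"
      using A row_replacement_carrier by (rule mult_carrier_mat)
    have "scales_volume m ?B"
    proof (rule *)
      show "?B \<in> carrier_mat m m" by fact
      show "det ?B \<noteq> 0"
        using A step.prems det_mult[OF A row_replacement_carrier] det_row_replacement[OF j(1), of v]
        by (simp add: v_def)
      show "?B $$ (i, l) = (if i = l then 1 else 0)" if "i < k" "l < m" for i l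
        using that k j step.prems(3)
        by (auto simp: index_mult_row_replacement[OF A j(1)] v_def simp del: index_mult_mat)
      show "?B $$ (k, k) \<noteq> 0"
        using k j True by (simp add: index_mult_row_replacement[OF A j(1)] v_def del: index_mult_mat)
    qed
    then show ?thesis
      by (intro scales_volume_cancel_row_replacement[OF A j(1)]) (auto simp: v_def)
  qed
qed

lemma nn_integral_lin_image:
  assumes "A \<in> carrier_mat m m" "det A \<noteq> 0" "f \<in> borel_measurable (lborel_PiM {..<m})"
  shows "(\<integral>\<^sup>+x. f (lin_image m A x) \<partial>lborel_PiM {..<m}) =
         ennreal (1 / \<bar>det A\<bar>) * (\<integral>\<^sup>+x. f x \<partial>lborel_PiM {..<m})"
  using scales_volume_if_unit_rows[of 0 m A] assms by (auto simp: scales_volume_def)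

section \<open>Volume of a product of intervals and discs\<close>

lemma nn_integral_disc:
  fixes r :: real
  assumes "r > 0"
  shows "(\<integral>\<^sup>+x. \<integral>\<^sup>+y. indicator {z :: real \<times> real. (fst z)\<^sup>2 + (snd z)\<^sup>2 < r\<^sup>2} (x, y) \<partial>lborel \<partial>lborel) =
    ennreal (pi * r\<^sup>2)"
proof -
  have eq: "{z :: real \<times> real. (fst z)\<^sup>2 + (snd z)\<^sup>2 < r\<^sup>2} = ball 0 r"
  proof -
    have "sqrt ((fst z)\<^sup>2 + (snd z)\<^sup>2) < r \<longleftrightarrow> (fst z)\<^sup>2 + (snd z)\<^sup>2 < r\<^sup>2" for z :: "real \<times> real"
      using assms real_less_rsqrt real_sqrt_less_iff by (metis abs_of_pos real_sqrt_abs)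
    then show ?thesis by (auto simp: dist_norm norm_prod_def)
  qed
  have "(\<integral>\<^sup>+x. \<integral>\<^sup>+y. indicator (ball (0 :: real \<times> real) r) (x, y) \<partial>lborel \<partial>lborel) =
      (\<integral>\<^sup>+z. indicator (ball (0 :: real \<times> real) r) z \<partial>(lborel \<Otimes>\<^sub>M lborel))"
    by (rule lborel.nn_integral_fst) (auto simp: lborel_prod intro!: borel_measurable_indicator)
  also have "\<dots> = emeasure lborel (ball (0 :: real \<times> real) r)"
    by (simp add: lborel_prod)
  also have "\<dots> = ennreal (pi * r\<^sup>2)"
    using assms by (simp add: emeasure_ball unit_ball_vol_2 power2_eq_square)
  finally show ?thesis by (simp only: eq)
qed

text \<open>\<open>c\<close> plays the part of complex conjugation on indices. A fixed index bounds
  one real coordinate; of two swapped indices the smaller carries the disc condition on both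
  coordinates and the larger carries none.\<close>

definition place_cond :: "('i::linorder \<Rightarrow> 'i) \<Rightarrow> ('i \<Rightarrow> real) \<Rightarrow> 'i \<Rightarrow> ('i \<Rightarrow> real) \<Rightarrow> bool" where
  "place_cond c r p y \<longleftrightarrow> (if c p = p then \<bar>y p\<bar> < r p
     else p < c p \<longrightarrow> (y p)\<^sup>2 + (y (c p))\<^sup>2 < (r p)\<^sup>2)"

definition place_vol :: "('i::linorder \<Rightarrow> 'i) \<Rightarrow> ('i \<Rightarrow> real) \<Rightarrow> 'i \<Rightarrow> real" where
  "place_vol c r p = (if c p = p then 2 * r p else if p < c p then pi * (r p)\<^sup>2 else 1)"

lemma measurable_place_cond:
  assumes "p \<in> I" "c p \<in> I"
  shows "(\<lambda>x. indicator {y. place_cond c r p y} x :: ennreal) \<in> borel_measurable (lborel_PiM I)"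
proof -
  have [measurable]: "(\<lambda>x. x p) \<in> borel_measurable (lborel_PiM I)"
    "(\<lambda>x. x (c p)) \<in> borel_measurable (lborel_PiM I)"
    using assms measurable_component_singleton[of _ I "\<lambda>_. lborel :: real measure"] by auto
  have "Measurable.pred (lborel_PiM I) (place_cond c r p)"
    unfolding place_cond_def by measurable
  then have "(\<lambda>x. if place_cond c r p x then 1 else 0 :: ennreal) \<in> borel_measurable (lborel_PiM I)"
    by measurable
  then show ?thesis by (simp add: indicator_def of_bool_def)
qed

text \<open>Each step removes the least index together with its partner under \<open>c\<close>. The
  rest is again closed under \<open>c\<close>, and minimality ensures that of a swapped pair the
  removed index \<open>p\<close> is the one carrying the disc.\<close>

lemma nn_integral_prod_place_cond:
  fixes c :: "'i::linorder \<Rightarrow> 'i"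
  assumes "finite I" and "\<And>p. p \<in> I \<Longrightarrow> c p \<in> I" "\<And>p. p \<in> I \<Longrightarrow> c (c p) = p"
    and "\<And>p. p \<in> I \<Longrightarrow> r p > 0"
  shows "(\<integral>\<^sup>+y. (\<Prod>p\<in>I. indicator {y. place_cond c r p y} y) \<partial>lborel_PiM I) =
         ennreal (\<Prod>p\<in>I. place_vol c r p)"
  using assms
proof (induction I rule: finite_psubset_induct)
  case (psubset I)
  let ?h = "\<lambda>p y. indicator {y. place_cond c r p y} y :: ennreal"
  have vol_nonneg: "place_vol c r q \<ge> 0" if "q \<in> I" for q
    using psubset.prems(3)[OF that] by (auto simp: place_vol_def)
  show ?case
  proof (cases "I = {}")
    case True
    then show ?thesis by (simp add: PiM_empty nn_integral_count_space_finite)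
  next
    case False
    define p where "p = Min I"
    have pI: "p \<in> I" and p_min: "\<And>q. q \<in> I \<Longrightarrow> p \<le> q"
      using False psubset.hyps by (auto simp: p_def)
    show ?thesis
    proof (cases "c p = p")
      case True
      define J where "J = I - {p}"
      have J: "J \<subset> I" "finite J" "p \<notin> J" "I = insert p J"
        using pI psubset.hyps by (auto simp: J_def)
      have cJ: "c q \<in> J" if "q \<in> J" for q
        using that psubset.prems(1,2)[of q] True by (auto simp: J_def)
      have IH: "(\<integral>\<^sup>+y. (\<Prod>q\<in>J. ?h q y) \<partial>lborel_PiM J) = ennreal (\<Prod>q\<in>J. place_vol c r q)"
        using J cJ psubset.prems by (intro psubset.IH) auto
      have meas: "(\<lambda>y. \<Prod>q\<in>I. ?h q y) \<in> borel_measurable (lborel_PiM I)"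
        using psubset.prems(1) by (intro borel_measurable_prod_ennreal measurable_place_cond) auto
      have measJ: "(\<lambda>y. \<Prod>q\<in>J. ?h q y) \<in> borel_measurable (lborel_PiM J)"
        using cJ by (intro borel_measurable_prod_ennreal measurable_place_cond) auto
      have upd: "(\<Prod>q\<in>I. ?h q (x(p := t))) = (\<Prod>q\<in>J. ?h q x) * indicator {- r p<..<r p} t" for x t
      proof -
        have "?h q (x(p := t)) = ?h q x" if "q \<in> J" for q
        proof -
          have "q \<noteq> p" "c q \<noteq> p" using that cJ[OF that] J(3) by auto
          then show ?thesis by (simp add: indicator_def place_cond_def)
        qed
        moreover have "?h p (x(p := t)) = indicator {- r p<..<r p} t"
          using True by (auto simp: indicator_def place_cond_def)
        ultimately show ?thesis
          unfolding J(4) using J by (simp add: mult.commute)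
      qed
      have "(\<integral>\<^sup>+y. (\<Prod>q\<in>I. ?h q y) \<partial>lborel_PiM I) =
          (\<integral>\<^sup>+x. \<integral>\<^sup>+t. (\<Prod>q\<in>I. ?h q (x(p := t))) \<partial>lborel \<partial>lborel_PiM J)"
        using meas J(2,3) unfolding J(4) by (rule lborel_PiM.product_nn_integral_insert[rotated 2])
      also have "\<dots> = (\<integral>\<^sup>+x. (\<Prod>q\<in>J. ?h q x) * ennreal (2 * r p) \<partial>lborel_PiM J)"
        using psubset.prems(3)[OF pI] by (simp add: upd nn_integral_cmult)
      also have "\<dots> = ennreal (\<Prod>q\<in>J. place_vol c r q) * ennreal (2 * r p)"
        by (simp add: nn_integral_multc[OF measJ] IH)
      also have "\<dots> = ennreal (\<Prod>q\<in>I. place_vol c r q)"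
        using J True psubset.prems(3)[OF pI] vol_nonneg
        by (simp add: place_vol_def ennreal_mult'[symmetric] mult.commute)
      finally show ?thesis .
    next
      case False
      define J where "J = I - {p, c p}"
      have cp: "p < c p" using p_min[of "c p"] psubset.prems(1)[OF pI] False by auto
      have ccp: "c (c p) = p" using psubset.prems(2)[OF pI] .
      have cpI: "c p \<in> I" using psubset.prems(1)[OF pI] .
      have J: "J \<subset> I" "finite J" "p \<notin> insert (c p) J" "c p \<notin> J" "I = insert p (insert (c p) J)"
        "finite (insert (c p) J)" "p \<notin> J"
        using pI cpI psubset.hyps False by (auto simp: J_def)
      have cJ: "c q \<in> J" if "q \<in> J" for q
        using that psubset.prems(1,2)[of q] ccp by (auto simp: J_def)
      have IH: "(\<integral>\<^sup>+y. (\<Prod>q\<in>J. ?h q y) \<partial>lborel_PiM J) = ennreal (\<Prod>q\<in>J. place_vol c r q)"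
        using J cJ psubset.prems by (intro psubset.IH) auto
      have meas: "(\<lambda>y. \<Prod>q\<in>I. ?h q y) \<in> borel_measurable (lborel_PiM I)"
        using psubset.prems(1) by (intro borel_measurable_prod_ennreal measurable_place_cond) auto
      have measJ: "(\<lambda>y. \<Prod>q\<in>J. ?h q y) \<in> borel_measurable (lborel_PiM J)"
        using cJ by (intro borel_measurable_prod_ennreal measurable_place_cond) auto
      let ?D = "{z :: real \<times> real. (fst z)\<^sup>2 + (snd z)\<^sup>2 < (r p)\<^sup>2}"
      have upd: "(\<Prod>q\<in>I. ?h q (x(c p := s, p := t))) = (\<Prod>q\<in>J. ?h q x) * indicator ?D (s, t)" for x s t
      proof -
        have "?h q (x(c p := s, p := t)) = ?h q x" if "q \<in> J" for q
        proof -
          have "q \<noteq> p" "c q \<noteq> p" "q \<noteq> c p" "c q \<noteq> c p" using that cJ[OF that] J by auto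
          then show ?thesis by (simp add: indicator_def place_cond_def)
        qed
        moreover have "?h p (x(c p := s, p := t)) = indicator ?D (s, t)"
          using cp by (auto simp: indicator_def place_cond_def add.commute)
        moreover have "?h (c p) (x(c p := s, p := t)) = 1"
          using cp ccp by (auto simp: indicator_def place_cond_def)
        ultimately show ?thesis
          unfolding J(5) using J by (simp add: mult.commute)
      qed
      have D_meas: "?D \<in> sets (lborel \<Otimes>\<^sub>M lborel)"
        unfolding lborel_prod sets_lborel
        by (intro borel_open open_Collect_less continuous_intros)
      have meas_t: "(\<lambda>t. indicator ?D (s, t) :: ennreal) \<in> borel_measurable lborel" for s
      proof -
        have "(\<lambda>t. indicator ?D (s, t) :: ennreal) = (\<lambda>t. indicator {t. s\<^sup>2 + t\<^sup>2 < (r p)\<^sup>2} t)"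
          by (auto simp: indicator_def)
        then show ?thesis by simp
      qed
      have meas_s: "(\<lambda>s. \<integral>\<^sup>+t. indicator ?D (s, t) \<partial>lborel) \<in> borel_measurable lborel"
        using D_meas by (intro lborel.borel_measurable_nn_integral) (simp add: case_prod_beta')
      let ?F = "\<lambda>x. \<integral>\<^sup>+t. (\<Prod>q\<in>I. ?h q (x(p := t))) \<partial>lborel"
      have meas2: "?F \<in> borel_measurable (Pi\<^sub>M (insert (c p) J) (\<lambda>_. lborel))"
      proof -
        have "(\<lambda>(x, t). x(p := t)) \<in>
          measurable (Pi\<^sub>M (insert (c p) J) (\<lambda>_. lborel :: real measure) \<Otimes>\<^sub>M lborel) (lborel_PiM I)"
          unfolding J(5) using measurable_add_dim[of p "insert (c p) J" "\<lambda>_. lborel :: real measure"] by simp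
        from measurable_compose[OF this meas]
        have "(\<lambda>(x, t). \<Prod>q\<in>I. ?h q (x(p := t))) \<in>
            borel_measurable (Pi\<^sub>M (insert (c p) J) (\<lambda>_. lborel) \<Otimes>\<^sub>M lborel)"
          by (simp add: case_prod_beta)
        then show ?thesis
          by (rule lborel.borel_measurable_nn_integral)
      qed
      have "(\<integral>\<^sup>+y. (\<Prod>q\<in>I. ?h q y) \<partial>lborel_PiM I) =
          (\<integral>\<^sup>+x. ?F x \<partial>Pi\<^sub>M (insert (c p) J) (\<lambda>_. lborel))"
        using lborel_PiM.product_nn_integral_insert[OF J(6,3), of "\<lambda>y. \<Prod>q\<in>I. ?h q y"] meas J(5)
        by simp
      also have "\<dots> = (\<integral>\<^sup>+x. \<integral>\<^sup>+s. ?F (x(c p := s)) \<partial>lborel \<partial>lborel_PiM J)"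
        using meas2 by (rule lborel_PiM.product_nn_integral_insert[OF J(2,4)])
      also have "\<dots> = (\<integral>\<^sup>+x. (\<Prod>q\<in>J. ?h q x) * ennreal (pi * (r p)\<^sup>2) \<partial>lborel_PiM J)"
        using psubset.prems(3)[OF pI]
        by (simp add: upd nn_integral_cmult meas_t meas_s nn_integral_disc)
      also have "\<dots> = ennreal (\<Prod>q\<in>J. place_vol c r q) * ennreal (pi * (r p)\<^sup>2)"
        by (simp add: nn_integral_multc[OF measJ] IH)
      also have "\<dots> = ennreal (\<Prod>q\<in>I. place_vol c r q)"
      proof -
        have "(\<Prod>q\<in>I. place_vol c r q) = place_vol c r p * (place_vol c r (c p) * (\<Prod>q\<in>J. place_vol c r q))"
          unfolding J(5) using J by simp
        also have "\<dots> = pi * (r p)\<^sup>2 * (\<Prod>q\<in>J. place_vol c r q)"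
          using cp ccp False by (auto simp: place_vol_def)
        finally show ?thesis by (simp add: ennreal_mult'[symmetric] ennreal_mult''[symmetric] mult.commute)
      qed
      finally show ?thesis .
    qed
  qed
qed

section \<open>Systems of linear forms in conjugate pairs\<close>

text \<open>The matrix of a system of linear forms, the form of index \<open>c p\<close> being conjugate to that of
  index \<open>p\<close>, is \<open>B * R\<close> where \<open>R\<close> has as rows the real parts of the forms with \<open>p \<le> c p\<close> and the
  imaginary parts of the others.\<close>

definition real_form :: "nat \<Rightarrow> (nat \<Rightarrow> nat) \<Rightarrow> complex mat \<Rightarrow> real mat" where
  "real_form m c S = mat m m (\<lambda>(p, q). if p \<le> c p then Re (S $$ (p, q)) else Im (S $$ (p, q)))"

lemma card_moved_eq:
  fixes c :: "nat \<Rightarrow> nat"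
  assumes c: "\<And>p. p < m \<Longrightarrow> c p < m" "\<And>p. p < m \<Longrightarrow> c (c p) = p"
  shows "card {p. p < m \<and> c p \<noteq> p} = 2 * card {p. p < m \<and> p < c p}"
proof -
  have "{p. p < m \<and> c p \<noteq> p} = {p. p < m \<and> p < c p} \<union> {p. p < m \<and> c p < p}" by auto
  moreover have "card ({p. p < m \<and> p < c p} \<union> {p. p < m \<and> c p < p}) =
      card {p. p < m \<and> p < c p} + card {p. p < m \<and> c p < p}"
    by (rule card_Un_disjoint) auto
  moreover have "bij_betw c {p. p < m \<and> p < c p} {p. p < m \<and> c p < p}"
    by (rule bij_betwI[where g = c]) (use c in auto)
  then have "card {p. p < m \<and> p < c p} = card {p. p < m \<and> c p < p}"
    by (rule bij_betw_same_card)
  ultimately show ?thesis by simp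
qed

text \<open>The power of 2 is the modulus of \<open>det B\<close>. It is read off from the product
  of \<open>B\<close> with its conjugate transpose, a diagonal matrix with entry 2 at each moved
  index and 1 at each fixed one, so the rows need not be rearranged into blocks of size 2.\<close>

lemma cmod_det_real_form:
  fixes c :: "nat \<Rightarrow> nat"
  assumes S: "S \<in> carrier_mat m m"
    and c: "\<And>p. p < m \<Longrightarrow> c p < m" "\<And>p. p < m \<Longrightarrow> c (c p) = p"
    and conj: "\<And>p q. p < m \<Longrightarrow> q < m \<Longrightarrow> S $$ (c p, q) = cnj (S $$ (p, q))"
  shows "cmod (det S) = 2 ^ card {p. p < m \<and> p < c p} * \<bar>det (real_form m c S)\<bar>"
proof -
  interpret cnj: comm_ring_hom cnj by unfold_locales auto
  let ?R = "real_form m c S"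
  \<comment> \<open>The sign in \<open>- \<i>\<close> is due to the larger index of a pair holding
    the imaginary part of the conjugate form, which is minus that of the form at the smaller
    index.\<close>
  define B where "B = mat m m (\<lambda>(p, q). if q = p then (if p \<le> c p then 1 else \<i>)
      else if q = c p then (if p < c p then - \<i> else 1) else 0)"
  have B: "B \<in> carrier_mat m m" by (simp add: B_def)
  have R: "?R \<in> carrier_mat m m" by (simp add: real_form_def)
  have sumB: "(\<Sum>r<m. B $$ (p, r) * X r) =
      B $$ (p, p) * X p + (if c p = p then 0 else B $$ (p, c p) * X (c p))" if "p < m" for p X
  proof -
    have "(\<Sum>r<m. B $$ (p, r) * X r) = (\<Sum>r<m. (if r = p then B $$ (p, p) * X p else 0) +
        (if r = c p then (if c p = p then 0 else B $$ (p, c p) * X (c p)) else 0))"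
      using that by (intro sum.cong) (auto simp: B_def)
    then show ?thesis using that c(1)[OF that] by (simp add: sum.distrib)
  qed
  have SBR: "S = B * map_mat complex_of_real ?R"
  proof (rule eq_matI)
    fix p q assume "p < dim_row (B * map_mat complex_of_real ?R)" "q < dim_col (B * map_mat complex_of_real ?R)"
    then have p: "p < m" and q: "q < m" using B R by auto
    have cp: "c p < m" "c (c p) = p" using c p by auto
    have cS: "S $$ (c p, q) = cnj (S $$ (p, q))" using conj p q by simp
    have "(B * map_mat complex_of_real ?R) $$ (p, q) = (\<Sum>r<m. B $$ (p, r) * complex_of_real (?R $$ (r, q)))"
      using B R p q by (auto simp: scalar_prod_def lessThan_atLeast0 intro!: sum.cong)
    also have "\<dots> = S $$ (p, q)"
      unfolding sumB[OF p] using p q cp cS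
      by (cases "p" "c p" rule: linorder_cases) (auto simp: B_def real_form_def complex_eq_iff)
    finally show "S $$ (p, q) = (B * map_mat complex_of_real ?R) $$ (p, q)" ..
  qed (use S B R in auto)
  define D where "D = mat m m (\<lambda>(p, q). if p = q then (if c p = p then 1 else 2) else 0 :: complex)"
  have D: "D \<in> carrier_mat m m" by (simp add: D_def)
  have "B * transpose_mat (map_mat cnj B) = D"
  proof (rule eq_matI)
    fix p q assume "p < dim_row D" "q < dim_col D"
    then have p: "p < m" and q: "q < m" using D by auto
    have cp: "c p < m" "c (c p) = p" and cq: "c q < m" "c (c q) = q" using c p q by auto
    have "(B * transpose_mat (map_mat cnj B)) $$ (p, q) = (\<Sum>r<m. B $$ (p, r) * cnj (B $$ (q, r)))"
      using B p q by (auto simp: scalar_prod_def lessThan_atLeast0 intro!: sum.cong)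
    also have "\<dots> = D $$ (p, q)"
    proof -
      consider "q = p" | "q \<noteq> p" "q = c p" | "q \<noteq> p" "q \<noteq> c p" by blast
      then show ?thesis
      proof cases
        case 3
        then have "c q \<noteq> p" "c p \<noteq> c q" using cp cq by auto
        with 3 show ?thesis unfolding sumB[OF p] using p q cp by (auto simp: B_def D_def)
      qed (unfold sumB[OF p], use p q cp in \<open>auto simp: B_def D_def\<close>)
    qed
    finally show "(B * transpose_mat (map_mat cnj B)) $$ (p, q) = D $$ (p, q)" .
  qed (use B D in auto)
  then have "det B * cnj (det B) = det D"
    using det_mult[OF B, of "transpose_mat (map_mat cnj B)"] B
      det_transpose[of "map_mat cnj B" m] cnj.hom_det[of B] by simp
  also have "det D = (\<Prod>p<m. if c p = p then 1 else 2)"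
  proof -
    have "det D = prod_list (diag_mat D)"
      by (rule det_upper_triangular[OF _ D]) (auto simp: D_def)
    also have "\<dots> = (\<Prod>p<m. D $$ (p, p))"
      using D by (simp add: prod_list_diag_prod lessThan_atLeast0)
    finally show ?thesis by (simp add: D_def)
  qed
  also have "\<dots> = 2 ^ card {p. p < m \<and> c p \<noteq> p}"
  proof -
    have "{..<m} \<inter> {p. c p \<noteq> p} = {p. p < m \<and> c p \<noteq> p}" by auto
    then show ?thesis
      by (subst prod.If_cases) (auto simp: Collect_neg_eq[symmetric])
  qed
  also have "\<dots> = (2 ^ card {p. p < m \<and> p < c p})\<^sup>2"
    by (simp add: card_moved_eq[OF c] power_mult[symmetric] mult.commute)
  finally have "complex_of_real ((cmod (det B))\<^sup>2) =
      complex_of_real ((2 ^ card {p. p < m \<and> p < c p})\<^sup>2)"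
    using complex_norm_square[of "det B"] by simp
  then have "(cmod (det B))\<^sup>2 = (2 ^ card {p. p < m \<and> p < c p})\<^sup>2"
    by (simp only: of_real_eq_iff)
  then have "cmod (det B) = 2 ^ card {p. p < m \<and> p < c p}"
    by (simp add: power2_eq_iff_nonneg)
  moreover have "det S = det B * complex_of_real (det ?R)"
    using det_mult[OF B, of "map_mat complex_of_real ?R"] R SBR of_real_hom.hom_det[of ?R] by simp
  ultimately show ?thesis by (simp add: norm_mult)
qed

text \<open>Conjugate forms have equal modulus and equal radii, so the inequality at the larger
  index of a pair follows from that of its partner.\<close>

lemma linear_forms_small_iff:
  fixes c :: "nat \<Rightarrow> nat"
  assumes S: "S \<in> carrier_mat m m"
    and c: "\<And>p. p < m \<Longrightarrow> c p < m" "\<And>p. p < m \<Longrightarrow> c (c p) = p"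
    and conj: "\<And>p q. p < m \<Longrightarrow> q < m \<Longrightarrow> S $$ (c p, q) = cnj (S $$ (p, q))"
    and r: "\<And>p. p < m \<Longrightarrow> r p > 0" "\<And>p. p < m \<Longrightarrow> r (c p) = r p"
  shows "(\<forall>p<m. cmod (\<Sum>q<m. S $$ (p, q) * complex_of_real (x q)) < r p) \<longleftrightarrow>
    (\<forall>p<m. place_cond c r p (lin_image m (real_form m c S) x))"
proof -
  define s where "s = (\<lambda>p. \<Sum>q<m. S $$ (p, q) * complex_of_real (x q))"
  define y where "y = lin_image m (real_form m c S) x"
  have y: "y p = (if p \<le> c p then Re (s p) else Im (s p))" if "p < m" for p
    using that by (simp add: y_def lin_image_def real_form_def s_def)
  have s: "s (c p) = cnj (s p)" if "p < m" for p
    unfolding s_def using that by (simp add: conj)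
  have place: "place_cond c r p y \<longleftrightarrow> p \<le> c p \<longrightarrow> cmod (s p) < r p" if p: "p < m" for p
  proof (cases "c p" p rule: linorder_cases)
    case less
    then show ?thesis by (simp add: place_cond_def)
  next
    case equal
    then have "cnj (s p) = s p" using s[OF p] by simp
    then have "Im (s p) = 0" by (simp add: complex_eq_iff)
    then have "cmod (s p) = \<bar>Re (s p)\<bar>" by (simp add: cmod_def)
    then show ?thesis using equal y[OF p] by (simp add: place_cond_def)
  next
    case greater
    have "(y p)\<^sup>2 + (y (c p))\<^sup>2 = (cmod (s p))\<^sup>2"
      using greater c[OF p] y[OF p] y[of "c p"] s[OF p] by (simp add: cmod_power2)
    moreover have "(cmod (s p))\<^sup>2 < (r p)\<^sup>2 \<longleftrightarrow> cmod (s p) < r p"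
      using power2_less_imp_less[of "cmod (s p)" "r p"] power_strict_mono[of "cmod (s p)" "r p" 2]
        r(1)[OF p] by auto
    ultimately show ?thesis using greater by (simp add: place_cond_def)
  qed
  have "(\<forall>p<m. cmod (s p) < r p) \<longleftrightarrow> (\<forall>p<m. place_cond c r p y)"
  proof
    assume R: "\<forall>p<m. place_cond c r p y"
    show "\<forall>p<m. cmod (s p) < r p"
    proof (intro allI impI)
      fix p assume p: "p < m"
      show "cmod (s p) < r p"
      proof (cases "p \<le> c p")
        case True
        then show ?thesis using R place p by simp
      next
        case False
        then have "cmod (s (c p)) < r (c p)"
          using R place[of "c p"] c[OF p] by auto
        then show ?thesis using s[OF p] r(2)[OF p] by simp
      qed
    qed
  qed (auto simp: place)
  then show ?thesis by (simp add: s_def y_def)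
qed

text \<open>By \<open>cmod_det_real_form\<close> the determinant of the real forms is
  \<open>cmod (det S)\<close> divided by 2 for every pair, and substitution puts it into the
  denominator.\<close>

lemma volume_linear_forms:
  fixes c :: "nat \<Rightarrow> nat"
  assumes S: "S \<in> carrier_mat m m" and det: "det S \<noteq> 0"
    and c: "\<And>p. p < m \<Longrightarrow> c p < m" "\<And>p. p < m \<Longrightarrow> c (c p) = p"
    and conj: "\<And>p q. p < m \<Longrightarrow> q < m \<Longrightarrow> S $$ (c p, q) = cnj (S $$ (p, q))"
    and r: "\<And>p. p < m \<Longrightarrow> r p > 0" "\<And>p. p < m \<Longrightarrow> r (c p) = r p"
  defines "K \<equiv> {x \<in> space (lborel_PiM {..<m}).
      \<forall>p<m. cmod (\<Sum>q<m. S $$ (p, q) * complex_of_real (x q)) < r p}"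
  shows "K \<in> sets (lborel_PiM {..<m})"
    and "emeasure (lborel_PiM {..<m}) K =
      ennreal (2 ^ card {p. p < m \<and> p < c p} * (\<Prod>p<m. place_vol c r p) / cmod (det S))"
proof -
  let ?L = "lborel_PiM {..<m}"
  let ?R = "real_form m c S"
  have [measurable]: "(\<lambda>x. x q) \<in> borel_measurable ?L" if "q < m" for q
    using that measurable_component_singleton[of q "{..<m}" "\<lambda>_. lborel :: real measure"] by auto
  have 1: "(\<lambda>x. cmod (\<Sum>q<m. S $$ (p, q) * complex_of_real (x q))) \<in> borel_measurable ?L" for p
  proof -
    have "(\<lambda>x. S $$ (p, q) * complex_of_real (x q)) \<in> borel_measurable ?L" if "q \<in> {..<m}" for q
    proof -
      have "(\<lambda>t. S $$ (p, q) * complex_of_real t) \<in> borel_measurable borel"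
        by (intro borel_measurable_continuous_onI continuous_intros)
      then show ?thesis
        using that measurable_compose[of "\<lambda>x. x q" ?L borel] by auto
    qed
    then have "(\<lambda>x. \<Sum>q<m. S $$ (p, q) * complex_of_real (x q)) \<in> borel_measurable ?L"
      by (rule borel_measurable_sum)
    moreover have "cmod \<in> borel_measurable borel"
      by (intro borel_measurable_continuous_onI continuous_intros)
    ultimately show ?thesis by (rule measurable_compose)
  qed
  have "K = {x \<in> space ?L. \<forall>p\<in>{..<m}. cmod (\<Sum>q<m. S $$ (p, q) * complex_of_real (x q)) < r p}"
    by (auto simp: K_def)
  also have "\<dots> \<in> sets ?L"
    by (intro sets.sets_Collect_finite_All' sets.sets_Collect_finite_All borel_measurable_less 1) auto
  finally show K: "K \<in> sets ?L" .
  have R: "?R \<in> carrier_mat m m" by (simp add: real_form_def)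
  have detR: "cmod (det S) = 2 ^ card {p. p < m \<and> p < c p} * \<bar>det ?R\<bar>"
    by (rule cmod_det_real_form[OF S c conj])
  then have detR0: "det ?R \<noteq> 0" using det by auto
  let ?f = "\<lambda>y. \<Prod>p<m. indicator {y. place_cond c r p y} y :: ennreal"
  have f: "?f \<in> borel_measurable ?L"
    using c by (intro borel_measurable_prod_ennreal measurable_place_cond) auto
  have ind: "indicator K x = ?f (lin_image m ?R x)" if x: "x \<in> space ?L" for x
  proof -
    have "x \<in> K \<longleftrightarrow> (\<forall>p<m. place_cond c r p (lin_image m ?R x))"
      using linear_forms_small_iff[where c = c and r = r and x = x, OF S c conj r] x by (simp add: K_def)
    moreover have "?f y = (if \<forall>p<m. place_cond c r p y then 1 else 0)" for y
      by (auto simp: indicator_def intro!: prod.neutral)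
    ultimately show ?thesis by (simp add: indicator_def)
  qed
  have "emeasure ?L K = (\<integral>\<^sup>+x. indicator K x \<partial>?L)" using K by simp
  also have "\<dots> = (\<integral>\<^sup>+x. ?f (lin_image m ?R x) \<partial>?L)"
    by (rule nn_integral_cong) (rule ind)
  also have "\<dots> = ennreal (1 / \<bar>det ?R\<bar>) * (\<integral>\<^sup>+y. ?f y \<partial>?L)"
    by (rule nn_integral_lin_image[OF R detR0 f])
  also have "(\<integral>\<^sup>+y. ?f y \<partial>?L) = ennreal (\<Prod>p<m. place_vol c r p)"
    using c r by (intro nn_integral_prod_place_cond) auto
  also have "ennreal (1 / \<bar>det ?R\<bar>) * \<dots> =
      ennreal (2 ^ card {p. p < m \<and> p < c p} * (\<Prod>p<m. place_vol c r p) / cmod (det S))"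
    using detR0 by (simp add: detR ennreal_mult'[symmetric])
  finally show "emeasure ?L K = \<dots>" .
qed

section \<open>Minkowski's theorem\<close>

text \<open>Translate \<open>K\<close> by every \<open>u\<close> in \<open>C\<close>, cut the
  translates along unit cubes and move all pieces by integer vectors into the half-open unit cube.
  As their total measure exceeds 1, two pieces meet. Using several incongruent translates gains the
  factor \<open>card C\<close> without a fundamental domain of a finer lattice.\<close>

lemma blichfeldt:
  fixes C :: "(nat \<Rightarrow> real) set"
  assumes K: "K \<in> sets (lborel_PiM {..<m})" and C: "finite C"
    and incongruent: "\<And>u v. u \<in> C \<Longrightarrow> v \<in> C \<Longrightarrow> u \<noteq> v \<Longrightarrow> \<exists>p<m. u p - v p \<notin> \<int>"
    and large: "1 < of_nat (card C) * emeasure (lborel_PiM {..<m}) K"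
  shows "\<exists>u\<in>C. \<exists>v\<in>C. \<exists>x\<in>K. \<exists>y\<in>K. \<exists>z :: nat \<Rightarrow> int.
    (\<forall>p<m. x p - y p = u p - v p + of_int (z p)) \<and> (\<exists>p<m. x p \<noteq> y p)"
proof (rule ccontr)
  assume neg: "\<not> ?thesis"
  let ?L = "lborel_PiM {..<m}"
  define Z where "Z = ({..<m} \<rightarrow>\<^sub>E (UNIV :: int set))"
  \<comment> \<open>\<open>A u z\<close> is the piece of \<open>K\<close> that the shift by
    \<open>u + z\<close> moves into the unit cube, and \<open>T\<close> below is that piece after
    the shift.\<close>
  define A where "A = (\<lambda>u z. {x \<in> space ?L. x \<in> K \<and>
    (\<forall>p\<in>{..<m}. 0 \<le> x p + (u p + real_of_int (z p)) \<and> x p + (u p + real_of_int (z p)) < 1)})"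
  define T where "T = (\<lambda>u z. {x \<in> space ?L. (\<lambda>p\<in>{..<m}. x p - (u p + real_of_int (z p))) \<in> K \<and>
    (\<forall>p\<in>{..<m}. 0 \<le> x p \<and> x p < 1)})"
  have comp: "(\<lambda>x. x q) \<in> borel_measurable ?L" if "q \<in> {..<m}" for q
    using that measurable_component_singleton[of q "{..<m}" "\<lambda>_. lborel :: real measure"] by auto
  have Z: "countable Z" unfolding Z_def by (rule countable_PiE) auto
  have A_sets: "A u z \<in> sets ?L" for u z
  proof -
    have "{x \<in> space ?L. (\<forall>p\<in>{..<m}. 0 \<le> x p + (u p + real_of_int (z p)) \<and>
        x p + (u p + real_of_int (z p)) < 1)} \<in> sets ?L"
      by (intro sets.sets_Collect_finite_All sets.sets_Collect_conj borel_measurable_less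
          borel_measurable_le borel_measurable_add comp borel_measurable_const) auto
    then have "K \<inter> {x \<in> space ?L. (\<forall>p\<in>{..<m}. 0 \<le> x p + (u p + real_of_int (z p)) \<and>
        x p + (u p + real_of_int (z p)) < 1)} \<in> sets ?L"
      using K by blast
    moreover have "A u z = K \<inter> {x \<in> space ?L. (\<forall>p\<in>{..<m}. 0 \<le> x p + (u p + real_of_int (z p)) \<and>
        x p + (u p + real_of_int (z p)) < 1)}"
      by (auto simp: A_def)
    ultimately show ?thesis by simp
  qed
  have T_sets: "T u z \<in> sets ?L" for u z
  proof -
    have "(\<lambda>x. \<lambda>p\<in>{..<m}. x p - (u p + real_of_int (z p))) \<in> measurable ?L ?L"
      by (intro measurable_restrict) (simp add: comp)
    from measurable_sets[OF this K]
    have "(\<lambda>x. \<lambda>p\<in>{..<m}. x p - (u p + real_of_int (z p))) -` K \<inter> space ?L \<in> sets ?L" .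
    moreover have "{x \<in> space ?L. (\<forall>p\<in>{..<m}. 0 \<le> x p \<and> x p < 1)} \<in> sets ?L"
      by (intro sets.sets_Collect_finite_All sets.sets_Collect_conj borel_measurable_less
          borel_measurable_le comp borel_measurable_const) auto
    moreover have "T u z = ((\<lambda>x. \<lambda>p\<in>{..<m}. x p - (u p + real_of_int (z p))) -` K \<inter> space ?L) \<inter>
        {x \<in> space ?L. (\<forall>p\<in>{..<m}. 0 \<le> x p \<and> x p < 1)}"
      by (auto simp: T_def)
    ultimately show ?thesis by auto
  qed
  have TA: "emeasure ?L (T u z) = emeasure ?L (A u z)" for u z
  proof -
    have "indicator (T u z) (\<lambda>p\<in>{..<m}. x p + (u p + real_of_int (z p))) =
        (indicator (A u z) x :: ennreal)" if x: "x \<in> space ?L" for x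
    proof -
      have "(\<lambda>q\<in>{..<m}. (\<lambda>p\<in>{..<m}. x p + (u p + real_of_int (z p))) q - (u q + real_of_int (z q))) = x"
        using x by (auto simp: fun_eq_iff space_PiM PiE_def extensional_def)
      moreover have "(\<lambda>p\<in>{..<m}. x p + (u p + real_of_int (z p))) \<in> space ?L"
        by (auto simp: space_PiM)
      ultimately have "(\<lambda>p\<in>{..<m}. x p + (u p + real_of_int (z p))) \<in> T u z \<longleftrightarrow> x \<in> A u z"
        using x unfolding T_def A_def by simp
      then show ?thesis by (simp add: indicator_def)
    qed
    then have "(\<integral>\<^sup>+x. indicator (A u z) x \<partial>?L) =
        (\<integral>\<^sup>+x. indicator (T u z) (\<lambda>p\<in>{..<m}. x p + (u p + real_of_int (z p))) \<partial>?L)"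
      by (intro nn_integral_cong) simp
    also have "\<dots> = (\<integral>\<^sup>+x. indicator (T u z) x \<partial>?L)"
      by (rule nn_integral_translate_PiM) (use T_sets in auto)
    finally show ?thesis using T_sets A_sets by simp
  qed
  \<comment> \<open>A common point of two pieces comes from points \<open>k\<close> and
    \<open>l\<close> of \<open>K\<close> whose difference is \<open>v - u\<close> plus an integer
    vector. The negated claim leaves only \<open>k = l\<close>, and then \<open>u\<close> and
    \<open>v\<close> are congruent, hence equal.\<close>
  have sep: "u = v \<and> z = w"
    if uv: "u \<in> C" "v \<in> C" and zw: "z \<in> Z" "w \<in> Z" and x: "x \<in> T u z" "x \<in> T v w" for u v z w x
  proof -
    define k where "k = (\<lambda>p\<in>{..<m}. x p - (u p + real_of_int (z p)))"
    define l where "l = (\<lambda>p\<in>{..<m}. x p - (v p + real_of_int (w p)))"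
    have kl: "k \<in> K" "l \<in> K" using x by (auto simp: T_def k_def l_def)
    have diff: "k p - l p = v p - u p + of_int (w p - z p)" if "p < m" for p
      using that by (simp add: k_def l_def)
    have eq: "k p = l p" if "p < m" for p
    proof (rule ccontr)
      assume "k p \<noteq> l p"
      then have "\<exists>p<m. k p \<noteq> l p" using that by blast
      moreover have "\<forall>p<m. k p - l p = v p - u p + of_int (w p - z p)" using diff by blast
      ultimately have "\<exists>z :: nat \<Rightarrow> int. (\<forall>p<m. k p - l p = v p - u p + of_int (z p)) \<and> (\<exists>p<m. k p \<noteq> l p)"
        by (intro exI[of _ "\<lambda>p. w p - z p"] conjI)
      then show False using neg uv kl by blast
    qed
    have int: "u p - v p = of_int (w p - z p)" if "p < m" for p
      using diff[OF that] eq[OF that] by simp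
    have "u = v"
    proof (rule ccontr)
      assume "u \<noteq> v"
      then obtain p where "p < m" "u p - v p \<notin> \<int>" using incongruent uv by blast
      then show False using int[of p] by (metis Ints_of_int)
    qed
    moreover have "z p = w p" for p
    proof (cases "p < m")
      case True
      then show ?thesis using int[OF True] \<open>u = v\<close> by simp
    next
      case False
      then show ?thesis using zw by (auto simp: Z_def PiE_def extensional_def)
    qed
    ultimately show ?thesis by auto
  qed
  have KT: "emeasure ?L K = emeasure ?L (\<Union>z\<in>Z. T u z)" if u: "u \<in> C" for u
  proof -
    have "K = (\<Union>z\<in>Z. A u z)"
    proof
      show "K \<subseteq> (\<Union>z\<in>Z. A u z)"
      proof
        fix x assume x: "x \<in> K"
        define z where "z = (\<lambda>p\<in>{..<m}. - \<lfloor>x p + u p\<rfloor>)"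
        have "z \<in> Z" by (auto simp: z_def Z_def)
        moreover have "0 \<le> x p + (u p + real_of_int (z p)) \<and> x p + (u p + real_of_int (z p)) < 1"
          if "p < m" for p
          using that unfolding z_def by simp linarith
        moreover have "x \<in> space ?L" using sets.sets_into_space[OF K] x by blast
        ultimately show "x \<in> (\<Union>z\<in>Z. A u z)" using x by (auto simp: A_def)
      qed
    qed (auto simp: A_def)
    moreover have "disjoint_family_on (A u) Z"
      unfolding disjoint_family_on_def
    proof (intro ballI impI)
      fix z w assume zw: "z \<in> Z" "w \<in> Z" "z \<noteq> w"
      show "A u z \<inter> A u w = {}"
      proof (rule ccontr)
        assume "A u z \<inter> A u w \<noteq> {}"
        then obtain x where x: "x \<in> A u z" "x \<in> A u w" by blast
        have "z p = w p" for p
        proof (cases "p < m")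
          case True
          then show ?thesis using x unfolding A_def by simp (smt (verit) lessThan_iff of_int_less_iff of_int_1 of_int_add)
        next
          case False
          then show ?thesis using zw by (auto simp: Z_def PiE_def extensional_def)
        qed
        then show False using zw by auto
      qed
    qed
    ultimately have "emeasure ?L K = (\<integral>\<^sup>+z. emeasure ?L (A u z) \<partial>count_space Z)"
      using emeasure_UN_countable[of Z "A u" ?L] A_sets Z by auto
    also have "\<dots> = (\<integral>\<^sup>+z. emeasure ?L (T u z) \<partial>count_space Z)" by (simp add: TA)
    also have "\<dots> = emeasure ?L (\<Union>z\<in>Z. T u z)"
      using T_sets Z sep[OF u u]
      by (intro emeasure_UN_countable[symmetric]) (auto simp: disjoint_family_on_def)
    finally show ?thesis .
  qed
  have UT_sets: "(\<Union>z\<in>Z. T u z) \<in> sets ?L" for u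
    using Z T_sets by (intro sets.countable_UN') auto
  define Q where "Q = ({..<m} \<rightarrow>\<^sub>E {0..<1 :: real})"
  have "of_nat (card C) * emeasure ?L K = (\<Sum>u\<in>C. emeasure ?L K)" by simp
  also have "\<dots> = (\<Sum>u\<in>C. emeasure ?L (\<Union>z\<in>Z. T u z))"
    by (rule sum.cong) (auto simp: KT)
  also have "\<dots> = emeasure ?L (\<Union>u\<in>C. \<Union>z\<in>Z. T u z)"
    using C UT_sets sep by (intro sum_emeasure) (auto simp: disjoint_family_on_def)
  also have "\<dots> \<le> emeasure ?L Q"
  proof (rule emeasure_mono)
    show "Q \<in> sets ?L" unfolding Q_def by (rule sets_PiM_I_finite) auto
  qed (auto simp: T_def Q_def space_PiM PiE_iff extensional_def)
  also have "\<dots> = 1"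
    unfolding Q_def by (subst lborel_PiM.emeasure_PiM) auto
  finally show False using large by simp
qed

text \<open>Blichfeldt's lemma gives two points of the region with halved radii, and the triangle
  inequality bounds the forms at their difference. \<open>C\<close> need not be closed under any
  operation, which is why \<open>u\<close>, \<open>v\<close> and \<open>z\<close> are returned
  separately.\<close>

theorem minkowski_linear_forms:
  fixes c :: "nat \<Rightarrow> nat" and r :: "nat \<Rightarrow> real" and C :: "(nat \<Rightarrow> real) set"
  assumes S: "S \<in> carrier_mat m m" and det: "det S \<noteq> 0"
    and c: "\<And>p. p < m \<Longrightarrow> c p < m" "\<And>p. p < m \<Longrightarrow> c (c p) = p"
    and conj: "\<And>p q. p < m \<Longrightarrow> q < m \<Longrightarrow> S $$ (c p, q) = cnj (S $$ (p, q))"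
    and r: "\<And>p. p < m \<Longrightarrow> r p > 0" "\<And>p. p < m \<Longrightarrow> r (c p) = r p"
    and C: "finite C"
    and incongruent: "\<And>u v. u \<in> C \<Longrightarrow> v \<in> C \<Longrightarrow> u \<noteq> v \<Longrightarrow> \<exists>p<m. u p - v p \<notin> \<int>"
    and large: "cmod (det S) < card C * (\<Prod>p<m. r p) * (pi / 2) ^ card {p. p < m \<and> p < c p}"
  obtains u v and z :: "nat \<Rightarrow> int" where "u \<in> C" "v \<in> C"
    "\<exists>p<m. u p - v p + of_int (z p) \<noteq> 0"
    "\<And>p. p < m \<Longrightarrow> cmod (\<Sum>q<m. S $$ (p, q) * complex_of_real (u q - v q + of_int (z q))) < r p"
proof -
  let ?L = "lborel_PiM {..<m}"
  \<comment> \<open>Half the radii, because the vector sought is a difference of two points of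
    \<open>K\<close>.\<close>
  define h where "h = (\<lambda>p. r p / 2)"
  define N where "N = card {p. p < m \<and> p < c p}"
  define K where "K = {x \<in> space ?L. \<forall>p<m. cmod (\<Sum>q<m. S $$ (p, q) * complex_of_real (x q)) < h p}"
  have h: "\<And>p. p < m \<Longrightarrow> h p > 0" "\<And>p. p < m \<Longrightarrow> h (c p) = h p"
    using r by (auto simp: h_def)
  note vol = volume_linear_forms[where c = c and r = h, OF S det c conj h, folded K_def N_def]
  \<comment> \<open>A fixed index contributes \<open>2 * h p = r p\<close>. A pair contributes the
    area of a disc of radius \<open>r p / 2\<close>, which is \<open>pi / 4\<close> times the
    product of its two equal radii; with the factor 2 from the determinant this becomes
    \<open>pi / 2\<close>.\<close>
  have "2 ^ N * (\<Prod>p<m. place_vol c h p) = (\<Prod>p<m. r p) * (pi / 2) ^ N"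
  proof -
    let ?P = "{p. p < m \<and> p < c p}" and ?M = "{p. p < m \<and> c p < p}" and ?F = "{p. p < m \<and> c p = p}"
    have un: "{..<m} = ?F \<union> (?P \<union> ?M)" by auto
    have split: "(\<Prod>p<m. g p) = (\<Prod>p\<in>?F. g p) * ((\<Prod>p\<in>?P. g p) * (\<Prod>p\<in>?M. g p))" for g :: "nat \<Rightarrow> real"
    proof -
      have "(\<Prod>p<m. g p) = (\<Prod>p\<in>?F. g p) * (\<Prod>p\<in>?P \<union> ?M. g p)"
        unfolding un by (rule prod.union_disjoint) auto
      also have "(\<Prod>p\<in>?P \<union> ?M. g p) = (\<Prod>p\<in>?P. g p) * (\<Prod>p\<in>?M. g p)"
        by (rule prod.union_disjoint) auto
      finally show ?thesis .
    qed
    have "(\<Prod>p\<in>?M. r p) = (\<Prod>p\<in>?P. r p)"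
      by (rule prod.reindex_bij_witness[where i = c and j = c]) (use c r in auto)
    moreover have "(\<Prod>p\<in>?F. place_vol c h p) = (\<Prod>p\<in>?F. r p)"
      by (rule prod.cong) (auto simp: place_vol_def h_def)
    moreover have "(\<Prod>p\<in>?M. place_vol c h p) = 1"
      by (rule prod.neutral) (auto simp: place_vol_def)
    moreover have "(\<Prod>p\<in>?P. place_vol c h p) = (\<Prod>p\<in>?P. (pi / 4) * (r p * r p))"
      by (rule prod.cong) (auto simp: place_vol_def h_def power2_eq_square)
    then have "(\<Prod>p\<in>?P. place_vol c h p) = (pi / 4) ^ N * ((\<Prod>p\<in>?P. r p) * (\<Prod>p\<in>?P. r p))"
      by (simp only: prod.distrib prod_constant N_def)
    moreover have "(2::real) ^ N * (pi / 4) ^ N = (pi / 2) ^ N"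
      by (simp add: power_mult_distrib[symmetric])
    ultimately show ?thesis unfolding split by (simp add: mult.assoc[symmetric])
  qed
  then have "emeasure ?L K = ennreal ((\<Prod>p<m. r p) * (pi / 2) ^ N / cmod (det S))"
    using vol(2) by simp
  then have "of_nat (card C) * emeasure ?L K =
      ennreal (card C * ((\<Prod>p<m. r p) * (pi / 2) ^ N / cmod (det S)))"
    by (simp add: ennreal_of_nat_eq_real_of_nat ennreal_mult' [symmetric])
  moreover have "1 < card C * ((\<Prod>p<m. r p) * (pi / 2) ^ N / cmod (det S))"
    using large det by (simp add: N_def field_simps)
  ultimately have big: "1 < of_nat (card C) * emeasure ?L K"
    by (simp add: ennreal_less_iff flip: ennreal_1)
  have K_sets: "K \<in> sets ?L" using vol(1) by simp
  have "\<exists>u\<in>C. \<exists>v\<in>C. \<exists>x\<in>K. \<exists>y\<in>K. \<exists>z :: nat \<Rightarrow> int.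
      (\<forall>p<m. x p - y p = u p - v p + of_int (z p)) \<and> (\<exists>p<m. x p \<noteq> y p)"
    by (rule blichfeldt[OF K_sets C incongruent big])
  then obtain u v x y and z :: "nat \<Rightarrow> int" where uv: "u \<in> C" "v \<in> C" and K: "x \<in> K" "y \<in> K"
    and diff: "\<And>p. p < m \<Longrightarrow> x p - y p = u p - v p + of_int (z p)" and ne: "\<exists>p<m. x p \<noteq> y p"
    by (elim bexE exE conjE) blast
  show ?thesis
  proof (rule that[OF uv])
    show "\<exists>p<m. u p - v p + of_int (z p) \<noteq> 0"
      using ne diff by (metis eq_iff_diff_eq_0)
    fix p assume p: "p < m"
    have "(\<Sum>q<m. S $$ (p, q) * complex_of_real (u q - v q + of_int (z q))) =
        (\<Sum>q<m. S $$ (p, q) * complex_of_real (x q - y q))"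
      by (rule sum.cong) (simp_all only: diff lessThan_iff)
    also have "\<dots> = (\<Sum>q<m. S $$ (p, q) * complex_of_real (x q)) -
        (\<Sum>q<m. S $$ (p, q) * complex_of_real (y q))"
      by (simp add: sum_subtractf algebra_simps)
    also have "cmod \<dots> \<le> cmod (\<Sum>q<m. S $$ (p, q) * complex_of_real (x q)) +
        cmod (\<Sum>q<m. S $$ (p, q) * complex_of_real (y q))"
      by (rule norm_triangle_ineq4)
    also have "\<dots> < h p + h p"
      using K p unfolding K_def by (intro add_strict_mono) auto
    also have "h p + h p = r p" by (simp add: h_def)
    finally show "cmod (\<Sum>q<m. S $$ (p, q) * complex_of_real (u q - v q + of_int (z q))) < r p" .
  qed
qed

section \<open>Algebraic integers\<close>

abbreviation int_scale :: "int \<Rightarrow> 'a::comm_ring_1 \<Rightarrow> 'a" where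
  "int_scale k x \<equiv> of_int k * x"

interpretation int_module: Modules.module "int_scale :: int \<Rightarrow> 'a::comm_ring_1 \<Rightarrow> 'a"
  by unfold_locales (auto simp: algebra_simps)

text \<open>The relations make \<open>b\<close> an eigenvector of an integer matrix, whose
  characteristic polynomial is monic with integer coefficients.\<close>

lemma algebraic_int_eigenvalue:
  fixes x :: "'a::field_char_0" and M :: "nat \<Rightarrow> nat \<Rightarrow> int"
  assumes eq: "\<And>i. i < n \<Longrightarrow> x * b i = (\<Sum>j<n. of_int (M i j) * b j)"
    and nz: "i < n" "b i \<noteq> 0"
  shows "algebraic_int x"
proof -
  define A where "A = mat n n (\<lambda>(i, j). M i j)"
  let ?A = "map_mat of_int A :: 'a mat"
  define v where "v = vec n b"
  have A: "A \<in> carrier_mat n n" by (simp add: A_def)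
  have "?A *\<^sub>v v = x \<cdot>\<^sub>v v"
    by (rule eq_vecI)
      (auto simp: A_def v_def eq scalar_prod_def lessThan_atLeast0 intro!: sum.cong)
  moreover have "v \<noteq> 0\<^sub>v n"
    using nz by (metis index_vec index_zero_vec(1) v_def)
  ultimately have "eigenvalue ?A x"
    using A unfolding eigenvalue_def eigenvector_def
    by (intro exI[of _ v]) (auto simp: v_def)
  then have "poly (char_poly ?A) x = 0"
    using eigenvalue_root_char_poly[of ?A n x] A by simp
  moreover have "char_poly ?A = map_poly of_int (char_poly A)"
    by (rule of_int_hom.char_poly_hom[OF A])
  moreover have "lead_coeff (char_poly A) = 1"
    using degree_monic_char_poly[OF A] by simp
  ultimately show ?thesis
    unfolding algebraic_int_altdef_ipoly by auto
qed

text \<open>The generators may be dependent: any choice of integer coefficients gives a matrix as in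
  \<open>algebraic_int_eigenvalue\<close>, and \<open>b0\<close> guarantees that the eigenvector is
  non-zero.\<close>

lemma algebraic_int_if_span_stable:
  fixes x :: "'a::field_char_0"
  assumes fin: "finite B" and nz: "b0 \<in> B" "b0 \<noteq> 0"
    and stable: "\<And>b. b \<in> B \<Longrightarrow> x * b \<in> int_module.span B"
  shows "algebraic_int x"
proof -
  obtain f where f: "bij_betw f {..<card B} B"
    using ex_bij_betw_nat_finite[OF fin] by (auto simp: lessThan_atLeast0)
  have "\<exists>u. x * b = (\<Sum>a\<in>B. of_int (u a) * a)" if "b \<in> B" for b
    using stable[OF that] unfolding int_module.span_finite[OF fin] by auto
  then obtain u where u: "\<And>b. b \<in> B \<Longrightarrow> x * b = (\<Sum>a\<in>B. of_int (u b a) * a)" by metis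
  have fB: "f i \<in> B" if "i < card B" for i
    using f that by (auto simp: bij_betw_def)
  obtain i where i: "i < card B" "f i = b0"
    using f nz(1) unfolding bij_betw_def by (metis imageE lessThan_iff)
  show ?thesis
  proof (rule algebraic_int_eigenvalue[where n = "card B" and b = f])
    fix i assume "i < card B"
    then have "x * f i = (\<Sum>a\<in>B. of_int (u (f i) a) * a)" using u fB by blast
    also have "\<dots> = (\<Sum>j<card B. of_int (u (f i) (f j)) * f j)"
      by (rule sum.reindex_bij_betw[OF f, symmetric])
    finally show "x * f i = (\<Sum>j<card B. of_int ((\<lambda>i j. u (f i) (f j)) i j) * f j)" by simp
  qed (use i nz in auto)
qed

lemma int_span_stableD:
  assumes "\<And>b. b \<in> B \<Longrightarrow> x * b \<in> int_module.span B" "w \<in> int_module.span B"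
  shows "x * w \<in> int_module.span B"
  using assms(2)
proof (induction rule: int_module.span_induct_alt)
  case base
  then show ?case by (simp add: int_module.span_zero)
next
  case (step c y z)
  have "x * (of_int c * y + z) = of_int c * (x * y) + x * z"
    by (simp add: algebra_simps)
  then show ?case
    using int_module.span_add[OF int_module.span_scale[OF assms(1)[OF step(1)]] step(2)] by simp
qed

lemma algebraic_int_pow_eq:
  fixes x :: "'a::field_char_0"
  assumes "algebraic_int x"
  obtains d c where "d > 0" "x ^ d = (\<Sum>i<d. of_int (c i) * x ^ i)"
proof -
  from assms obtain p where p: "poly (map_poly of_int p) x = 0" "lead_coeff p = 1"
    unfolding algebraic_int_altdef_ipoly by blast
  let ?d = "degree p"
  have deg: "degree (map_poly (of_int :: int \<Rightarrow> 'a) p) = ?d"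
    by (rule of_int_hom.degree_map_poly_hom)
  have "(\<Sum>i\<le>?d. of_int (coeff p i) * x ^ i) = 0"
    using p(1) by (simp add: poly_altdef coeff_map_poly deg)
  then have eq: "x ^ ?d = (\<Sum>i<?d. of_int (- coeff p i) * x ^ i)"
    using p(2) by (simp add: lessThan_Suc_atMost[symmetric] sum_negf eq_neg_iff_add_eq_0 add.commute)
  moreover have "?d > 0"
    using eq by (cases "?d = 0") auto
  ultimately show ?thesis by (rule that[rotated])
qed

text \<open>The monomials in \<open>x\<close> and \<open>y\<close> with exponents below the degrees
  of two monic relations generate a group that both multiplications preserve, hence so do their sum
  and composite.\<close>

lemma algebraic_int_add_mult:
  fixes x y :: "'a::field_char_0"
  assumes "algebraic_int x" "algebraic_int y"
  shows "algebraic_int (x + y)" "algebraic_int (x * y)"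
proof -
  obtain d c where d: "d > 0" "x ^ d = (\<Sum>i<d. of_int (c i) * x ^ i)"
    using algebraic_int_pow_eq[OF assms(1)] by blast
  obtain e c' where e: "e > 0" "y ^ e = (\<Sum>i<e. of_int (c' i) * y ^ i)"
    using algebraic_int_pow_eq[OF assms(2)] by blast
  define B where "B = (\<lambda>(i, j). x ^ i * y ^ j) ` ({..<d} \<times> {..<e})"
  have fin: "finite B" by (simp add: B_def)
  have mem: "x ^ i * y ^ j \<in> int_module.span B" if "i < d" "j < e" for i j
    by (rule int_module.span_base) (use that in \<open>auto simp: B_def\<close>)
  have X: "x * b \<in> int_module.span B" if "b \<in> B" for b
  proof -
    from that obtain i j where ij: "i < d" "j < e" "b = x ^ i * y ^ j" by (auto simp: B_def)
    show ?thesis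
    proof (cases "Suc i < d")
      case True
      with mem[of "Suc i" j] ij show ?thesis by (simp add: mult_ac)
    next
      case False
      then have "Suc i = d" using ij by simp
      then have "x * b = x ^ d * y ^ j" using ij by auto
      also have "\<dots> = (\<Sum>k<d. of_int (c k) * (x ^ k * y ^ j))"
        unfolding d(2) sum_distrib_right by (intro sum.cong) (simp_all add: mult_ac)
      also have "\<dots> \<in> int_module.span B"
        using mem ij by (intro int_module.span_sum int_module.span_scale) auto
      finally show ?thesis .
    qed
  qed
  have Y: "y * b \<in> int_module.span B" if "b \<in> B" for b
  proof -
    from that obtain i j where ij: "i < d" "j < e" "b = x ^ i * y ^ j" by (auto simp: B_def)
    show ?thesis
    proof (cases "Suc j < e")
      case True
      with mem[of i "Suc j"] ij show ?thesis by (simp add: mult_ac)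
    next
      case False
      then have "Suc j = e" using ij by simp
      then have "y * b = x ^ i * y ^ e" using ij by auto
      also have "\<dots> = (\<Sum>k<e. of_int (c' k) * (x ^ i * y ^ k))"
        unfolding e(2) sum_distrib_left by (intro sum.cong) (simp_all add: mult_ac)
      also have "\<dots> \<in> int_module.span B"
        using mem ij by (intro int_module.span_sum int_module.span_scale) auto
      finally show ?thesis .
    qed
  qed
  have one: "1 \<in> B" unfolding B_def using d(1) e(1) by (auto intro!: image_eqI[of _ _ "(0, 0)"])
  show "algebraic_int (x + y)"
    by (rule algebraic_int_if_span_stable[OF fin one])
      (auto simp: distrib_right intro!: int_module.span_add X Y)
  show "algebraic_int (x * y)"
    by (rule algebraic_int_if_span_stable[OF fin one])
      (auto simp: mult.assoc intro!: int_span_stableD[OF X] Y)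
qed

lemmas algebraic_int_add = algebraic_int_add_mult(1)
  and algebraic_int_mult = algebraic_int_add_mult(2)

lemma algebraic_int_diff:
  "algebraic_int x \<Longrightarrow> algebraic_int y \<Longrightarrow> algebraic_int (x - y :: 'a::field_char_0)"
  using algebraic_int_add[of x "- y"] by simp

lemma algebraic_int_sum:
  "(\<And>i. i \<in> A \<Longrightarrow> algebraic_int (f i)) \<Longrightarrow> algebraic_int (\<Sum>i\<in>A. f i :: 'a::field_char_0)"
  by (induction A rule: infinite_finite_induct) (auto intro: algebraic_int_add)

lemma algebraic_int_prod:
  "(\<And>i. i \<in> A \<Longrightarrow> algebraic_int (f i)) \<Longrightarrow> algebraic_int (\<Prod>i\<in>A. f i :: 'a::field_char_0)"
  by (induction A rule: infinite_finite_induct) (auto intro: algebraic_int_mult)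

lemma algebraic_int_power:
  "algebraic_int x \<Longrightarrow> algebraic_int (x ^ n :: 'a::field_char_0)"
  by (induction n) (auto intro: algebraic_int_mult)

lemma algebraic_int_ipoly:
  "algebraic_int x \<Longrightarrow> algebraic_int (poly (map_poly of_int p) x :: 'a::field_char_0)"
  by (auto simp: poly_altdef coeff_map_poly intro!: algebraic_int_sum algebraic_int_mult algebraic_int_power)

lemma algebraic_int_det:
  fixes A :: "'a::field_char_0 mat"
  assumes A: "A \<in> carrier_mat n n" and int: "\<And>i j. i < n \<Longrightarrow> j < n \<Longrightarrow> algebraic_int (A $$ (i, j))"
  shows "algebraic_int (det A)"
proof -
  have "algebraic_int (\<Prod>i = 0..<n. A $$ (i, p i))" if "p permutes {0..<n}" for p
    using that by (intro algebraic_int_prod int) (auto dest: permutes_in_image)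
  then show ?thesis
    unfolding det_def'[OF A]
    by (intro algebraic_int_sum algebraic_int_mult) auto
qed

text \<open>The cofactor comes from splitting off the constant coefficient of an integer polynomial with root
  \<open>x\<close>.\<close>

lemma algebraic_dvd_int:
  fixes x :: "'a::field_char_0"
  assumes "algebraic x" "x \<noteq> 0"
  obtains q and d :: int where "d \<noteq> 0" "x * poly (map_poly of_int q) x = of_int d"
proof -
  obtain p where p: "coeff p 0 \<noteq> 0" "poly (map_poly of_int p) x = 0"
    using algebraicE'_nonzero[OF assms] by blast
  obtain a q where pq: "p = pCons a q" by (cases p)
  have "x * poly (map_poly of_int q) x = of_int (- a)"
    using p(2) by (simp add: pq of_int_hom.map_poly_pCons_hom eq_neg_iff_add_eq_0 add.commute)
  then show ?thesis using that[of "- a" q] p(1) by (simp add: pq)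
qed

lemma algebraic_int_dvd_int:
  fixes x :: "'a::field_char_0"
  assumes "algebraic_int x" "x \<noteq> 0"
  obtains y and d :: int where "d \<noteq> 0" "algebraic_int y" "x * y = of_int d"
  using algebraic_dvd_int[OF algebraic_int_imp_algebraic[OF assms(1)] assms(2)]
    algebraic_int_ipoly[OF assms(1)] by metis

section \<open>From algebraic integers to algebraic numbers\<close>

text \<open>Multiplying an integer relation of degree \<open>d\<close> and leading coefficient
  \<open>c\<close> by \<open>c ^ (d - 1)\<close> yields a monic relation for \<open>c * x\<close>,
  so the lower powers of \<open>c * x\<close> generate a stable group.\<close>

lemma algebraic_int_multiple:
  fixes x :: "'a::field_char_0"
  assumes "algebraic x"
  obtains m :: int where "m \<noteq> 0" "algebraic_int (of_int m * x)"
proof -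
  obtain p where p: "poly (map_poly of_int p) x = 0" "p \<noteq> 0"
    using algebraicE'[OF assms] by blast
  let ?d = "degree p" and ?c = "lead_coeff p"
  define y where "y = of_int ?c * x"
  define B where "B = (\<lambda>i. y ^ i) ` {..<?d}"
  have c: "?c \<noteq> 0" using p by simp
  have deg: "degree (map_poly (of_int :: int \<Rightarrow> 'a) p) = ?d"
    by (rule of_int_hom.degree_map_poly_hom)
  have "(\<Sum>i\<le>?d. of_int (coeff p i) * x ^ i) = 0"
    using p(1) by (simp add: poly_altdef coeff_map_poly deg)
  then have eq: "of_int ?c * x ^ ?d = (\<Sum>i<?d. of_int (- coeff p i) * x ^ i)"
    by (simp add: lessThan_Suc_atMost[symmetric] sum_negf eq_neg_iff_add_eq_0 add.commute)
  have d: "?d > 0" using eq c by (cases "?d = 0") auto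
  have "y ^ ?d = of_int (?c ^ (?d - 1)) * (of_int ?c * x ^ ?d)"
    using d by (cases ?d) (auto simp: y_def power_mult_distrib)
  also have "\<dots> = (\<Sum>i<?d. of_int (- coeff p i * ?c ^ (?d - 1 - i)) * y ^ i)"
    unfolding eq sum_distrib_left
  proof (rule sum.cong[OF refl])
    fix i assume "i \<in> {..<?d}"
    then have "?c ^ (?d - 1) = ?c ^ (?d - 1 - i) * ?c ^ i"
      by (simp add: power_add[symmetric])
    then show "of_int (?c ^ (?d - 1)) * (of_int (- coeff p i) * x ^ i) =
        of_int (- coeff p i * ?c ^ (?d - 1 - i)) * y ^ i"
      by (simp add: y_def power_mult_distrib)
  qed
  finally have top: "y ^ ?d = (\<Sum>i<?d. of_int (- coeff p i * ?c ^ (?d - 1 - i)) * y ^ i)" .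
  have mem: "y ^ i \<in> int_module.span B" if "i < ?d" for i
    by (rule int_module.span_base) (use that in \<open>auto simp: B_def\<close>)
  have "algebraic_int y"
  proof (rule algebraic_int_if_span_stable)
    show "finite B" "1 \<in> B" unfolding B_def using d by (auto intro!: image_eqI[of _ _ 0])
    fix b assume "b \<in> B"
    then obtain i where i: "i < ?d" "b = y ^ i" by (auto simp: B_def)
    show "y * b \<in> int_module.span B"
    proof (cases "Suc i < ?d")
      case True
      then show ?thesis using mem[of "Suc i"] i by simp
    next
      case False
      then have "y * b = y ^ ?d" using i by (metis Suc_lessI power_Suc)
      then show ?thesis
        unfolding \<open>y * b = y ^ ?d\<close> top using mem
        by (intro int_module.span_sum int_module.span_scale) auto
    qed
  qed auto
  then show ?thesis using that[OF c] by (simp add: y_def)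
qed

lemma algebraic_if_multiple:
  fixes x :: "'a::field_char_0"
  assumes "m \<noteq> 0" "algebraic (of_int m * x)"
  shows "algebraic x"
proof -
  obtain p where p: "poly (map_poly of_int p) (of_int m * x) = 0" "p \<noteq> 0"
    using algebraicE'[OF assms(2)] by blast
  define q where "q = pcompose p [:0, m:]"
  have "map_poly (of_int :: int \<Rightarrow> 'a) q = pcompose (map_poly of_int p) [:0, of_int m:]"
    unfolding q_def by (simp add: of_int_hom.map_poly_pcompose of_int_hom.map_poly_pCons_hom)
  then have "poly (map_poly of_int q) x = 0" using p(1) by (simp add: poly_pcompose mult.commute)
  moreover have "q \<noteq> 0" unfolding q_def using p(2) assms(1) by (simp add: pcompose_eq_0_iff)
  ultimately show ?thesis
    by (intro algebraicI[of "map_poly of_int q"]) (auto simp: coeff_map_poly)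
qed

text \<open>Clearing denominators reduces both claims to algebraic integers.\<close>

lemma algebraic_add_mult:
  fixes x y :: "'a::field_char_0"
  assumes "algebraic x" "algebraic y"
  shows "algebraic (x + y)" "algebraic (x * y)"
proof -
  obtain m where m: "m \<noteq> 0" "algebraic_int (of_int m * x)"
    using algebraic_int_multiple[OF assms(1)] .
  obtain n where n: "n \<noteq> 0" "algebraic_int (of_int n * y)"
    using algebraic_int_multiple[OF assms(2)] .
  have "algebraic_int (of_int n * (of_int m * x) + of_int m * (of_int n * y))"
    using m n by (intro algebraic_int_add algebraic_int_mult[of "of_int n" "of_int m * x"]
        algebraic_int_mult[of "of_int m" "of_int n * y"]) auto
  then have "algebraic (of_int (m * n) * (x + y))"
    by (simp add: algebra_simps algebraic_int_imp_algebraic)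
  then show "algebraic (x + y)" by (rule algebraic_if_multiple[rotated]) (use m n in auto)
  have "algebraic_int ((of_int m * x) * (of_int n * y))"
    by (rule algebraic_int_mult[OF m(2) n(2)])
  then have "algebraic (of_int (m * n) * (x * y))"
    by (simp add: algebra_simps algebraic_int_imp_algebraic)
  then show "algebraic (x * y)" by (rule algebraic_if_multiple[rotated]) (use m n in auto)
qed

section \<open>Minimal polynomials over the rationals and primitive elements\<close>

interpretation rat_vs: vector_space "rat_scale :: rat \<Rightarrow> 'a::field_char_0 \<Rightarrow> 'a"
  by unfold_locales (auto simp: rat_scale_def algebra_simps of_rat_add of_rat_mult)

abbreviation rpoly :: "rat poly \<Rightarrow> 'a::field_char_0 \<Rightarrow> 'a" where
  "rpoly p x \<equiv> poly (map_poly of_rat p) x"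

interpretation of_rat_poly_hom: map_poly_comm_ring_hom "of_rat :: rat \<Rightarrow> 'a::field_char_0" ..

lemma rpoly_simps [simp]:
  "rpoly (p + q) x = rpoly p x + rpoly q x"
  "rpoly (p - q) x = rpoly p x - rpoly q x"
  "rpoly (p * q) x = rpoly p x * rpoly q x"
  "rpoly (pCons a p) x = of_rat a + x * rpoly p x"
  "rpoly (smult a p) x = of_rat a * rpoly p x"
  "rpoly (monom a n) x = of_rat a * x ^ n"
  by (simp_all add: of_rat_poly_hom.hom_add of_rat_poly_hom.hom_minus of_rat_poly_hom.hom_mult
      of_rat_hom.map_poly_pCons_hom of_rat_hom.map_poly_hom_smult map_poly_monom poly_monom)

lemma rpoly_sum: "rpoly (\<Sum>i\<in>A. f i) x = (\<Sum>i\<in>A. rpoly (f i) x)"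
  by (induction A rule: infinite_finite_induct) auto

lemma rpoly_of_int_poly: "rpoly (map_poly of_int p) x = poly (map_poly of_int p) x"
  by (simp add: map_poly_map_poly o_def)

lemma algebraic_iff_rpoly: "algebraic x \<longleftrightarrow> (\<exists>p. p \<noteq> 0 \<and> rpoly p x = 0)"
proof
  assume "algebraic x"
  then obtain p where "p \<noteq> 0" "poly (map_poly of_int p) x = 0" by (rule algebraicE')
  then show "\<exists>p. p \<noteq> 0 \<and> rpoly p x = 0"
    by (intro exI[of _ "map_poly of_int p"]) (auto simp: rpoly_of_int_poly)
next
  assume "\<exists>p. p \<noteq> 0 \<and> rpoly p x = 0"
  then obtain p where "p \<noteq> 0" "rpoly p x = 0" by blast
  then show "algebraic x"
    by (intro algebraicI'[of "map_poly of_rat p"]) (auto simp: coeff_map_poly)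
qed

lemma algebraic_of_rat [simp]: "algebraic (of_rat q)"
  unfolding algebraic_iff_rpoly by (rule exI[of _ "[:- q, 1:]"]) (simp add: of_rat_minus)

text \<open>A generator of the ideal of rational polynomials vanishing at \<open>x\<close>, not
  normalised to be monic. Since \<open>p\<close> is rational, the same \<open>p\<close> can be
  attached to elements of different fields, in particular to \<open>x\<close> and its complex
  conjugates.\<close>

definition min_rat_poly :: "'a::field_char_0 \<Rightarrow> rat poly \<Rightarrow> bool" where
  "min_rat_poly x p \<longleftrightarrow> p \<noteq> 0 \<and> (\<forall>q. rpoly q x = 0 \<longleftrightarrow> p dvd q)"

lemma ex_min_rat_poly:
  assumes "algebraic x"
  obtains p where "min_rat_poly x p"
proof -
  let ?P = "\<lambda>p. p \<noteq> 0 \<and> rpoly p x = 0"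
  define p where "p = arg_min degree ?P"
  obtain p0 where "?P p0" using assms unfolding algebraic_iff_rpoly by blast
  then have p: "?P p" and least: "\<And>q. ?P q \<Longrightarrow> degree p \<le> degree q"
    using arg_min_nat_lemma[of ?P p0 degree] unfolding p_def by auto
  have "p dvd q" if "rpoly q x = 0" for q
  proof -
    have "rpoly (p * (q div p)) x + rpoly (q mod p) x = 0"
      using that by (metis mult_div_mod_eq rpoly_simps(1))
    then have "rpoly (q mod p) x = 0" using p by simp
    moreover have "q mod p = 0 \<or> degree (q mod p) < degree p" using p degree_mod_less by blast
    ultimately have "q mod p = 0" using least[of "q mod p"] by fastforce
    then show ?thesis by (simp add: dvd_eq_mod_eq_0)
  qed
  then have "min_rat_poly x p" using p by (auto simp: min_rat_poly_def elim!: dvdE)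
  then show ?thesis by (rule that)
qed

lemma min_rat_poly_algebraic: "min_rat_poly x p \<Longrightarrow> algebraic x"
  unfolding algebraic_iff_rpoly min_rat_poly_def by (meson dvd_refl)

lemma min_rat_poly_degree:
  assumes "min_rat_poly x p" shows "degree p > 0"
proof (rule ccontr)
  assume "\<not> ?thesis"
  moreover have "p \<noteq> 0" using assms by (simp add: min_rat_poly_def)
  ultimately have "p dvd 1" using is_unit_iff_degree[of p] by blast
  then have "rpoly 1 x = 0" using assms unfolding min_rat_poly_def by blast
  then show False by simp
qed

lemma min_rat_poly_pderiv:
  assumes "min_rat_poly x p" shows "rpoly (pderiv p) x \<noteq> 0"
  using assms not_dvd_pderiv[of p] min_rat_poly_degree[OF assms] by (auto simp: min_rat_poly_def)

text \<open>All conjugates share one minimal polynomial because \<open>p\<close> is irreducible: in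
  \<open>p = p' * s\<close> one factor vanishes at \<open>x\<close>, and \<open>s\<close> has too
  small a degree to be a multiple of \<open>p\<close>.\<close>

lemma min_rat_poly_root:
  fixes x :: "'a::field_char_0" and z :: "'b::field_char_0"
  assumes p: "min_rat_poly x p" and z: "rpoly p z = 0"
  shows "min_rat_poly z p"
proof -
  have p0: "p \<noteq> 0" using p by (simp add: min_rat_poly_def)
  then have "algebraic z" using z by (auto simp: algebraic_iff_rpoly)
  then obtain p' where p': "min_rat_poly z p'" by (rule ex_min_rat_poly)
  then obtain s where s: "p = p' * s" using z by (auto simp: min_rat_poly_def)
  have "rpoly p x = 0" using p by (simp add: min_rat_poly_def)
  then have "p dvd p' \<or> p dvd s" using p by (auto simp: s min_rat_poly_def)
  moreover have "\<not> p dvd s"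
  proof
    assume "p dvd s"
    then have "degree p \<le> degree s" using p0 s by (intro dvd_imp_degree_le) auto
    then show False using min_rat_poly_degree[OF p'] p0 by (auto simp: s degree_mult_eq)
  qed
  ultimately have "p dvd p'" by blast
  then have "p dvd q \<longleftrightarrow> p' dvd q" for q using s by (metis dvd_trans dvd_triv_left)
  then show ?thesis using p' p0 by (simp add: min_rat_poly_def)
qed

section \<open>Subfields and simple extensions of the rationals\<close>

definition is_subfield :: "'a::field set \<Rightarrow> bool" where
  "is_subfield K \<longleftrightarrow> 0 \<in> K \<and> 1 \<in> K \<and> (\<forall>x\<in>K. \<forall>y\<in>K. x + y \<in> K \<and> x * y \<in> K) \<and>
     (\<forall>x\<in>K. - x \<in> K \<and> inverse x \<in> K)"

lemma subfieldD:
  assumes "is_subfield K"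
  shows "0 \<in> K" "1 \<in> K" "x \<in> K \<Longrightarrow> y \<in> K \<Longrightarrow> x + y \<in> K" "x \<in> K \<Longrightarrow> y \<in> K \<Longrightarrow> x * y \<in> K"
    "x \<in> K \<Longrightarrow> - x \<in> K" "x \<in> K \<Longrightarrow> inverse x \<in> K"
    "x \<in> K \<Longrightarrow> y \<in> K \<Longrightarrow> x - y \<in> K" "x \<in> K \<Longrightarrow> y \<in> K \<Longrightarrow> x / y \<in> K"
    "x \<in> K \<Longrightarrow> x ^ n \<in> K"
proof -
  show "0 \<in> K" "1 \<in> K" and add: "\<And>x y. x \<in> K \<Longrightarrow> y \<in> K \<Longrightarrow> x + y \<in> K"
    and mult: "\<And>x y. x \<in> K \<Longrightarrow> y \<in> K \<Longrightarrow> x * y \<in> K"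
    and uminus: "\<And>x. x \<in> K \<Longrightarrow> - x \<in> K" and inv: "\<And>x. x \<in> K \<Longrightarrow> inverse x \<in> K"
    using assms by (auto simp: is_subfield_def)
  then show "x \<in> K \<Longrightarrow> y \<in> K \<Longrightarrow> x - y \<in> K"
    by (metis add_uminus_conv_diff)
  show "x \<in> K \<Longrightarrow> y \<in> K \<Longrightarrow> x / y \<in> K"
    using mult inv by (simp add: divide_inverse)
  show "x \<in> K \<Longrightarrow> x ^ n \<in> K"
    using \<open>1 \<in> K\<close> mult by (induction n) auto
qed

lemma subfield_sum:
  "is_subfield K \<Longrightarrow> (\<And>i. i \<in> A \<Longrightarrow> f i \<in> K) \<Longrightarrow> (\<Sum>i\<in>A. f i) \<in> K"
  by (induction A rule: infinite_finite_induct) (auto simp: subfieldD)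

lemma subfield_of_int: "is_subfield K \<Longrightarrow> of_int k \<in> K"
proof -
  assume K: "is_subfield K"
  have "of_nat n \<in> K" for n by (induction n) (use K in \<open>auto simp: subfieldD\<close>)
  then show ?thesis by (cases k) (use K in \<open>auto simp del: of_nat_Suc intro: subfieldD\<close>)
qed

lemma subfield_of_rat:
  assumes K: "is_subfield (K :: 'a::field_char_0 set)" shows "of_rat q \<in> K"
proof (cases q)
  case (Fract a b)
  then show ?thesis using subfield_of_int[OF K] subfieldD[OF K] by (simp add: of_rat_rat)
qed

lemma subfield_rpoly:
  assumes K: "is_subfield (K :: 'a::field_char_0 set)" and x: "x \<in> K" shows "rpoly p x \<in> K"
  by (induction p) (use x in \<open>auto simp: subfieldD[OF K] subfield_of_rat[OF K]\<close>)

definition adjoin_rat :: "'a::field_char_0 \<Rightarrow> 'a set" where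
  "adjoin_rat x = range (\<lambda>p. rpoly p x)"

lemma adjoin_rat_mem [simp]: "rpoly p x \<in> adjoin_rat x"
  by (auto simp: adjoin_rat_def)

lemma adjoin_rat_self: "x \<in> adjoin_rat x"
  using adjoin_rat_mem[of "[:0, 1:]" x] by simp

text \<open>Closure under inverses is automatic: by \<open>algebraic_dvd_int\<close> a non-zero
  algebraic \<open>x\<close> times an integer polynomial in \<open>x\<close> is a non-zero integer,
  so the inverse is a rational multiple of that polynomial value.\<close>

lemma is_subfieldI_algebraic:
  assumes alg: "\<And>x. x \<in> K \<Longrightarrow> algebraic x" and rat: "\<And>q. of_rat q \<in> K"
    and ring: "\<And>x y. x \<in> K \<Longrightarrow> y \<in> K \<Longrightarrow> x + y \<in> K" "\<And>x y. x \<in> K \<Longrightarrow> y \<in> K \<Longrightarrow> x * y \<in> K"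
  shows "is_subfield (K :: 'a::field_char_0 set)"
proof -
  have int: "poly (map_poly of_int p) x \<in> K" if "x \<in> K" for p :: "int poly" and x
  proof -
    have "rpoly q x \<in> K" for q
      using rat[of 0] by (induction q) (auto intro: ring rat that)
    from this[of "map_poly of_int p"] show ?thesis by (simp only: rpoly_of_int_poly)
  qed
  have "- x \<in> K" if "x \<in> K" for x
    using ring(2)[OF rat[of "- 1"] that] by simp
  moreover have "inverse x \<in> K" if x: "x \<in> K" for x
  proof (cases "x = 0")
    case False
    obtain q d where d: "d \<noteq> 0" "x * poly (map_poly of_int q) x = of_int d"
      using algebraic_dvd_int[OF alg[OF x] False] .
    have "inverse x = of_rat (1 / of_int d) * poly (map_poly of_int q) x"
      using d False by (simp add: of_rat_divide field_simps)
    then show ?thesis using ring(2)[OF rat int[OF x]] by simp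
  qed (use x in auto)
  ultimately show ?thesis
    using rat[of 0] rat[of 1] ring by (auto simp: is_subfield_def)
qed

lemma is_subfield_adjoin_rat:
  assumes "algebraic (x :: 'a::field_char_0)" shows "is_subfield (adjoin_rat x)"
proof (rule is_subfieldI_algebraic)
  fix y z assume "y \<in> adjoin_rat x" "z \<in> adjoin_rat x"
  then obtain p q where pq: "y = rpoly p x" "z = rpoly q x" by (auto simp: adjoin_rat_def)
  show "y + z \<in> adjoin_rat x" "y * z \<in> adjoin_rat x"
    using adjoin_rat_mem[of "p + q" x] adjoin_rat_mem[of "p * q" x] pq by simp_all
next
  fix y assume "y \<in> adjoin_rat x"
  then obtain p where p: "y = rpoly p x" by (auto simp: adjoin_rat_def)
  have "algebraic (rpoly p x)"
  proof (induction p)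
    case (pCons a p)
    then show ?case using assms by (auto intro!: algebraic_add_mult)
  qed auto
  then show "algebraic y" using p by simp
next
  show "of_rat q \<in> adjoin_rat x" for q
    using adjoin_rat_mem[of "[:q:]" x] by simp
qed

text \<open>The degree bound in the hypothesis lets the lemma serve both for the powers below the
  degree of an algebraic element and for arbitrarily many powers of a transcendental one.\<close>

lemma powers_independent:
  fixes x :: "'a::field_char_0"
  assumes "\<And>q. q \<noteq> 0 \<Longrightarrow> degree q < n \<Longrightarrow> rpoly q x \<noteq> 0"
  shows "inj_on (\<lambda>i. x ^ i) {..<n}" "rat_vs.independent ((\<lambda>i. x ^ i) ` {..<n})"
proof -
  show inj: "inj_on (\<lambda>i. x ^ i) {..<n}"
  proof (rule inj_onI, rule ccontr)
    fix i j assume ij: "i \<in> {..<n}" "j \<in> {..<n}" "x ^ i = x ^ j" "i \<noteq> j"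
    let ?q = "monom 1 i - monom 1 j :: rat poly"
    have "coeff ?q i = 1" using ij by simp
    then have "?q \<noteq> 0" by (metis coeff_0 zero_neq_one)
    moreover have "degree ?q < n"
      using ij by (intro degree_diff_less) (auto simp: degree_monom_eq)
    moreover have "rpoly ?q x = 0" using ij by (simp add: poly_monom)
    ultimately show False using assms by blast
  qed
  show "rat_vs.independent ((\<lambda>i. x ^ i) ` {..<n})"
  proof (rule rat_vs.independent_if_scalars_zero)
    fix f y assume sum: "(\<Sum>y\<in>(\<lambda>i. x ^ i) ` {..<n}. rat_scale (f y) y) = 0"
      and y: "y \<in> (\<lambda>i. x ^ i) ` {..<n}"
    obtain i where i: "i < n" "y = x ^ i" using y by blast
    define q where "q = (\<Sum>i<n. monom (f (x ^ i)) i)"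
    have "rpoly q x = 0"
      using sum by (simp add: q_def rpoly_sum sum.reindex[OF inj] rat_scale_def o_def poly_monom)
    moreover have "q = 0 \<or> degree q < n"
    proof -
      have "degree q \<le> n - 1" unfolding q_def
        by (rule degree_sum_le) (auto intro: order_trans[OF degree_monom_le])
      then show ?thesis using i by auto
    qed
    ultimately have "q = 0" using assms by blast
    moreover have "coeff q i = f (x ^ i)" using i by (simp add: q_def coeff_sum)
    ultimately show "f y = 0" using i by simp
  qed auto
qed

lemma min_rat_poly_powers_independent:
  assumes "min_rat_poly x p"
  shows "inj_on (\<lambda>i. x ^ i) {..<degree p}" "rat_vs.independent ((\<lambda>i. x ^ i) ` {..<degree p})"
proof -
  have "rpoly q x \<noteq> 0" if "q \<noteq> 0" "degree q < degree p" for q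
    using that assms dvd_imp_degree_le[of p q] by (auto simp: min_rat_poly_def)
  then show "inj_on (\<lambda>i. x ^ i) {..<degree p}" "rat_vs.independent ((\<lambda>i. x ^ i) ` {..<degree p})"
    by (rule powers_independent; blast)+
qed

lemma rpoly_mod_min:
  assumes "min_rat_poly x p"
  shows "rpoly (q mod p) x = rpoly q x"
proof -
  have "rpoly q x = rpoly (p * (q div p) + q mod p) x" by simp
  also have "\<dots> = rpoly (q mod p) x"
    unfolding rpoly_simps using assms by (simp add: min_rat_poly_def)
  finally show ?thesis ..
qed

lemma adjoin_rat_sum_powers:
  assumes p: "min_rat_poly x p" and y: "y \<in> adjoin_rat x"
  obtains c where "y = (\<Sum>i<degree p. of_rat (c i) * x ^ i)"
proof -
  from y obtain q where q: "y = rpoly q x" by (auto simp: adjoin_rat_def)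
  let ?r = "q mod p"
  have r: "y = rpoly ?r x" using q rpoly_mod_min[OF p] by simp
  have deg: "degree ?r < degree p"
    using min_rat_poly_degree[OF p] by (metis degree_0 degree_mod_less less_zeroE neq0_conv)
  have "y = (\<Sum>i\<le>degree ?r. of_rat (coeff ?r i) * x ^ i)"
    unfolding r by (simp add: poly_altdef coeff_map_poly of_rat_hom.degree_map_poly_hom)
  also have "\<dots> = (\<Sum>i<degree p. of_rat (coeff ?r i) * x ^ i)"
    using deg by (intro sum.mono_neutral_left) (auto simp: coeff_eq_0)
  finally show ?thesis by (rule that)
qed

lemma span_powers_eq:
  assumes p: "min_rat_poly x p"
  shows "rat_vs.span ((\<lambda>i. x ^ i) ` {..<degree p}) = adjoin_rat x"
proof
  show "rat_vs.span ((\<lambda>i. x ^ i) ` {..<degree p}) \<subseteq> adjoin_rat x"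
  proof
    fix y assume "y \<in> rat_vs.span ((\<lambda>i. x ^ i) ` {..<degree p})"
    then show "y \<in> adjoin_rat x"
    proof (induction rule: rat_vs.span_induct_alt)
      case base
      show ?case using adjoin_rat_mem[of 0 x] by simp
    next
      case (step c y z)
      then obtain i q where "y = x ^ i" "z = rpoly q x" by (auto simp: adjoin_rat_def)
      then have "rat_scale c y + z = rpoly (monom c i + q) x" by (simp add: rat_scale_def poly_monom)
      then show ?case by (simp only: adjoin_rat_mem)
    qed
  qed
  show "adjoin_rat x \<subseteq> rat_vs.span ((\<lambda>i. x ^ i) ` {..<degree p})"
  proof
    fix y assume "y \<in> adjoin_rat x"
    then obtain c where y: "y = (\<Sum>i<degree p. of_rat (c i) * x ^ i)"
      by (rule adjoin_rat_sum_powers[OF p])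
    have "(\<Sum>i<degree p. rat_scale (c i) (x ^ i)) \<in> rat_vs.span ((\<lambda>i. x ^ i) ` {..<degree p})"
      by (intro rat_vs.span_sum rat_vs.span_scale rat_vs.span_base) auto
    then show "y \<in> rat_vs.span ((\<lambda>i. x ^ i) ` {..<degree p})" by (simp add: y rat_scale_def)
  qed
qed

section \<open>Polynomials over a subfield and the primitive element theorem\<close>

definition polys_over :: "'a::field set \<Rightarrow> 'a poly set" where
  "polys_over K = {p. \<forall>i. coeff p i \<in> K}"

lemma polys_over_pCons [simp]: "pCons a p \<in> polys_over K \<longleftrightarrow> a \<in> K \<and> p \<in> polys_over K"
  unfolding polys_over_def by (auto simp: coeff_pCons split: nat.splits)

lemma polys_over_closed:
  assumes K: "is_subfield K"
  shows "0 \<in> polys_over K" "p \<in> polys_over K \<Longrightarrow> q \<in> polys_over K \<Longrightarrow> p + q \<in> polys_over K"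
    "p \<in> polys_over K \<Longrightarrow> q \<in> polys_over K \<Longrightarrow> p - q \<in> polys_over K"
    "p \<in> polys_over K \<Longrightarrow> q \<in> polys_over K \<Longrightarrow> p * q \<in> polys_over K"
    "a \<in> K \<Longrightarrow> q \<in> polys_over K \<Longrightarrow> smult a q \<in> polys_over K"
  by (auto simp: polys_over_def subfieldD[OF K] coeff_mult intro!: subfield_sum[OF K])

text \<open>Polynomial division divides coefficients only by the leading coefficient of
  \<open>p\<close>, so it never leaves the subfield.\<close>

lemma polys_over_div_mod:
  assumes K: "is_subfield K" and p: "p \<in> polys_over K" and q: "q \<in> polys_over K"
  shows "q div p \<in> polys_over K \<and> q mod p \<in> polys_over K"
proof (cases "p = 0")
  case False
  show ?thesis using q
  proof (induction q)
    case 0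
    then show ?case by simp
  next
    case (pCons a q)
    then have IH: "q div p \<in> polys_over K" "q mod p \<in> polys_over K" and a: "a \<in> K" by auto
    have 1: "pCons a (q mod p) \<in> polys_over K" using a IH by simp
    then have "coeff (pCons a (q mod p)) (degree p) / lead_coeff p \<in> K"
      using p by (intro subfieldD[OF K]) (auto simp: polys_over_def)
    then show ?case
      unfolding div_pCons_eq mod_pCons_eq using False IH p 1 by (auto intro!: polys_over_closed[OF K])
  qed
qed (use q polys_over_closed[OF K] in auto)

text \<open>The minimal polynomial \<open>p\<close> of \<open>b\<close> over \<open>K\<close> divides both \<open>g\<close> and \<open>h\<close>; having \<open>b\<close> as its
  only root, and as a simple one, it is linear.\<close>

lemma common_root_in_subfield:
  fixes K :: "'a::{alg_closed_field, field_char_0} set"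
  assumes K: "is_subfield K" and g: "g \<in> polys_over K" and h: "h \<in> polys_over K"
    and root: "poly g b = 0" "poly h b = 0" and simple: "poly (pderiv g) b \<noteq> 0"
    and only: "\<And>z. poly g z = 0 \<Longrightarrow> poly h z = 0 \<Longrightarrow> z = b"
  shows "b \<in> K"
proof -
  let ?P = "\<lambda>p. p \<noteq> 0 \<and> p \<in> polys_over K \<and> poly p b = 0"
  define p where "p = arg_min degree ?P"
  have "?P g" using g root simple by auto
  then have p: "?P p" and least: "\<And>q. ?P q \<Longrightarrow> degree p \<le> degree q"
    using arg_min_nat_lemma[of ?P g degree] unfolding p_def by auto
  have dvd: "p dvd q" if "q \<in> polys_over K" "poly q b = 0" for q
  proof -
    have "poly (p * (q div p) + q mod p) b = 0" using that by simp
    then have "poly (q mod p) b = 0" using p unfolding poly_add poly_mult by simp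
    moreover have "q mod p \<in> polys_over K" using polys_over_div_mod[OF K] p that by blast
    moreover have "q mod p = 0 \<or> degree (q mod p) < degree p" using p degree_mod_less by blast
    ultimately have "q mod p = 0" using least[of "q mod p"] by fastforce
    then show ?thesis by (simp add: dvd_eq_mod_eq_0)
  qed
  have pg: "p dvd g" "p dvd h" using dvd g h root by auto
  obtain s where s: "p = [:- b, 1:] * s" using p by (auto simp: poly_eq_0_iff_dvd)
  then have s0: "s \<noteq> 0" using p by auto
  have "degree s = 0"
  proof (rule ccontr)
    assume "degree s \<noteq> 0"
    then obtain z where z: "poly s z = 0" using alg_closed_imp_poly_has_root[of s] by auto
    then have "poly p z = 0" by (simp add: s)
    then have "z = b" using only pg by (auto elim!: dvdE)
    then obtain s' where s': "s = [:- b, 1:] * s'" using z by (auto simp: poly_eq_0_iff_dvd)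
    obtain u where "g = p * u" using pg(1) by (rule dvdE)
    then have g: "g = [:- b, 1:] * ([:- b, 1:] * (s' * u))" by (simp only: s s' mult.assoc)
    have "poly (pderiv g) b = 0" unfolding g pderiv_mult poly_add poly_mult by simp
    then show False using simple by simp
  qed
  then obtain c where "s = [:c:]" by (metis degree_eq_zeroE)
  then have "p = [:- b * c, c:]" "c \<noteq> 0" using s s0 by auto
  then have "c \<in> K" "- b * c \<in> K" using p by auto
  then have "- ((- b * c) / c) \<in> K" by (intro subfieldD(5)[OF K] subfieldD(8)[OF K])
  then show ?thesis using \<open>c \<noteq> 0\<close> by simp
qed

text \<open>With \<open>w = x + c * y\<close>, the polynomials \<open>g\<close> and
  \<open>f (w - c * z)\<close> in \<open>z\<close> have coefficients in the field generated by
  \<open>w\<close> and share the root \<open>y\<close>. For all but finitely many \<open>c\<close>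
  they share no other, and then \<open>common_root_in_subfield\<close> applies.\<close>

lemma primitive_element_two:
  fixes x y :: "'a::{alg_closed_field, field_char_0}"
  assumes x: "algebraic x" and y: "algebraic y"
  obtains c :: rat where "x \<in> adjoin_rat (x + of_rat c * y)" "y \<in> adjoin_rat (x + of_rat c * y)"
proof -
  obtain f where f: "min_rat_poly x f" using x by (rule ex_min_rat_poly)
  obtain g where g: "min_rat_poly y g" using y by (rule ex_min_rat_poly)
  have f0: "map_poly of_rat f \<noteq> (0 :: 'a poly)" and g0: "map_poly of_rat g \<noteq> (0 :: 'a poly)"
    using f g by (auto simp: min_rat_poly_def)
  \<comment> \<open>A second common root \<open>v\<close> would make \<open>u = w - c * v\<close> a
    root of \<open>f\<close>, so that \<open>c\<close> is one of these quotients. For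
    \<open>v = y\<close> division by zero gives the value 0, which harmlessly excludes
    \<open>c = 0\<close>.\<close>
  define Bad where "Bad = (\<lambda>(u, v). (u - x) / (y - v)) ` ({u. rpoly f u = 0} \<times> {v. rpoly g v = 0})"
  have "finite Bad" unfolding Bad_def using f0 g0 by (intro finite_imageI finite_cartesian_product poly_roots_finite)
  moreover have "infinite (range (of_rat :: rat \<Rightarrow> 'a))"
    by (simp add: finite_image_iff inj_on_def infinite_UNIV_char_0)
  ultimately obtain c where c: "of_rat c \<notin> Bad" by (metis finite_subset image_subsetI)
  let ?w = "x + of_rat c * y"
  have w: "algebraic ?w" by (intro algebraic_add_mult x y) auto
  note K = is_subfield_adjoin_rat[OF w]
  have wK: "?w \<in> adjoin_rat ?w" by (rule adjoin_rat_self)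
  have yK: "y \<in> adjoin_rat ?w"
  proof (rule common_root_in_subfield[OF K])
    have polys: "map_poly of_rat p \<in> polys_over (adjoin_rat ?w)" for p
      by (auto simp: polys_over_def coeff_map_poly subfield_of_rat[OF K])
    show "map_poly of_rat g \<in> polys_over (adjoin_rat ?w)" by (rule polys)
    let ?l = "[:?w, - of_rat c:]"
    have l: "?l \<in> polys_over (adjoin_rat ?w)"
      using wK by (auto intro!: subfieldD[OF K] subfield_of_rat[OF K] polys_over_closed[OF K])
    have "pcompose q ?l \<in> polys_over (adjoin_rat ?w)" if "q \<in> polys_over (adjoin_rat ?w)" for q
      using that
      by (induction q)
        (auto simp: pcompose_pCons simp del: mult_pCons_left pCons_0_0
          intro!: polys_over_closed[OF K] l)
    then show "pcompose (map_poly of_rat f) ?l \<in> polys_over (adjoin_rat ?w)" using polys by blast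
    show "rpoly g y = 0" using g by (simp add: min_rat_poly_def)
    show "poly (pcompose (map_poly of_rat f) ?l) y = 0"
      using f by (simp add: poly_pcompose min_rat_poly_def algebra_simps)
    show "poly (pderiv (map_poly of_rat g)) y \<noteq> 0"
      using min_rat_poly_pderiv[OF g] by (simp add: of_rat_hom.map_poly_pderiv)
    fix z assume z: "rpoly g z = 0" "poly (pcompose (map_poly of_rat f) ?l) z = 0"
    show "z = y"
    proof (rule ccontr)
      assume "z \<noteq> y"
      have "rpoly f (?w - of_rat c * z) = 0" using z(2) by (simp add: poly_pcompose algebra_simps)
      moreover have "((?w - of_rat c * z) - x) / (y - z) = of_rat c"
        using \<open>z \<noteq> y\<close> by (simp add: field_simps)
      ultimately have "of_rat c \<in> Bad" unfolding Bad_def using z(1)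
        by (intro image_eqI[of _ _ "(?w - of_rat c * z, z)"]) auto
      then show False using c by simp
    qed
  qed
  have "?w - of_rat c * y \<in> adjoin_rat ?w"
    by (intro subfieldD[OF K] wK yK subfield_of_rat[OF K])
  then have "x \<in> adjoin_rat ?w" by simp
  then show ?thesis using yK by (rule that)
qed

lemma number_field_is_subfield: "number_field F \<Longrightarrow> is_subfield F"
  by (auto simp: number_field_def is_subfield_def)

text \<open>A transcendental element would have more independent powers than the field has
  generators over the rationals.\<close>

lemma number_field_algebraic:
  assumes F: "number_field F" and x: "x \<in> F" shows "algebraic x"
proof (rule ccontr)
  assume "\<not> algebraic x"
  then have 1: "\<And>q. q \<noteq> 0 \<Longrightarrow> rpoly q x \<noteq> 0" by (auto simp: algebraic_iff_rpoly)
  obtain B where B: "finite B" "rat_vs.span B = F" using F by (auto simp: number_field_def)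
  have "(\<lambda>i. x ^ i) ` {..<Suc (card B)} \<subseteq> F"
    using subfieldD(9)[OF number_field_is_subfield[OF F] x] by auto
  then have "card ((\<lambda>i. x ^ i) ` {..<Suc (card B)}) \<le> card B"
    using powers_independent(2)[of "Suc (card B)" x] 1 rat_vs.independent_span_bound[OF B(1)] B(2) by blast
  then show False using powers_independent(1)[of "Suc (card B)" x] 1 by (simp add: card_image)
qed

text \<open>An element \<open>x\<close> of maximal degree works. For any \<open>y\<close> some
  \<open>w\<close> generates both \<open>x\<close> and \<open>y\<close>; if \<open>y\<close> were
  not generated by \<open>x\<close>, the powers of \<open>x\<close> together with \<open>y\<close>
  would be more independent elements than the degree of \<open>w\<close> allows.\<close>

theorem primitive_element:
  fixes F :: "'a::{alg_closed_field, field_char_0} set"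
  assumes F: "number_field F"
  obtains x where "x \<in> F" "F = adjoin_rat x"
proof -
  note K = number_field_is_subfield[OF F]
  obtain B where B: "finite B" "rat_vs.span B = F" using F by (auto simp: number_field_def)
  have bound: "degree p \<le> card B" if "x \<in> F" "min_rat_poly x p" for x p
  proof -
    have "(\<lambda>i. x ^ i) ` {..<degree p} \<subseteq> F" using subfieldD(9)[OF K that(1)] by auto
    then show ?thesis
      using min_rat_poly_powers_independent[OF that(2)] rat_vs.independent_span_bound[OF B(1)] B(2)
      by (metis card_image card_lessThan)
  qed
  define D where "D = {degree p | p. \<exists>x\<in>F. min_rat_poly x p}"
  have "finite D" by (rule finite_subset[of _ "{..card B}"]) (auto simp: D_def bound)
  moreover have "D \<noteq> {}"
  proof -
    obtain p where "min_rat_poly (0 :: 'a) p" by (rule ex_min_rat_poly[of 0]) auto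
    then have "degree p \<in> D" unfolding D_def using subfieldD(1)[OF K] by blast
    then show ?thesis by blast
  qed
  ultimately have "Max D \<in> D" and le: "\<And>d. d \<in> D \<Longrightarrow> d \<le> Max D" by auto
  then obtain x p where x: "x \<in> F" "min_rat_poly x p" "Max D = degree p" by (auto simp: D_def)
  have max: "degree q \<le> degree p" if "y \<in> F" "min_rat_poly y q" for y q
    using le[of "degree q"] that x(3) by (auto simp: D_def)
  have "y \<in> adjoin_rat x" if y: "y \<in> F" for y
  proof -
    obtain c where c: "x \<in> adjoin_rat (x + of_rat c * y)" "y \<in> adjoin_rat (x + of_rat c * y)"
      by (rule primitive_element_two[OF number_field_algebraic[OF F x(1)] number_field_algebraic[OF F y]])
    let ?w = "x + of_rat c * y"
    have wF: "?w \<in> F" using x y by (intro subfieldD[OF K] subfield_of_rat[OF K])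
    obtain q where q: "min_rat_poly ?w q" using number_field_algebraic[OF F wF] by (rule ex_min_rat_poly)
    have deg: "degree q \<le> degree p" using max[OF wF q] .
    note w_field = is_subfield_adjoin_rat[OF min_rat_poly_algebraic[OF q]]
    let ?S = "(\<lambda>i. x ^ i) ` {..<degree p}" and ?T = "(\<lambda>i. ?w ^ i) ` {..<degree q}"
    have ST: "?S \<subseteq> rat_vs.span ?T"
      unfolding span_powers_eq[OF q] using subfieldD(9)[OF w_field c(1)] by auto
    have S: "rat_vs.independent ?S" "card ?S = degree p"
      using min_rat_poly_powers_independent[OF x(2)] by (auto simp: card_image)
    have T: "card ?T = degree q"
      using min_rat_poly_powers_independent[OF q] by (auto simp: card_image)
    show ?thesis
    proof (rule ccontr)
      assume "y \<notin> adjoin_rat x"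
      then have y': "y \<notin> rat_vs.span ?S" by (simp add: span_powers_eq[OF x(2)])
      then have "rat_vs.independent (insert y ?S)"
        by (rule rat_vs.independent_insertI[OF _ S(1)])
      moreover have "insert y ?S \<subseteq> rat_vs.span ?T" using ST c(2) span_powers_eq[OF q] by simp
      ultimately have "card (insert y ?S) \<le> card ?T"
        using rat_vs.independent_span_bound[of ?T] by blast
      moreover have "card (insert y ?S) = Suc (degree p)"
        using y' rat_vs.span_base[of y ?S] S(2) by (subst card_insert_disjoint) auto
      ultimately show False using T deg by simp
    qed
  qed
  moreover have "adjoin_rat x \<subseteq> F"
    using subfield_rpoly[OF K x(1)] by (auto simp: adjoin_rat_def)
  ultimately show ?thesis using that[OF x(1)] by blast
qed

section \<open>Embeddings\<close>

text \<open>Unlike \<open>embeddings\<close> this asks for neither extensionality nor injectivity,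
  so that a map on a large field can be used unchanged on its subfields. On a subfield injectivity
  follows.\<close>

definition hom_on :: "'a::field set \<Rightarrow> ('a \<Rightarrow> 'b::field) \<Rightarrow> bool" where
  "hom_on K \<phi> \<longleftrightarrow> \<phi> 1 = 1 \<and>
     (\<forall>x\<in>K. \<forall>y\<in>K. \<phi> (x + y) = \<phi> x + \<phi> y \<and> \<phi> (x * y) = \<phi> x * \<phi> y)"

lemma hom_onD:
  assumes "hom_on K \<phi>"
  shows "\<phi> 1 = 1" "x \<in> K \<Longrightarrow> y \<in> K \<Longrightarrow> \<phi> (x + y) = \<phi> x + \<phi> y"
    "x \<in> K \<Longrightarrow> y \<in> K \<Longrightarrow> \<phi> (x * y) = \<phi> x * \<phi> y"
  using assms by (auto simp: hom_on_def)

lemma hom_on_zero: assumes "is_subfield K" "hom_on K \<phi>" shows "\<phi> 0 = 0"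
proof -
  have "\<phi> 0 = \<phi> 0 + \<phi> 0"
    using hom_onD(2)[OF assms(2), of 0 0] subfieldD(1)[OF assms(1)] by (metis add_0)
  from arg_cong[OF this, of "\<lambda>t. t - \<phi> 0"] show ?thesis by simp
qed

lemma hom_on_uminus:
  assumes K: "is_subfield K" "hom_on K \<phi>" and x: "x \<in> K" shows "\<phi> (- x) = - \<phi> x"
proof -
  have "\<phi> (- x) + \<phi> x = 0"
    using hom_onD(2)[OF K(2), of "- x" x] subfieldD(5)[OF K(1) x] x hom_on_zero[OF K] by simp
  then show ?thesis by (simp add: eq_neg_iff_add_eq_0)
qed

lemma hom_on_diff:
  assumes K: "is_subfield K" "hom_on K \<phi>" and "x \<in> K" "y \<in> K" shows "\<phi> (x - y) = \<phi> x - \<phi> y"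
  using hom_onD(2)[OF K(2), of x "- y"] subfieldD(5)[OF K(1)] hom_on_uminus[OF K] assms by simp

lemma hom_on_sum:
  assumes K: "is_subfield K" "hom_on K \<phi>" and "\<And>i. i \<in> A \<Longrightarrow> f i \<in> K"
  shows "\<phi> (\<Sum>i\<in>A. f i) = (\<Sum>i\<in>A. \<phi> (f i))"
  using assms(3)
  by (induction A rule: infinite_finite_induct)
    (auto simp: hom_on_zero[OF K] hom_onD[OF K(2)] subfield_sum[OF K(1)])

lemma hom_on_nonzero:
  assumes K: "is_subfield K" "hom_on K \<phi>" and x: "x \<in> K" "x \<noteq> 0" shows "\<phi> x \<noteq> 0"
proof
  assume "\<phi> x = 0"
  moreover have "\<phi> x * \<phi> (inverse x) = 1"
    using hom_onD(1,3)[OF K(2)] x subfieldD(6)[OF K(1) x(1)] by (metis right_inverse)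
  ultimately show False by simp
qed

lemma hom_on_inj:
  assumes K: "is_subfield K" "hom_on K \<phi>" shows "inj_on \<phi> K"
proof (rule inj_onI)
  fix x y assume xy: "x \<in> K" "y \<in> K" "\<phi> x = \<phi> y"
  then have "\<phi> (x - y) = 0" using hom_on_diff[OF K] by simp
  then show "x = y" using hom_on_nonzero[OF K subfieldD(7)[OF K(1) xy(1,2)]] by auto
qed

lemma hom_on_of_int:
  assumes K: "is_subfield K" "hom_on K \<phi>" shows "\<phi> (of_int k) = of_int k"
proof -
  have nat: "\<phi> (of_nat n) = of_nat n" for n
  proof (induction n)
    case (Suc n)
    then show ?case
      using hom_onD(1)[OF K(2)] hom_onD(2)[OF K(2), of 1 "of_nat n"]
        subfieldD(2)[OF K(1)] subfield_of_int[OF K(1), of "int n"] by simp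
  qed (simp add: hom_on_zero[OF K])
  show ?thesis
  proof (cases k)
    case (nonneg n)
    then show ?thesis by (simp add: nat)
  next
    case (neg n)
    have "of_nat (Suc n) \<in> K" using subfield_of_int[OF K(1), of "int (Suc n)"] by simp
    then show ?thesis using neg hom_on_uminus[OF K, of "of_nat (Suc n)"] nat[of "Suc n"]
      by (simp del: of_nat_Suc)
  qed
qed

lemma hom_on_of_rat:
  fixes \<phi> :: "'a::field_char_0 \<Rightarrow> 'b::field_char_0"
  assumes K: "is_subfield K" "hom_on K \<phi>" shows "\<phi> (of_rat q) = of_rat q"
proof (cases q)
  case (Fract a b)
  have "of_rat q * of_int b = (of_int a :: 'a)" using Fract by (simp add: of_rat_rat)
  then have "\<phi> (of_rat q) * of_int b = of_int a"
    using hom_onD(3)[OF K(2) subfield_of_rat[OF K(1), of q] subfield_of_int[OF K(1), of b]]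
      hom_on_of_int[OF K] by simp
  then show ?thesis using Fract by (simp add: of_rat_rat field_simps)
qed

lemma hom_on_rpoly:
  fixes \<phi> :: "'a::field_char_0 \<Rightarrow> 'b::field_char_0"
  assumes K: "is_subfield K" "hom_on K \<phi>" and x: "x \<in> K"
  shows "\<phi> (rpoly p x) = rpoly p (\<phi> x)"
proof (induction p)
  case (pCons a p)
  then show ?case
    by (simp add: hom_onD[OF K(2)] subfield_of_rat[OF K(1)] subfield_rpoly[OF K(1) x] x
        subfieldD(4)[OF K(1)] hom_on_of_rat[OF K])
qed (simp add: hom_on_zero[OF K])

lemma hom_on_algebraic_int:
  fixes \<phi> :: "'a::field_char_0 \<Rightarrow> 'b::field_char_0"
  assumes K: "is_subfield K" "hom_on K \<phi>" and x: "x \<in> K" "algebraic_int x"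
  shows "algebraic_int (\<phi> x)"
proof -
  obtain p where p: "poly (map_poly of_int p) x = 0" "lead_coeff p = 1"
    using x(2) unfolding algebraic_int_altdef_ipoly by blast
  have "rpoly (map_poly of_int p) (\<phi> x) = 0"
    using hom_on_rpoly[OF K x(1), of "map_poly of_int p"] p(1) hom_on_zero[OF K]
    by (simp add: rpoly_of_int_poly)
  then show ?thesis
    unfolding algebraic_int_altdef_ipoly using p(2) by (auto simp: rpoly_of_int_poly)
qed

lemma embeddings_hom_on: "\<phi> \<in> embeddings F \<Longrightarrow> hom_on F \<phi>"
  by (simp add: embeddings_def hom_on_def)

lemma embeddingsI:
  assumes K: "is_subfield K" "hom_on K \<phi>" shows "restrict \<phi> K \<in> embeddings K"
proof -
  have "inj_on (restrict \<phi> K) K" using hom_on_inj[OF K] by (simp add: inj_on_def)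
  then show ?thesis
    using hom_onD[OF K(2)] subfieldD(2-4)[OF K(1)] by (simp add: embeddings_def)
qed

section \<open>Embeddings and the roots of a minimal polynomial\<close>

text \<open>An embedding is determined by its value at the generator. Conversely a root
  \<open>z\<close> defines the map sending \<open>rpoly q x\<close> to \<open>rpoly q z\<close>; it
  does not depend on \<open>q\<close> because \<open>x\<close> and \<open>z\<close> have the same
  minimal polynomial.\<close>

lemma bij_betw_embeddings_roots:
  fixes x :: "'k::field_char_0"
  assumes p: "min_rat_poly x p"
  shows "bij_betw (\<lambda>\<phi>. \<phi> x) (embeddings (adjoin_rat x)) {z. rpoly p z = 0}"
proof (rule bij_betw_imageI)
  note K = is_subfield_adjoin_rat[OF min_rat_poly_algebraic[OF p]]
  note hom = embeddings_hom_on[of _ "adjoin_rat x"]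
  show "inj_on (\<lambda>\<phi>. \<phi> x) (embeddings (adjoin_rat x))"
  proof (rule inj_onI)
    fix \<phi> \<psi> assume *: "\<phi> \<in> embeddings (adjoin_rat x)" "\<psi> \<in> embeddings (adjoin_rat x)" "\<phi> x = \<psi> x"
    show "\<phi> = \<psi>"
    proof (rule extensionalityI)
      show "\<phi> \<in> extensional (adjoin_rat x)" "\<psi> \<in> extensional (adjoin_rat x)"
        using * by (auto simp: embeddings_def)
      fix y assume "y \<in> adjoin_rat x"
      then obtain q where "y = rpoly q x" by (auto simp: adjoin_rat_def)
      then show "\<phi> y = \<psi> y"
        using hom_on_rpoly[OF K hom adjoin_rat_self] * by metis
    qed
  qed
  show "(\<lambda>\<phi>. \<phi> x) ` embeddings (adjoin_rat x) = {z. rpoly p z = 0}"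
  proof (intro equalityI subsetI)
    fix z assume "z \<in> (\<lambda>\<phi>. \<phi> x) ` embeddings (adjoin_rat x)"
    then obtain \<phi> where \<phi>: "\<phi> \<in> embeddings (adjoin_rat x)" "z = \<phi> x" by blast
    have "rpoly p x = 0" using p by (simp add: min_rat_poly_def)
    then have "rpoly p z = 0"
      using hom_on_rpoly[OF K hom[OF \<phi>(1)] adjoin_rat_self, of p] \<phi>(2)
        hom_on_zero[OF K hom[OF \<phi>(1)]] by simp
    then show "z \<in> {z. rpoly p z = 0}" by simp
  next
    fix z :: complex assume "z \<in> {z. rpoly p z = 0}"
    then have z: "min_rat_poly z p" using min_rat_poly_root[OF p] by simp
    define \<psi> where "\<psi> = (\<lambda>y. rpoly (SOME q. y = rpoly q x) z)"
    have \<psi>: "\<psi> (rpoly q x) = rpoly q z" for q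
    proof -
      define r where "r = (SOME r. rpoly q x = rpoly r x)"
      have "rpoly q x = rpoly r x" unfolding r_def by (rule someI[of _ q]) simp
      then have "rpoly (r - q) x = 0" by simp
      then have "rpoly (r - q) z = 0" using p z unfolding min_rat_poly_def by blast
      then show ?thesis by (simp add: \<psi>_def r_def)
    qed
    have "hom_on (adjoin_rat x) \<psi>"
      unfolding hom_on_def adjoin_rat_def
      using \<psi>[of 1] \<psi>[of "_ + _"] \<psi>[of "_ * _"] \<psi> by auto
    then have "restrict \<psi> (adjoin_rat x) \<in> embeddings (adjoin_rat x)" by (rule embeddingsI[OF K])
    moreover have "restrict \<psi> (adjoin_rat x) x = z"
      using \<psi>[of "[:0, 1:]"] adjoin_rat_self[of x] by simp
    ultimately show "z \<in> (\<lambda>\<phi>. \<phi> x) ` embeddings (adjoin_rat x)" by (metis imageI)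
  qed
qed

text \<open>A multiple root would be a root of the derivative as well. Since every root has minimal
  polynomial \<open>p\<close>, \<open>min_rat_poly_pderiv\<close> excludes this.\<close>

lemma card_roots_min_rat_poly:
  assumes p: "min_rat_poly x p"
  shows "finite {z :: complex. rpoly p z = 0}" "card {z :: complex. rpoly p z = 0} = degree p"
proof -
  let ?P = "map_poly of_rat p :: complex poly"
  have P0: "?P \<noteq> 0" using p by (simp add: min_rat_poly_def)
  show fin: "finite {z :: complex. rpoly p z = 0}" by (rule poly_roots_finite[OF P0])
  have "rsquarefree ?P"
    unfolding rsquarefree_roots
  proof (intro allI notI)
    fix z assume z: "poly ?P z = 0 \<and> poly (pderiv ?P) z = 0"
    then have "min_rat_poly z p" using min_rat_poly_root[OF p] by blast
    from min_rat_poly_pderiv[OF this] z show False by (simp add: of_rat_hom.map_poly_pderiv)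
  qed
  from complex_poly_decompose_rsquarefree[OF this]
  have "degree ?P = degree (\<Prod>z | poly ?P z = 0. [:- z, 1:])"
    using P0 by (metis degree_smult_eq leading_coeff_0_iff)
  also have "\<dots> = card {z. poly ?P z = 0}"
    by (subst degree_prod_eq_sum_degree) auto
  finally show "card {z :: complex. rpoly p z = 0} = degree p"
    by (simp add: of_rat_hom.degree_map_poly_hom)
qed

lemma field_degree_adjoin_rat:
  assumes p: "min_rat_poly x p" shows "field_degree (adjoin_rat x) = degree p"
  unfolding field_degree_def span_powers_eq[OF p, symmetric]
  using min_rat_poly_powers_independent[OF p]
  by (simp add: rat_vs.dim_eq_card_independent card_image)

lemma embeddings_number_field:
  fixes F :: "'k::{alg_closed_field, field_char_0} set"
  assumes F: "number_field F"
  shows "finite (embeddings F)" "card (embeddings F) = field_degree F"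
proof -
  obtain x where x: "x \<in> F" "F = adjoin_rat x" using F by (rule primitive_element)
  obtain p where p: "min_rat_poly x p"
    using number_field_algebraic[OF F x(1)] by (rule ex_min_rat_poly)
  show "finite (embeddings F)" "card (embeddings F) = field_degree F"
    using bij_betw_embeddings_roots[OF p] card_roots_min_rat_poly[OF p] x(2)
      field_degree_adjoin_rat[OF p] bij_betw_finite bij_betw_same_card by metis+
qed

section \<open>Extending embeddings to all algebraic numbers\<close>

text \<open>Partial maps are taken as graphs so that extension is inclusion and the bound of a chain
  is its union. As the domain is a ring of algebraic numbers containing the rationals, it is a
  subfield without closure under inverses being demanded.\<close>

definition partial_embedding :: "('a::field_char_0 \<times> 'b::field_char_0) set \<Rightarrow> bool" where
  "partial_embedding G \<longleftrightarrow> single_valued G \<and> (\<forall>x\<in>Domain G. algebraic x) \<and>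
     (\<forall>q. (of_rat q, of_rat q) \<in> G) \<and>
     (\<forall>x y x' y'. (x, y) \<in> G \<longrightarrow> (x', y') \<in> G \<longrightarrow> (x + x', y + y') \<in> G \<and> (x * x', y * y') \<in> G)"

lemma partial_embedding_hom:
  fixes G :: "('a::field_char_0 \<times> 'b::field_char_0) set"
  assumes G: "partial_embedding G"
  obtains \<phi> where "is_subfield (Domain G)" "hom_on (Domain G) \<phi>"
    "\<forall>x y. (x, y) \<in> G \<longleftrightarrow> x \<in> Domain G \<and> y = \<phi> x"
proof -
  define \<phi> where "\<phi> = (\<lambda>x. THE y. (x, y) \<in> G)"
  have sv: "single_valued G" and alg: "\<And>x. x \<in> Domain G \<Longrightarrow> algebraic x"
    and rat: "\<And>q. (of_rat q, of_rat q) \<in> G"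
    and ring: "\<And>x y x' y'. (x, y) \<in> G \<Longrightarrow> (x', y') \<in> G \<Longrightarrow> (x + x', y + y') \<in> G"
      "\<And>x y x' y'. (x, y) \<in> G \<Longrightarrow> (x', y') \<in> G \<Longrightarrow> (x * x', y * y') \<in> G"
    using G by (auto simp: partial_embedding_def)
  have \<phi>: "\<phi> x = y" if "(x, y) \<in> G" for x y
    unfolding \<phi>_def using that sv by (intro the_equality) (auto simp: single_valued_def)
  have iff: "\<forall>x y. (x, y) \<in> G \<longleftrightarrow> x \<in> Domain G \<and> y = \<phi> x"
    using \<phi> by blast
  have "is_subfield (Domain G)"
    by (rule is_subfieldI_algebraic) (use alg rat ring in \<open>blast+\<close>)
  moreover have "hom_on (Domain G) \<phi>"
    unfolding hom_on_def using \<phi>[OF rat[of 1]] ring \<phi> by (auto simp: Domain_iff)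
  ultimately show ?thesis using iff by (rule that)
qed

lemma coeff_map_hom_on:
  assumes "is_subfield K" "hom_on K \<phi>" shows "coeff (map_poly \<phi> p) i = \<phi> (coeff p i)"
  by (simp add: coeff_map_poly hom_on_zero[OF assms])

lemma map_poly_hom_on:
  assumes K: "is_subfield K" "hom_on K \<phi>" and p: "p \<in> polys_over K" and q: "q \<in> polys_over K"
  shows "map_poly \<phi> (p + q) = map_poly \<phi> p + map_poly \<phi> q"
    "map_poly \<phi> (p * q) = map_poly \<phi> p * map_poly \<phi> q"
    "map_poly \<phi> (p - q) = map_poly \<phi> p - map_poly \<phi> q"
proof -
  have pq: "coeff p i \<in> K" "coeff q i \<in> K" for i using p q by (auto simp: polys_over_def)
  show "map_poly \<phi> (p + q) = map_poly \<phi> p + map_poly \<phi> q"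
    using pq by (intro poly_eqI) (simp add: coeff_map_hom_on[OF K] hom_onD[OF K(2)])
  show "map_poly \<phi> (p - q) = map_poly \<phi> p - map_poly \<phi> q"
    using pq by (intro poly_eqI) (simp add: coeff_map_hom_on[OF K] hom_on_diff[OF K])
  show "map_poly \<phi> (p * q) = map_poly \<phi> p * map_poly \<phi> q"
    using pq by (intro poly_eqI)
      (simp add: coeff_map_hom_on[OF K] coeff_mult hom_on_sum[OF K] hom_onD[OF K(2)] subfieldD(4)[OF K(1)])
qed

text \<open>Let \<open>p\<close> be a polynomial of least degree over the domain that vanishes at
  \<open>a\<close>, and \<open>b\<close> a root of its image under \<open>\<phi>\<close>. The
  extension sends the value of \<open>q\<close> at \<open>a\<close> to the value of the image of
  \<open>q\<close> at \<open>b\<close>. It is well defined because polynomials vanishing at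
  \<open>a\<close> are multiples of \<open>p\<close>.\<close>

lemma partial_embedding_extend:
  fixes G :: "('a::field_char_0 \<times> 'b::{alg_closed_field, field_char_0}) set"
  assumes G: "partial_embedding G" and a: "algebraic a"
  obtains G' where "partial_embedding G'" "G \<subseteq> G'" "a \<in> Domain G'"
proof -
  obtain \<phi> where K: "is_subfield (Domain G)" "hom_on (Domain G) \<phi>"
    and G_iff: "\<forall>x y. (x, y) \<in> G \<longleftrightarrow> x \<in> Domain G \<and> y = \<phi> x"
    by (rule partial_embedding_hom[OF G])
  let ?K = "Domain G"
  have alg: "\<And>x. x \<in> ?K \<Longrightarrow> algebraic x" using G by (auto simp: partial_embedding_def)
  let ?P = "\<lambda>p. p \<noteq> 0 \<and> p \<in> polys_over ?K \<and> poly p a = 0"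
  define p where "p = arg_min degree ?P"
  obtain q0 where "q0 \<noteq> 0" "rpoly q0 a = 0" using a unfolding algebraic_iff_rpoly by blast
  then have "?P (map_poly of_rat q0)"
    by (auto simp: polys_over_def coeff_map_poly subfield_of_rat[OF K(1)])
  then have p: "?P p" and least: "\<And>q. ?P q \<Longrightarrow> degree p \<le> degree q"
    using arg_min_nat_lemma[of ?P "map_poly of_rat q0" degree] unfolding p_def by auto
  have degp: "degree p > 0"
  proof (rule ccontr)
    assume "\<not> ?thesis"
    then obtain c where "p = [:c:]" by (auto elim: degree_eq_zeroE)
    then show False using p by auto
  qed
  \<comment> \<open>The leading coefficient does not become zero, so the image of \<open>p\<close>
    still has positive degree and therefore a root.\<close>
  have "degree (map_poly \<phi> p) = degree p"
  proof (rule degree_map_poly)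
    have "lead_coeff p \<in> ?K" using p by (auto simp: polys_over_def)
    then show "(\<phi> (lead_coeff p) = 0) = (p = 0)"
      using hom_on_nonzero[OF K, of "lead_coeff p"] hom_on_zero[OF K] by auto
  qed
  then obtain b where b: "poly (map_poly \<phi> p) b = 0"
    using alg_closed_imp_poly_has_root[of "map_poly \<phi> p"] degp by auto
  have vanish: "poly (map_poly \<phi> q) b = 0" if q: "q \<in> polys_over ?K" "poly q a = 0" for q
  proof -
    note dm = polys_over_div_mod[OF K(1), of p q]
    have "poly (p * (q div p) + q mod p) a = 0" using q by simp
    then have "poly (q mod p) a = 0" using p unfolding poly_add poly_mult by simp
    moreover have "q mod p = 0 \<or> degree (q mod p) < degree p" using p degree_mod_less by blast
    ultimately have "q mod p = 0" using least[of "q mod p"] dm p q by fastforce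
    then have "q = p * (q div p)" by (metis add.right_neutral mult_div_mod_eq)
    then have "map_poly \<phi> q = map_poly \<phi> p * map_poly \<phi> (q div p)"
      using map_poly_hom_on(2)[OF K, of p "q div p"] dm p q by metis
    then show ?thesis using b by simp
  qed
  define G' where "G' = (\<lambda>q. (poly q a, poly (map_poly \<phi> q) b)) ` polys_over ?K"
  have mem: "(poly q a, poly (map_poly \<phi> q) b) \<in> G'" if "q \<in> polys_over ?K" for q
    using that by (auto simp: G'_def)
  have GG': "G \<subseteq> G'"
  proof (rule subrelI)
    fix x y assume xy: "(x, y) \<in> G"
    then have "[:x:] \<in> polys_over ?K" using polys_over_closed(1)[OF K(1)] by auto
    from mem[OF this] have "(x, poly (map_poly \<phi> [:x:]) b) \<in> G'" by simp
    moreover have "map_poly \<phi> [:x:] = [:\<phi> x:]"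
      by (rule poly_eqI) (simp add: coeff_map_hom_on[OF K] coeff_pCons hom_on_zero[OF K] split: nat.split)
    moreover have "y = \<phi> x" using xy G_iff by blast
    ultimately show "(x, y) \<in> G'" by simp
  qed
  have "partial_embedding G'"
    unfolding partial_embedding_def
  proof (intro conjI allI impI ballI)
    show "single_valued G'"
    proof (rule single_valuedI)
      fix x y z assume xy: "(x, y) \<in> G'" "(x, z) \<in> G'"
      from xy(1) obtain q where q: "q \<in> polys_over ?K" "x = poly q a" "y = poly (map_poly \<phi> q) b"
        unfolding G'_def by blast
      from xy(2) obtain r where r: "r \<in> polys_over ?K" "x = poly r a" "z = poly (map_poly \<phi> r) b"
        unfolding G'_def by blast
      note qr = q(1) r(1) q(2,3) r(2,3)
      have "poly (map_poly \<phi> (q - r)) b = 0"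
        using qr by (intro vanish polys_over_closed(3)[OF K(1)]) auto
      then show "y = z" using qr map_poly_hom_on(3)[OF K] by simp
    qed
    show "algebraic x" if "x \<in> Domain G'" for x
    proof -
      from that obtain q where q: "q \<in> polys_over ?K" "x = poly q a" by (auto simp: G'_def)
      have "algebraic (poly q a)" using q(1)
      proof (induction q)
        case (pCons c q)
        have "algebraic c" "algebraic (poly q a)" using pCons alg by auto
        then show ?case using algebraic_add_mult(1)[OF _ algebraic_add_mult(2)[OF a]] by simp
      qed auto
      then show ?thesis using q by simp
    qed
    show "(of_rat q, of_rat q) \<in> G'" for q using GG' G by (auto simp: partial_embedding_def)
    fix x y x' y' assume xy: "(x, y) \<in> G'" "(x', y') \<in> G'"
    from xy(1) obtain q where q: "q \<in> polys_over ?K" "x = poly q a" "y = poly (map_poly \<phi> q) b"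
      unfolding G'_def by blast
    from xy(2) obtain r where r: "r \<in> polys_over ?K" "x' = poly r a" "y' = poly (map_poly \<phi> r) b"
      unfolding G'_def by blast
    note qr = q(1) r(1) q(2,3) r(2,3)
    show "(x + x', y + y') \<in> G'"
      using mem[OF polys_over_closed(2)[OF K(1) qr(1,2)]] map_poly_hom_on(1)[OF K qr(1,2)] qr by simp
    show "(x * x', y * y') \<in> G'"
      using mem[OF polys_over_closed(4)[OF K(1) qr(1,2)]] map_poly_hom_on(2)[OF K qr(1,2)] qr by simp
  qed
  moreover have "a \<in> Domain G'"
  proof -
    have "[:0, 1:] \<in> polys_over ?K"
      using polys_over_closed(1)[OF K(1)] subfieldD(1,2)[OF K(1)] by auto
    from mem[OF this] show ?thesis by (auto simp: Domain_iff)
  qed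
  ultimately show ?thesis using GG' that by blast
qed

text \<open>Each condition involves at most two pairs, and any two pairs of the union already lie in
  one member of the chain.\<close>

lemma partial_embedding_Union:
  assumes C: "C \<noteq> {}" "subset.chain {G. partial_embedding G \<and> H \<subseteq> G} C"
  shows "partial_embedding (\<Union>C)"
proof -
  have mem: "partial_embedding G" if "G \<in> C" for G
    using C(2) that by (auto simp: subset_chain_def)
  have two: "\<exists>G\<in>C. u \<in> G \<and> v \<in> G" if "u \<in> \<Union>C" "v \<in> \<Union>C" for u v
  proof -
    from that obtain G1 G2 where "G1 \<in> C" "u \<in> G1" "G2 \<in> C" "v \<in> G2" by blast
    moreover have "G1 \<subseteq> G2 \<or> G2 \<subseteq> G1"
      using C(2) calculation by (auto simp: subset_chain_def)
    ultimately show ?thesis by blast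
  qed
  show ?thesis
    unfolding partial_embedding_def
  proof (intro conjI allI impI ballI)
    show "single_valued (\<Union>C)"
    proof (rule single_valuedI)
      fix x y z assume "(x, y) \<in> \<Union>C" "(x, z) \<in> \<Union>C"
      then obtain G where "G \<in> C" "(x, y) \<in> G" "(x, z) \<in> G" using two by blast
      then show "y = z" using mem by (auto simp: partial_embedding_def single_valued_def)
    qed
    show "algebraic x" if "x \<in> Domain (\<Union>C)" for x
    proof -
      from that obtain G where "G \<in> C" "x \<in> Domain G" by blast
      then show ?thesis using mem[of G] by (auto simp: partial_embedding_def)
    qed
    show "(of_rat q, of_rat q) \<in> \<Union>C" for q
      using C(1) mem by (auto simp: partial_embedding_def)
    fix x y x' y' assume "(x, y) \<in> \<Union>C" "(x', y') \<in> \<Union>C"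
    then obtain G where "G \<in> C" "(x, y) \<in> G" "(x', y') \<in> G" using two by blast
    then show "(x + x', y + y') \<in> \<Union>C" "(x * x', y * y') \<in> \<Union>C"
      using mem[of G] unfolding partial_embedding_def by blast+
  qed
qed

text \<open>The isomorphism sending \<open>z\<close> to \<open>w\<close> on the field generated by
  \<open>z\<close> is enlarged to a maximal partial embedding, which by
  \<open>partial_embedding_extend\<close> is defined at every algebraic number.\<close>

lemma ex_algebraic_embedding:
  fixes z :: "'a::field_char_0" and w :: "'b::{alg_closed_field, field_char_0}"
  assumes p: "min_rat_poly z p" and w: "rpoly p w = 0"
  obtains \<phi> where "is_subfield {x :: 'a. algebraic x}" "hom_on {x :: 'a. algebraic x} \<phi>" "\<phi> z = w"
proof -
  have wp: "min_rat_poly w p" by (rule min_rat_poly_root[OF p w])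
  define H where "H = range (\<lambda>q. (rpoly q z, rpoly q w))"
  have H: "(rpoly q z, rpoly q w) \<in> H" for q by (auto simp: H_def)
  note Kz = is_subfield_adjoin_rat[OF min_rat_poly_algebraic[OF p]]
  have "partial_embedding H"
    unfolding partial_embedding_def
  proof (intro conjI allI impI ballI)
    show "single_valued H"
    proof (rule single_valuedI)
      fix x y y' assume xy: "(x, y) \<in> H" "(x, y') \<in> H"
      from xy(1) obtain q where q: "x = rpoly q z" "y = rpoly q w" unfolding H_def by blast
      from xy(2) obtain r where r: "x = rpoly r z" "y' = rpoly r w" unfolding H_def by blast
      note qr = q r
      then have "rpoly (q - r) z = 0" by simp
      then have "rpoly (q - r) w = 0" using p wp unfolding min_rat_poly_def by blast
      then show "y = y'" using qr by simp
    qed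
    show "algebraic x" if "x \<in> Domain H" for x
    proof -
      from that obtain q where q: "x = rpoly q z" by (auto simp: H_def)
      have "algebraic (rpoly q z)"
      proof (induction q)
        case (pCons c q)
        have "algebraic (z * rpoly q z)"
          by (rule algebraic_add_mult(2)[OF min_rat_poly_algebraic[OF p] pCons.IH])
        then show ?case using algebraic_add_mult(1)[OF algebraic_of_rat, of _ c] by simp
      qed auto
      then show ?thesis using q by simp
    qed
    show "(of_rat q, of_rat q) \<in> H" for q using H[of "[:q:]"] by simp
    fix x y x' y' assume xy: "(x, y) \<in> H" "(x', y') \<in> H"
    from xy(1) obtain q where q: "x = rpoly q z" "y = rpoly q w" unfolding H_def by blast
    from xy(2) obtain r where r: "x' = rpoly r z" "y' = rpoly r w" unfolding H_def by blast
    note qr = q r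
    show "(x + x', y + y') \<in> H" "(x * x', y * y') \<in> H"
      using H[of "q + r"] H[of "q * r"] qr by simp_all
  qed
  let ?A = "{G. partial_embedding G \<and> H \<subseteq> G}"
  have "\<exists>M\<in>?A. \<forall>X\<in>?A. M \<subseteq> X \<longrightarrow> X = M"
  proof (rule subset_Zorn_nonempty)
    show "?A \<noteq> {}" using \<open>partial_embedding H\<close> by blast
    fix C assume C: "C \<noteq> {}" "subset.chain ?A C"
    then have "H \<subseteq> \<Union>C" unfolding subset_chain_def by blast
    then show "\<Union>C \<in> ?A" using partial_embedding_Union[OF C] by blast
  qed
  then obtain M where M0: "M \<in> ?A" "\<forall>X\<in>?A. M \<subseteq> X \<longrightarrow> X = M" by (elim bexE)
  then have M: "partial_embedding M" "H \<subseteq> M" by simp_all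
  have max: "X = M" if "partial_embedding X" "M \<subseteq> X" for X
    using M0(2) that M(2) by (metis (no_types, lifting) mem_Collect_eq subset_trans)
  have dom: "Domain M = {x. algebraic x}"
  proof (intro equalityI subsetI)
    fix a :: 'a assume "a \<in> {x. algebraic x}"
    then have a: "algebraic a" by simp
    obtain G' where "partial_embedding G'" "M \<subseteq> G'" "a \<in> Domain G'"
      by (rule partial_embedding_extend[OF M(1) a])
    then show "a \<in> Domain M" using max[of G'] by simp
  qed (use M(1) in \<open>auto simp: partial_embedding_def\<close>)
  obtain \<phi> where \<phi>: "is_subfield (Domain M)" "hom_on (Domain M) \<phi>"
    "\<forall>x y. (x, y) \<in> M \<longleftrightarrow> x \<in> Domain M \<and> y = \<phi> x"
    by (rule partial_embedding_hom[OF M(1)])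
  have "(z, w) \<in> M" using H[of "[:0, 1:]"] M(2) by auto
  then have "\<phi> z = w" using \<phi>(3) by simp
  with \<phi>(1,2) show ?thesis unfolding dom by (rule that)
qed

section \<open>Algebraic integers with small conjugates\<close>

lemma norm_prod_mset_less_1:
  fixes A :: "complex multiset"
  assumes "A \<noteq> {#}" "\<And>x. x \<in># A \<Longrightarrow> cmod x < 1"
  shows "cmod (prod_mset A) < 1"
  using assms
proof (induction A)
  case (add x A)
  show ?case
  proof (cases "A = {#}")
    case False
    then have "cmod (prod_mset A) < 1" "cmod x < 1" using add by auto
    then have "cmod x * cmod (prod_mset A) < 1 * 1" by (intro mult_strict_mono') auto
    then show ?thesis by (simp add: norm_mult)
  qed (use add in auto)
qed auto

text \<open>The constant coefficient of the normalised minimal polynomial is a non-zero integer, and up to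
  sign the product of the conjugates.\<close>

lemma ex_conjugate_ge_1:
  fixes z :: "'a::field_char_0"
  assumes z: "algebraic_int z" "z \<noteq> 0"
  obtains p and w :: complex where "min_rat_poly z p" "rpoly p w = 0" "cmod w \<ge> 1"
proof (rule ccontr)
  assume neg: "\<not> thesis"
  note found = that
  obtain p where p: "min_rat_poly z p"
    using algebraic_int_imp_algebraic[OF z(1)] by (rule ex_min_rat_poly)
  let ?P = "map_poly of_rat p :: complex poly"
  have small: "cmod w < 1" if "rpoly p w = 0" for w
    using neg found[OF p that] by linarith
  have P0: "?P \<noteq> 0" using p by (simp add: min_rat_poly_def)
  have int: "algebraic_int w" if "rpoly p w = 0" for w :: complex
  proof -
    obtain r where r: "poly (map_poly of_int r) z = 0" "lead_coeff r = 1"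
      using z(1) unfolding algebraic_int_altdef_ipoly by blast
    then have "p dvd map_poly of_int r"
      using p unfolding min_rat_poly_def by (metis rpoly_of_int_poly)
    then have "rpoly (map_poly of_int r) w = 0" using that by (auto elim!: dvdE)
    then show ?thesis unfolding algebraic_int_altdef_ipoly using r(2) by (auto simp: rpoly_of_int_poly)
  qed
  obtain A where A: "size A = degree ?P" "?P = smult (lead_coeff ?P) (\<Prod>x\<in>#A. [:- x, 1:])"
    using alg_closed_imp_factorization[OF P0] by blast
  have roots: "rpoly p x = 0" if "x \<in># A" for x
  proof -
    have "poly (\<Prod>x\<in>#A. [:- x, 1:]) x = 0"
      using that by (induction A) auto
    then show ?thesis by (subst A(2)) simp
  qed
  define N where "N = prod_mset (image_mset uminus A)"
  have "poly (\<Prod>x\<in>#A. [:- x, 1:]) 0 = N"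
    unfolding N_def by (induction A) auto
  then have N: "of_rat (coeff p 0 / lead_coeff p) = N"
    using arg_cong[OF A(2), of "\<lambda>q. poly q 0"] P0
    by (simp add: poly_0_coeff_0 coeff_map_poly of_rat_divide of_rat_hom.degree_map_poly_hom)
  have "algebraic_int N"
  proof -
    have "\<And>x. x \<in># A \<Longrightarrow> algebraic_int x" using roots int by blast
    then show ?thesis unfolding N_def by (induction A) (auto intro!: algebraic_int_mult)
  qed
  moreover have "N \<in> \<rat>" using N by (metis Rats_of_rat)
  ultimately have "N \<in> \<int>" by (rule rational_algebraic_int_is_int)
  then obtain k where k: "N = of_int k" by (auto elim: Ints_cases)
  have "A \<noteq> {#}" using A(1) min_rat_poly_degree[OF p] by (auto simp: of_rat_hom.degree_map_poly_hom)
  then have "cmod N < 1"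
    unfolding N_def using roots small by (intro norm_prod_mset_less_1) auto
  then have "N = 0" using k by simp
  \<comment> \<open>If the product vanishes, 0 is a conjugate of \<open>z\<close>, so
    \<open>p\<close> divides the polynomial \<open>[:0, 1:]\<close> and \<open>z\<close> itself is
    0.\<close>
  then have "0 \<in># A" unfolding N_def by (auto simp: prod_mset_zero_iff)
  then have "min_rat_poly (0 :: complex) p" using roots min_rat_poly_root[OF p] by blast
  then have "p dvd [:0, 1:]" unfolding min_rat_poly_def by (metis add_0 mult_zero_left of_rat_0 rpoly_simps(4))
  then have "rpoly [:0, 1:] z = 0" using p unfolding min_rat_poly_def by blast
  then show False using z(2) by simp
qed

text \<open>The bound is asked of all embeddings of the field of algebraic numbers because no fixed
  number field is assumed to contain \<open>z\<close>. A conjugate of modulus at least 1 is the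
  value of such an embedding.\<close>

theorem algebraic_int_eq_0_if_small:
  fixes z :: "'k::field_char_0"
  assumes z: "algebraic_int z"
    and small: "\<And>\<phi>. hom_on {x :: 'k. algebraic x} \<phi> \<Longrightarrow> cmod (\<phi> z) < 1"
  shows "z = 0"
proof (rule ccontr)
  assume "z \<noteq> 0"
  obtain p and w :: complex where p: "min_rat_poly z p" "rpoly p w = 0" "cmod w \<ge> 1"
    by (rule ex_conjugate_ge_1[OF z \<open>z \<noteq> 0\<close>])
  obtain \<phi> where \<phi>: "hom_on {x :: 'k. algebraic x} \<phi>" "\<phi> z = w"
    by (rule ex_algebraic_embedding[OF p(1,2)])
  then show False using small[OF \<phi>(1)] p(3) by simp
qed

section \<open>Integral bases\<close>

definition int_basis :: "(nat \<Rightarrow> 'a) \<Rightarrow> nat \<Rightarrow> 'a::comm_ring_1 set \<Rightarrow> bool" where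
  "int_basis \<beta> k G \<longleftrightarrow> (\<forall>i<k. \<beta> i \<in> G) \<and>
    (\<forall>c :: nat \<Rightarrow> int. (\<Sum>i<k. of_int (c i) * \<beta> i) = 0 \<longrightarrow> (\<forall>i<k. c i = 0)) \<and>
    (\<forall>g\<in>G. \<exists>c :: nat \<Rightarrow> int. g = (\<Sum>i<k. of_int (c i) * \<beta> i))"

lemma int_basisD:
  fixes c :: "nat \<Rightarrow> int"
  assumes "int_basis \<beta> k G"
  shows "i < k \<Longrightarrow> \<beta> i \<in> G" "(\<Sum>i<k. of_int (c i) * \<beta> i) = 0 \<Longrightarrow> \<forall>i<k. c i = 0"
    "g \<in> G \<Longrightarrow> \<exists>c :: nat \<Rightarrow> int. g = (\<Sum>i<k. of_int (c i) * \<beta> i)"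
  using assms unfolding int_basis_def by blast+

text \<open>The last element of the basis is one whose multiple by \<open>d\<close> has least positive coordinate along
  the last vector; the others come from the subgroup on which that coordinate vanishes.\<close>

lemma subgroup_basis:
  fixes G :: "'a::field_char_0 set" and \<alpha> :: "nat \<Rightarrow> 'a"
  assumes "int_module.subspace G" and "d \<noteq> 0"
    and "\<And>c :: nat \<Rightarrow> int. (\<Sum>i<n. of_int (c i) * \<alpha> i) = 0 \<Longrightarrow> \<forall>i<n. c i = 0"
    and "\<And>g. g \<in> G \<Longrightarrow> \<exists>c :: nat \<Rightarrow> int. of_int d * g = (\<Sum>i<n. of_int (c i) * \<alpha> i)"
  shows "\<exists>\<beta> k. int_basis \<beta> k G"
  using assms
proof (induction n arbitrary: G)
  case 0
  have "g = 0" if "g \<in> G" for g using 0(4)[OF that] 0(2) by simp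
  then show ?case by (intro exI[of _ "\<lambda>_. 0"] exI[of _ 0]) (simp add: int_basis_def)
next
  case (Suc n)
  note sub = \<open>int_module.subspace G\<close> and d = \<open>d \<noteq> 0\<close>
  have indep: "\<forall>i<n. c i = 0" if "(\<Sum>i<n. of_int (c i) * \<alpha> i) = 0" for c :: "nat \<Rightarrow> int"
  proof -
    have "(\<Sum>i<Suc n. of_int ((c(n := 0)) i) * \<alpha> i) = 0" using that by simp
    from Suc.prems(3)[OF this] show ?thesis by (metis fun_upd_other less_SucI nat_neq_iff)
  qed
  define G' where "G' = {g \<in> G. \<exists>c :: nat \<Rightarrow> int. of_int d * g = (\<Sum>i<n. of_int (c i) * \<alpha> i)}"
  have G'I: "g \<in> G'" if "g \<in> G" "of_int d * g = (\<Sum>i<n. of_int (c i) * \<alpha> i)" for g and c :: "nat \<Rightarrow> int"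
    using that unfolding G'_def by blast
  have G': "int_module.subspace G'"
  proof (rule int_module.subspaceI)
    show "0 \<in> G'" unfolding G'_def
      using int_module.subspace_0[OF sub] by (auto intro!: exI[of _ "\<lambda>_. 0"])
    fix x y assume xy: "x \<in> G'" "y \<in> G'"
    from xy(1) obtain a where a: "x \<in> G" "of_int d * x = (\<Sum>i<n. of_int (a i) * \<alpha> i)"
      unfolding G'_def by blast
    from xy(2) obtain b where b: "y \<in> G" "of_int d * y = (\<Sum>i<n. of_int (b i) * \<alpha> i)"
      unfolding G'_def by blast
    have eq: "of_int d * (x + y) = (\<Sum>i<n. of_int (a i + b i) * \<alpha> i)"
      using a b by (simp add: distrib_left distrib_right sum.distrib)
    show "x + y \<in> G'"
      by (rule G'I[where c = "\<lambda>i. a i + b i", OF int_module.subspace_add[OF sub a(1) b(1)] eq])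
  next
    fix k x assume "x \<in> G'"
    then obtain a where a: "x \<in> G" "of_int d * x = (\<Sum>i<n. of_int (a i) * \<alpha> i)"
      unfolding G'_def by blast
    have "of_int d * (of_int k * x) = of_int k * (of_int d * x)" by simp
    also have "\<dots> = (\<Sum>i<n. of_int (k * a i) * \<alpha> i)"
      unfolding a(2) sum_distrib_left by (intro sum.cong refl) (simp only: of_int_mult mult.assoc)
    finally have eq: "of_int d * (of_int k * x) = (\<Sum>i<n. of_int (k * a i) * \<alpha> i)" .
    show "of_int k * x \<in> G'"
      by (rule G'I[where c = "\<lambda>i. k * a i", OF int_module.subspace_scale[OF sub a(1)] eq])
  qed
  have "\<exists>\<beta> k. int_basis \<beta> k G'"
    by (rule Suc.IH[OF G' d indep]) (simp_all add: G'_def)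
  then obtain \<beta> k where \<beta>: "int_basis \<beta> k G'" by blast
  note IH = int_basisD[OF \<beta>]
  have coords: "\<exists>c. \<forall>i<k. of_int d * \<beta> i = (\<Sum>j<n. of_int (c i j) * \<alpha> j)"
  proof -
    have "\<forall>i. \<exists>c. i < k \<longrightarrow> of_int d * \<beta> i = (\<Sum>j<n. of_int (c j) * \<alpha> j)"
      using IH(1) unfolding G'_def by blast
    then show ?thesis by (rule choice)
  qed
  define E where "E = {c n | (c :: nat \<Rightarrow> int) g. g \<in> G \<and> of_int d * g = (\<Sum>i<Suc n. of_int (c i) * \<alpha> i)}"
  have EI: "c n \<in> E" if "g \<in> G" "of_int d * g = (\<Sum>i<Suc n. of_int (c i) * \<alpha> i)" for g c
    unfolding E_def using that by blast
  show ?case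
  proof (cases "\<exists>e\<in>E. e \<noteq> 0")
    case False
    have "g \<in> G'" if g: "g \<in> G" for g
    proof -
      obtain c :: "nat \<Rightarrow> int" where c: "of_int d * g = (\<Sum>i<Suc n. of_int (c i) * \<alpha> i)"
        using Suc.prems(4)[OF g] by blast
      then have "c n = 0" using False EI[OF g c] by blast
      then show ?thesis using c by (intro G'I[OF g, of c]) simp
    qed
    then have "G' = G" unfolding G'_def by blast
    then show ?thesis using \<beta> by blast
  next
    case True
    have Eneg: "- e \<in> E" if "e \<in> E" for e
    proof -
      from that obtain c g where cg: "e = c n" "g \<in> G" "of_int d * g = (\<Sum>i<Suc n. of_int (c i) * \<alpha> i)"
        unfolding E_def by blast
      have "of_int d * (- g) = - (\<Sum>i<Suc n. of_int (c i) * \<alpha> i)" by (simp only: cg(3) mult_minus_right)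
      also have "\<dots> = (\<Sum>i<Suc n. of_int (- c i) * \<alpha> i)" by (simp add: sum_negf)
      finally have "of_int d * (- g) = (\<Sum>i<Suc n. of_int (- c i) * \<alpha> i)" .
      from EI[where c = "\<lambda>i. - c i", OF int_module.subspace_neg[OF sub cg(2)] this]
      show ?thesis unfolding cg(1) .
    qed
    define e where "e = (LEAST e. e > 0 \<and> int e \<in> E)"
    obtain e1 where e1: "e1 \<in> E" "e1 \<noteq> 0" using True by blast
    have "\<exists>e. e > 0 \<and> int e \<in> E"
      using e1 Eneg[of e1] by (intro exI[of _ "nat \<bar>e1\<bar>"]) (auto simp: abs_if)
    then have e: "e > 0" "int e \<in> E" unfolding e_def by (metis (mono_tags, lifting) LeastI_ex)+
    have e_min: "e \<le> f" if "f > 0" "int f \<in> E" for f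
      unfolding e_def by (rule Least_le) (use that in simp)
    obtain c0 g0 where g0: "int e = c0 n" "g0 \<in> G" "of_int d * g0 = (\<Sum>i<Suc n. of_int (c0 i) * \<alpha> i)"
      using e(2) unfolding E_def by blast
    \<comment> \<open>Division with remainder: the remainder of \<open>c n\<close> modulo
      \<open>e\<close> is again a last coordinate and smaller than \<open>e\<close>, so minimality
      of \<open>e\<close> makes it zero.\<close>
    have reduce: "g - of_int q * g0 \<in> G' \<and> c n = q * c0 n"
      if g: "g \<in> G" "of_int d * g = (\<Sum>i<Suc n. of_int (c i) * \<alpha> i)" and q: "q = c n div int e"
      for g q and c :: "nat \<Rightarrow> int"
    proof -
      have diff: "g - of_int q * g0 \<in> G"
        by (intro int_module.subspace_diff[OF sub] int_module.subspace_scale[OF sub] g g0)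
      have "of_int d * (g - of_int q * g0) = of_int d * g - of_int q * (of_int d * g0)"
        by (simp add: algebra_simps)
      also have "\<dots> = (\<Sum>i<Suc n. of_int (c i - q * c0 i) * \<alpha> i)"
        unfolding g(2) g0(3)
        by (simp add: sum_distrib_left sum_subtractf algebra_simps del: sum.lessThan_Suc)
      finally have eq: "of_int d * (g - of_int q * g0) = (\<Sum>i<Suc n. of_int (c i - q * c0 i) * \<alpha> i)" .
      have mem: "c n - q * c0 n \<in> E" by (rule EI[where c = "\<lambda>i. c i - q * c0 i", OF diff eq])
      have mod: "c n - q * c0 n = c n mod int e"
        unfolding q g0(1)[symmetric] by (simp add: minus_div_mult_eq_mod)
      have "c n mod int e = 0"
      proof (rule ccontr)
        assume nz: "c n mod int e \<noteq> 0"
        have "c n mod int e \<ge> 0" by (rule pos_mod_sign) (use e(1) in linarith)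
        with nz have pos: "c n mod int e > 0" by linarith
        have E: "c n mod int e \<in> E" using mem unfolding mod .
        define f where "f = nat (c n mod int e)"
        have f: "int f = c n mod int e" unfolding f_def by (rule nat_0_le) (use pos in linarith)
        have "e \<le> f" proof (rule e_min)
          show "f > 0" using f pos by linarith
          show "int f \<in> E" unfolding f by (rule E)
        qed
        moreover have "c n mod int e < int e" by (rule pos_mod_bound) (use e(1) in linarith)
        ultimately have "int f < int e" "int e \<le> int f" using f by (simp_all only: of_nat_le_iff)
        then show False by linarith
      qed
      then have zero: "c n - q * c0 n = 0" using mod by simp
      then have "of_int d * (g - of_int q * g0) = (\<Sum>i<n. of_int (c i - q * c0 i) * \<alpha> i)"
        unfolding eq by simp
      from G'I[where c = "\<lambda>i. c i - q * c0 i", OF diff this] show ?thesis using zero by simp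
    qed
    define \<beta>' where "\<beta>' = \<beta>(k := g0)"
    have sumb: "(\<Sum>i<Suc k. of_int (c i) * \<beta>' i) = (\<Sum>i<k. of_int (c i) * \<beta> i) + of_int (c k) * g0" for c :: "nat \<Rightarrow> int"
      by (simp add: \<beta>'_def)
    show ?thesis
      unfolding int_basis_def
    proof (intro exI[of _ \<beta>'] exI[of _ "Suc k"] conjI allI impI ballI)
      fix i assume "i < Suc k"
      then show "\<beta>' i \<in> G" using IH(1) g0(2) by (auto simp: \<beta>'_def G'_def less_Suc_eq)
    next
      fix c :: "nat \<Rightarrow> int" and i
      assume z: "(\<Sum>i<Suc k. of_int (c i) * \<beta>' i) = 0" and i: "i < Suc k"
      obtain a where a: "\<forall>i<k. of_int d * \<beta> i = (\<Sum>j<n. of_int (a i j) * \<alpha> j)" using coords by blast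
      \<comment> \<open>Coordinates of \<open>d\<close> times the given relation. The elements of
        \<open>G'\<close> have no component along the last vector, so the last coordinate is
        \<open>c k * int e\<close>; its vanishing forces \<open>c k = 0\<close>.\<close>
      define b where "b = (\<lambda>j. (if j < n then (\<Sum>i<k. c i * a i j) else 0) + c k * c0 j)"
      have "0 = of_int d * (\<Sum>i<Suc k. of_int (c i) * \<beta>' i)" using z by simp
      also have "\<dots> = (\<Sum>i<k. of_int (c i) * (of_int d * \<beta> i)) + of_int (c k) * (of_int d * g0)"
        unfolding sumb distrib_left sum_distrib_left
        by (intro arg_cong2[where f = "(+)"] sum.cong refl mult.left_commute)
      also have "(\<Sum>i<k. of_int (c i) * (of_int d * \<beta> i)) = (\<Sum>i<k. \<Sum>j<n. of_int (c i * a i j) * \<alpha> j)"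
      proof (rule sum.cong[OF refl])
        fix i assume "i \<in> {..<k}"
        then have "of_int d * \<beta> i = (\<Sum>j<n. of_int (a i j) * \<alpha> j)" using a by blast
        then show "of_int (c i) * (of_int d * \<beta> i) = (\<Sum>j<n. of_int (c i * a i j) * \<alpha> j)"
          by (simp only: sum_distrib_left of_int_mult mult.assoc)
      qed
      also have "\<dots> = (\<Sum>j<n. of_int (\<Sum>i<k. c i * a i j) * \<alpha> j)"
        by (subst sum.swap) (simp only: sum_distrib_right of_int_sum)
      also have "\<dots> + of_int (c k) * (of_int d * g0) = (\<Sum>j<Suc n. of_int (b j) * \<alpha> j)"
      proof -
        have "of_int (c k) * (of_int d * g0) = (\<Sum>j<n. of_int (c k * c0 j) * \<alpha> j) + of_int (c k * c0 n) * \<alpha> n"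
          unfolding g0(3) sum.lessThan_Suc by (simp only: distrib_left sum_distrib_left of_int_mult mult.assoc)
        moreover have "(\<Sum>j<Suc n. of_int (b j) * \<alpha> j) =
            (\<Sum>j<n. of_int (\<Sum>i<k. c i * a i j) * \<alpha> j + of_int (c k * c0 j) * \<alpha> j) + of_int (c k * c0 n) * \<alpha> n"
          unfolding sum.lessThan_Suc
        proof (intro arg_cong2[where f = "(+)"] sum.cong refl)
          fix j assume "j \<in> {..<n}"
          then have "b j = (\<Sum>i<k. c i * a i j) + c k * c0 j" by (simp add: b_def)
          then show "of_int (b j) * \<alpha> j =
              of_int (\<Sum>i<k. c i * a i j) * \<alpha> j + of_int (c k * c0 j) * \<alpha> j"
            by (simp only: of_int_add distrib_right)
        next
          have "b n = c k * c0 n" by (simp add: b_def)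
          then show "of_int (b n) * \<alpha> n = of_int (c k * c0 n) * \<alpha> n" by (simp only:)
        qed
        ultimately show ?thesis by (simp only: sum.distrib add.assoc)
      qed
      finally have "(\<Sum>j<Suc n. of_int (b j) * \<alpha> j) = 0" by (rule sym)
      from Suc.prems(3)[OF this] have "b n = 0" by blast
      then have "c k * int e = 0" unfolding g0(1) by (simp add: b_def)
      then have ck: "c k = 0" using e(1) by simp
      then have "(\<Sum>i<k. of_int (c i) * \<beta> i) = 0" using z unfolding sumb by simp
      then show "c i = 0" using IH(2)[of c] ck i by (auto simp: less_Suc_eq)
    next
      fix g assume g: "g \<in> G"
      obtain c :: "nat \<Rightarrow> int" where c: "of_int d * g = (\<Sum>i<Suc n. of_int (c i) * \<alpha> i)"
        using Suc.prems(4)[OF g] by blast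
      define q where "q = c n div int e"
      obtain b :: "nat \<Rightarrow> int" where b: "g - of_int q * g0 = (\<Sum>i<k. of_int (b i) * \<beta> i)"
        using IH(3) reduce[OF g c q_def] by blast
      have "g = (\<Sum>i<k. of_int (b i) * \<beta> i) + of_int q * g0" unfolding b[symmetric] by simp
      also have "\<dots> = (\<Sum>i<Suc k. of_int ((b(k := q)) i) * \<beta>' i)" unfolding sumb by simp
      finally show "\<exists>c :: nat \<Rightarrow> int. g = (\<Sum>i<Suc k. of_int (c i) * \<beta>' i)" by blast
    qed
  qed
qed

section \<open>The ring of integers of a number field\<close>

locale number_field_set =
  fixes F :: "'k::{alg_closed_field, field_char_0} set"
  assumes number_field: "number_field F"
begin

lemma subfield: "is_subfield F"
  by (rule number_field_is_subfield[OF number_field])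

abbreviation integers :: "'k set" where "integers \<equiv> ring_of_integers F"

lemma integers_iff: "x \<in> integers \<longleftrightarrow> x \<in> F \<and> algebraic_int x"
  by (simp add: ring_of_integers_def alg_integers_def)

lemma integers_closed:
  "0 \<in> integers" "1 \<in> integers" "of_int k \<in> integers"
  "x \<in> integers \<Longrightarrow> y \<in> integers \<Longrightarrow> x + y \<in> integers"
  "x \<in> integers \<Longrightarrow> y \<in> integers \<Longrightarrow> x - y \<in> integers"
  "x \<in> integers \<Longrightarrow> y \<in> integers \<Longrightarrow> x * y \<in> integers"
  "x \<in> integers \<Longrightarrow> - x \<in> integers"
  "x \<in> integers \<Longrightarrow> x ^ n \<in> integers"
  using subfieldD[OF subfield] subfield_of_int[OF subfield]
  by (auto simp: integers_iff algebraic_int_add algebraic_int_diff algebraic_int_mult algebraic_int_power)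

lemma integers_sum: "(\<And>i. i \<in> A \<Longrightarrow> f i \<in> integers) \<Longrightarrow> (\<Sum>i\<in>A. f i) \<in> integers"
  by (induction A rule: infinite_finite_induct) (auto intro: integers_closed)

lemma subspace_integers: "int_module.subspace integers"
  by (rule int_module.subspaceI) (auto intro: integers_closed)

lemma ex_integer_multiple:
  assumes "x \<in> F"
  obtains m :: int where "m \<noteq> 0" "of_int m * x \<in> integers"
  using algebraic_int_multiple[OF number_field_algebraic[OF number_field assms]]
    subfieldD(4)[OF subfield subfield_of_int[OF subfield] assms] by (metis integers_iff)

lemma integral_primitive_element:
  obtains x where "x \<in> integers" "F = adjoin_rat x"
proof -
  obtain x where x: "x \<in> F" "F = adjoin_rat x" using number_field by (rule primitive_element)
  obtain m where m: "m \<noteq> 0" "of_int m * x \<in> integers" using x(1) by (rule ex_integer_multiple)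
  let ?y = "of_int m * x"
  have y: "?y \<in> F" "algebraic ?y" using m by (auto simp: integers_iff algebraic_int_imp_algebraic)
  note K = is_subfield_adjoin_rat[OF y(2)]
  have "of_rat (1 / of_int m) * ?y \<in> adjoin_rat ?y"
    by (intro subfieldD(4)[OF K] subfield_of_rat[OF K] adjoin_rat_self)
  then have "x \<in> adjoin_rat ?y" using m(1) by (simp add: of_rat_divide)
  then have "F \<subseteq> adjoin_rat ?y" unfolding x(2) using subfield_rpoly[OF K] by (auto simp: adjoin_rat_def)
  moreover have "adjoin_rat ?y \<subseteq> F" using subfield_rpoly[OF subfield y(1)] by (auto simp: adjoin_rat_def)
  ultimately show ?thesis using that[OF m(2)] by blast
qed

text \<open>With \<open>\<delta>\<close> the Vandermonde determinant of the conjugates of a primitive element, Cramer's rule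
  shows that \<open>\<delta>\<close> times each coordinate of an integer of \<open>F\<close> is an algebraic integer; an integer
  multiple of \<open>\<delta>\<close> turns it into a rational integer.\<close>

lemma ex_integral_basis: "\<exists>\<omega>. integral_basis F \<omega>"
proof -
  obtain x where x: "x \<in> integers" "F = adjoin_rat x" by (rule integral_primitive_element)
  have xF: "x \<in> F" "algebraic_int x" using x(1) by (auto simp: integers_iff)
  obtain p where p: "min_rat_poly x p"
    using algebraic_int_imp_algebraic[OF xF(2)] by (rule ex_min_rat_poly)
  define n where "n = degree p"
  obtain \<sigma> where \<sigma>: "set \<sigma> = embeddings F" "distinct \<sigma>"
    using finite_distinct_list[OF embeddings_number_field(1)[OF number_field]] by blast
  have len: "length \<sigma> = n"
    using distinct_card[OF \<sigma>(2)] \<sigma>(1) embeddings_number_field(2)[OF number_field]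
      field_degree_adjoin_rat[OF p] x(2) by (simp add: n_def)
  have \<sigma>E: "\<sigma> ! i \<in> embeddings F" if "i < n" for i using that \<sigma>(1) len nth_mem by blast
  note hom = embeddings_hom_on[OF \<sigma>E]
  define V where "V = mat n n (\<lambda>(i, j). ((\<sigma> ! i) x) ^ j)"
  have V: "V \<in> carrier_mat n n" by (simp add: V_def)
  have roots: "{z :: complex. rpoly p z = 0} = (\<lambda>i. (\<sigma> ! i) x) ` {..<n}"
  proof -
    have "{z :: complex. rpoly p z = 0} = (\<lambda>\<phi>. \<phi> x) ` embeddings F"
      using bij_betw_embeddings_roots[OF p] x(2) by (simp add: bij_betw_def)
    also have "embeddings F = (\<lambda>i. \<sigma> ! i) ` {..<n}"
      unfolding \<sigma>(1)[symmetric] set_conv_nth len by auto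
    finally show ?thesis by (simp add: image_image)
  qed
  have detV: "det V \<noteq> 0"
  proof
    assume "det V = 0"
    then obtain v where v: "v \<in> carrier_vec n" "v \<noteq> 0\<^sub>v n" "V *\<^sub>v v = 0\<^sub>v n"
      using det_0_iff_vec_prod_zero[OF V] by blast
    \<comment> \<open>A kernel vector is the coefficient vector of a non-zero polynomial of degree
      below \<open>n\<close> that vanishes at all \<open>n\<close> conjugates of
      \<open>x\<close>.\<close>
    define q where "q = (\<Sum>j<n. monom (v $ j) j)"
    have coeff: "coeff q j = (if j < n then v $ j else 0)" for j
      unfolding q_def by (simp add: coeff_sum)
    have "poly q ((\<sigma> ! i) x) = 0" if i: "i < n" for i
    proof -
      have "poly q ((\<sigma> ! i) x) = (V *\<^sub>v v) $ i"
        using i v(1) by (auto simp: q_def V_def poly_sum poly_monom scalar_prod_def lessThan_atLeast0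
            mult.commute intro!: sum.cong)
      then show ?thesis using v(3) i by simp
    qed
    then have sub: "{z. rpoly p z = 0} \<subseteq> {z. poly q z = 0}" unfolding roots by auto
    have "q \<noteq> 0"
    proof
      assume "q = 0"
      then have "v $ j = 0" if "j < n" for j using coeff[of j] that by simp
      then have "v = 0\<^sub>v n" using v(1) by (intro eq_vecI) auto
      then show False using v(2) by simp
    qed
    have "n > 0" using min_rat_poly_degree[OF p] by (simp add: n_def)
    then have "degree q < n" using coeff by (intro degree_lessI) auto
    moreover have "n \<le> card {z. poly q z = 0}"
      using card_mono[OF poly_roots_finite[OF \<open>q \<noteq> 0\<close>] sub] card_roots_min_rat_poly[OF p]
      by (simp add: n_def)
    moreover have "card {z. poly q z = 0} \<le> degree q"
      using \<open>q \<noteq> 0\<close> by (rule card_poly_roots_bound)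
    ultimately show False by simp
  qed
  have int_conj: "algebraic_int ((\<sigma> ! i) y)" if "i < n" "y \<in> integers" for i y
    using hom_on_algebraic_int[OF subfield hom[OF that(1)]] that(2) by (auto simp: integers_iff)
  have "algebraic_int (det V)"
    by (rule algebraic_int_det[OF V]) (auto simp: V_def intro!: algebraic_int_power int_conj x(1))
  then obtain d y where d: "d \<noteq> 0" "algebraic_int y" "det V * y = of_int d"
    using algebraic_int_dvd_int[OF _ detV] by metis
  have mult: "\<exists>c :: nat \<Rightarrow> int. of_int d * u = (\<Sum>j<n. of_int (c j) * x ^ j)" if u: "u \<in> integers" for u
  proof -
    have "u \<in> adjoin_rat x" using u unfolding x(2)[symmetric] by (simp add: integers_iff)
    then obtain c where c: "u = (\<Sum>j<n. of_rat (c j) * x ^ j)"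
      unfolding n_def by (rule adjoin_rat_sum_powers[OF p])
    have conj: "(\<sigma> ! i) u = (\<Sum>j<n. ((\<sigma> ! i) x) ^ j * of_rat (c j))" if i: "i < n" for i
    proof -
      have "u = rpoly (\<Sum>j<n. monom (c j) j) x" using c by (simp add: rpoly_sum poly_monom)
      then have "(\<sigma> ! i) u = rpoly (\<Sum>j<n. monom (c j) j) ((\<sigma> ! i) x)"
        using hom_on_rpoly[OF subfield hom[OF i] xF(1)] by metis
      then show ?thesis by (simp add: rpoly_sum poly_monom mult.commute)
    qed
    define w where "w = vec n (\<lambda>j. of_rat (c j) :: complex)"
    have w: "w \<in> carrier_vec n" by (simp add: w_def)
    have Vw: "V *\<^sub>v w = vec n (\<lambda>i. (\<sigma> ! i) u)"
      by (rule eq_vecI) (auto simp: V_def w_def conj scalar_prod_def lessThan_atLeast0)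
    have "\<exists>k. of_int d * c j = of_int k" if j: "j < n" for j
    proof -
      have "det (replace_col V (V *\<^sub>v w) j) = w $ j * det V"
        by (rule cramer_lemma_mat[OF V w j])
      moreover have "algebraic_int (det (replace_col V (V *\<^sub>v w) j))"
      proof (rule algebraic_int_det)
        show "replace_col V (V *\<^sub>v w) j \<in> carrier_mat n n" using V by (simp add: replace_col_def)
        fix i l assume "i < n" "l < n"
        then show "algebraic_int (replace_col V (V *\<^sub>v w) j $$ (i, l))"
          using V u x(1) unfolding Vw
          by (auto simp: replace_col_def V_def intro!: algebraic_int_power int_conj)
      qed
      ultimately have "algebraic_int (w $ j * det V * y)" using algebraic_int_mult d(2) by metis
      also have "w $ j * det V * y = of_rat (c j) * (det V * y)" using j by (simp add: w_def)
      also have "\<dots> = of_rat (of_int d * c j)" unfolding d(3) by (simp add: of_rat_mult)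
      finally have "algebraic_int (of_rat (of_int d * c j) :: complex)" .
      then have "(of_rat (of_int d * c j) :: complex) \<in> \<int>"
        by (rule rational_algebraic_int_is_int) simp
      then obtain k where "(of_rat (of_int d * c j) :: complex) = of_int k" by (auto elim: Ints_cases)
      then have "(of_rat (of_int d * c j) :: complex) = of_rat (of_int k)" by simp
      then show ?thesis by (metis of_rat_eq_iff)
    qed
    then obtain k where k: "\<And>j. j < n \<Longrightarrow> of_int d * c j = of_int (k j)" by metis
    have "of_int d * u = (\<Sum>j<n. of_rat (of_int d * c j) * x ^ j)"
      unfolding c by (simp add: sum_distrib_left of_rat_mult mult.assoc)
    also have "\<dots> = (\<Sum>j<n. of_int (k j) * x ^ j)" by (rule sum.cong) (auto simp: k)
    finally show ?thesis by blast
  qed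
  have indep: "\<forall>i<n. c i = 0" if z: "(\<Sum>i<n. of_int (c i) * x ^ i) = 0" for c :: "nat \<Rightarrow> int"
  proof -
    define q where "q = (\<Sum>i<n. monom (of_int (c i) :: rat) i)"
    have coeff: "coeff q j = (if j < n then of_int (c j) else 0)" for j
      unfolding q_def by (simp add: coeff_sum)
    have "rpoly q x = 0" using z by (simp add: q_def rpoly_sum poly_monom)
    then have "p dvd q" using p by (simp add: min_rat_poly_def)
    have "q = 0"
    proof (rule ccontr)
      assume "q \<noteq> 0"
      then have "n \<le> degree q" using \<open>p dvd q\<close> dvd_imp_degree_le by (auto simp: n_def)
      moreover have "n > 0" using min_rat_poly_degree[OF p] by (simp add: n_def)
      then have "degree q < n" using coeff by (intro degree_lessI) auto
      ultimately show False by simp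
    qed
    then show ?thesis using coeff by (metis coeff_0 of_int_0_eq_iff)
  qed
  have "\<exists>\<beta> k. int_basis \<beta> k integers"
    by (rule subgroup_basis[OF subspace_integers d(1) indep mult])
  then obtain \<beta> k where "int_basis \<beta> k integers" by blast
  note \<beta> = int_basisD[OF this]
  have "integral_basis F (map \<beta> [0..<k])"
    unfolding integral_basis_def
  proof (intro conjI ballI)
    show "set (map \<beta> [0..<k]) \<subseteq> integers" using \<beta>(1) by auto
    fix u assume "u \<in> integers"
    then obtain c :: "nat \<Rightarrow> int" where c: "u = (\<Sum>i<k. of_int (c i) * \<beta> i)" using \<beta>(3) by blast
    show "\<exists>!c :: int list. length c = length (map \<beta> [0..<k]) \<and>
        u = (\<Sum>i<length (map \<beta> [0..<k]). of_int (c ! i) * map \<beta> [0..<k] ! i)"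
    proof (rule ex1I[of _ "map c [0..<k]"])
      show "length (map c [0..<k]) = length (map \<beta> [0..<k]) \<and>
        u = (\<Sum>i<length (map \<beta> [0..<k]). of_int (map c [0..<k] ! i) * map \<beta> [0..<k] ! i)"
        using c by simp
      fix c' :: "int list" assume c': "length c' = length (map \<beta> [0..<k]) \<and>
        u = (\<Sum>i<length (map \<beta> [0..<k]). of_int (c' ! i) * map \<beta> [0..<k] ! i)"
      then have "(\<Sum>i<k. of_int (c' ! i - c i) * \<beta> i) = 0"
        using c by (simp add: left_diff_distrib sum_subtractf)
      then have "\<forall>i<k. c' ! i - c i = 0" by (rule \<beta>(2))
      then show "c' = map c [0..<k]" using c' by (intro nth_equalityI) auto
    qed
  qed
  then show ?thesis by blast
qed

end

section \<open>Ideals\<close>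

lemma common_denominator:
  fixes c :: "nat \<Rightarrow> rat"
  shows "\<exists>D :: int. D > 0 \<and> (\<forall>i<n. \<exists>k :: int. of_int D * c i = of_int k)"
proof (induction n)
  case 0
  show ?case by (rule exI[of _ 1]) simp
next
  case (Suc n)
  then obtain D where D: "D > 0" "\<forall>i<n. \<exists>k :: int. of_int D * c i = of_int k" by blast
  obtain a b where ab: "c n = Rat.Fract a b" "b > 0" by (cases "c n") auto
  have last: "of_int (D * b) * c n = of_int (D * a)"
    using ab by (simp add: Fract_of_int_quotient del: of_int_eq_iff)
  have "\<exists>k :: int. of_int (D * b) * c i = of_int k" if "i < n" for i
  proof -
    obtain k :: int where k: "of_int D * c i = of_int k" using D(2) \<open>i < n\<close> by blast
    have "of_int (D * b) * c i = of_int b * (of_int D * c i)" by (simp only: of_int_mult ac_simps)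
    also have "\<dots> = of_int (b * k)" unfolding k by (simp only: of_int_mult)
    finally show ?thesis by blast
  qed
  with last have "\<forall>i<Suc n. \<exists>k :: int. of_int (D * b) * c i = of_int k"
    unfolding less_Suc_eq by blast
  moreover have "D * b > 0" using D(1) ab(2) by simp
  ultimately show ?case by blast
qed

context number_field_set
begin

section \<open>Coordinates with respect to an integral basis\<close>

lemma basis_nth: "integral_basis F \<omega> \<Longrightarrow> i < length \<omega> \<Longrightarrow> \<omega> ! i \<in> integers"
  by (auto simp: integral_basis_def)

lemma basis_span_int:
  assumes "integral_basis F \<omega>" "u \<in> integers"
  obtains c :: "nat \<Rightarrow> int" where "u = (\<Sum>i<length \<omega>. of_int (c i) * \<omega> ! i)"
proof -
  obtain c :: "int list" where "u = (\<Sum>i<length \<omega>. of_int (c ! i) * \<omega> ! i)"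
    using assms unfolding integral_basis_def by blast
  then show ?thesis by (rule that)
qed

lemma basis_independent_int:
  assumes \<omega>: "integral_basis F \<omega>" and z: "(\<Sum>i<length \<omega>. of_int (c i) * \<omega> ! i) = 0"
    and i: "i < length \<omega>"
  shows "(c :: nat \<Rightarrow> int) i = 0"
proof -
  let ?n = "length \<omega>"
  have "\<exists>!c :: int list. length c = ?n \<and> 0 = (\<Sum>i<?n. of_int (c ! i) * \<omega> ! i)"
    using \<omega> integers_closed(1) unfolding integral_basis_def by blast
  moreover have "length (map c [0..<?n]) = ?n \<and> 0 = (\<Sum>i<?n. of_int (map c [0..<?n] ! i) * \<omega> ! i)"
    using z by simp
  moreover have "length (replicate ?n 0) = ?n \<and> 0 = (\<Sum>i<?n. of_int (replicate ?n 0 ! i) * \<omega> ! i)"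
    by simp
  ultimately have "map c [0..<?n] = replicate ?n 0" by blast
  then have "map c [0..<?n] ! i = replicate ?n 0 ! i" by simp
  then show ?thesis using i by simp
qed

lemma basis_independent_rat:
  assumes \<omega>: "integral_basis F \<omega>" and z: "(\<Sum>i<length \<omega>. of_rat (c i) * \<omega> ! i) = 0"
    and i: "i < length \<omega>"
  shows "c i = 0"
proof -
  let ?n = "length \<omega>"
  obtain D :: int where D: "D > 0" "\<forall>i<?n. \<exists>k :: int. of_int D * c i = of_int k"
    using common_denominator by blast
  then obtain k :: "nat \<Rightarrow> int" where k: "\<And>i. i < ?n \<Longrightarrow> of_int D * c i = of_int (k i)" by metis
  have "0 = of_int D * (\<Sum>i<?n. of_rat (c i) * \<omega> ! i)" using z by simp
  also have "\<dots> = (\<Sum>i<?n. of_rat (of_int D * c i) * \<omega> ! i)"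
    unfolding sum_distrib_left by (intro sum.cong refl) (simp only: of_rat_mult of_rat_of_int_eq mult.assoc)
  also have "\<dots> = (\<Sum>i<?n. of_int (k i) * \<omega> ! i)" by (rule sum.cong) (auto simp: k)
  finally have "k i = 0" using basis_independent_int[OF \<omega> _ i, of k] by simp
  then show ?thesis using k[OF i] D(1) by simp
qed

lemma basis_span_rat:
  assumes \<omega>: "integral_basis F \<omega>" and u: "u \<in> F"
  obtains c where "u = (\<Sum>i<length \<omega>. of_rat (c i) * \<omega> ! i)"
proof -
  obtain m where m: "m \<noteq> 0" "of_int m * u \<in> integers" using u by (rule ex_integer_multiple)
  obtain c :: "nat \<Rightarrow> int" where c: "of_int m * u = (\<Sum>i<length \<omega>. of_int (c i) * \<omega> ! i)"
    using \<omega> m(2) by (rule basis_span_int)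
  have "u = of_rat (1 / of_int m) * (of_int m * u)" using m(1) by (simp add: of_rat_divide)
  also have "\<dots> = (\<Sum>i<length \<omega>. of_rat (of_int (c i) / of_int m) * \<omega> ! i)"
    unfolding c sum_distrib_left by (intro sum.cong) (auto simp: of_rat_divide)
  finally show ?thesis by (rule that)
qed

text \<open>An integral basis is also a basis over the rationals: rational relations can be cleared
  of denominators, and every element of \<open>F\<close> has an integral multiple.\<close>

lemma basis_length:
  assumes \<omega>: "integral_basis F \<omega>" shows "length \<omega> = field_degree F"
proof -
  let ?n = "length \<omega>"
  have inj: "inj_on (\<lambda>i. \<omega> ! i) {..<?n}"
  proof (rule inj_onI, rule ccontr)
    fix i j assume ij: "i \<in> {..<?n}" "j \<in> {..<?n}" "\<omega> ! i = \<omega> ! j" "i \<noteq> j"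
    let ?c = "\<lambda>k. (if k = i then 1 else 0) - (if k = j then 1 else 0) :: int"
    have "(\<Sum>k<?n. of_int (?c k) * \<omega> ! k) =
        (\<Sum>k<?n. (if k = i then \<omega> ! i else 0) - (if k = j then \<omega> ! j else 0))"
      by (rule sum.cong) auto
    also have "\<dots> = 0" using ij by (simp add: sum_subtractf)
    finally have "?c i = 0" using basis_independent_int[OF \<omega>, of ?c i] ij by blast
    then show False using ij(4) by simp
  qed
  have set: "set \<omega> = (\<lambda>i. \<omega> ! i) ` {..<?n}" by (auto simp: set_conv_nth)
  have card: "card (set \<omega>) = ?n" unfolding set by (simp add: card_image[OF inj])
  have "rat_vs.independent (set \<omega>)"
  proof (rule rat_vs.independent_if_scalars_zero)
    fix f y assume z: "(\<Sum>y\<in>set \<omega>. rat_scale (f y) y) = 0" and y: "y \<in> set \<omega>"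
    obtain i where i: "i < ?n" "y = \<omega> ! i" using y by (auto simp: set_conv_nth)
    have "(\<Sum>i<?n. of_rat (f (\<omega> ! i)) * \<omega> ! i) = 0"
      using z unfolding set by (simp add: sum.reindex[OF inj] rat_scale_def)
    from basis_independent_rat[OF \<omega> this i(1)] show "f y = 0" using i by simp
  qed simp
  moreover have "F \<subseteq> rat_vs.span (set \<omega>)"
  proof
    fix u assume "u \<in> F"
    then obtain c where "u = (\<Sum>i<?n. of_rat (c i) * \<omega> ! i)" by (rule basis_span_rat[OF \<omega>])
    also have "\<dots> = (\<Sum>i<?n. rat_scale (c i) (\<omega> ! i))" by (simp add: rat_scale_def)
    also have "\<dots> \<in> rat_vs.span (set \<omega>)"
      by (intro rat_vs.span_sum rat_vs.span_scale rat_vs.span_base) auto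
    finally show "u \<in> rat_vs.span (set \<omega>)" .
  qed
  moreover have "set \<omega> \<subseteq> F" using \<omega> by (auto simp: integral_basis_def integers_iff)
  ultimately have "rat_vs.dim F = ?n" using card by (intro rat_vs.dim_unique)
  then show ?thesis by (simp add: field_degree_def)
qed

section \<open>Ideals and finiteness of residues\<close>

abbreviation ideal :: "'k set \<Rightarrow> bool" where "ideal \<equiv> is_ideal_of integers"

lemma idealD:
  assumes "ideal I"
  shows "x \<in> I \<Longrightarrow> x \<in> integers" "0 \<in> I" "x \<in> I \<Longrightarrow> y \<in> I \<Longrightarrow> x + y \<in> I"
    "r \<in> integers \<Longrightarrow> x \<in> I \<Longrightarrow> r * x \<in> I" "x \<in> I \<Longrightarrow> r \<in> integers \<Longrightarrow> x * r \<in> I"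
    "x \<in> I \<Longrightarrow> y \<in> I \<Longrightarrow> x - y \<in> I"
proof -
  show *: "x \<in> I \<Longrightarrow> x \<in> integers" "0 \<in> I" "\<And>x y. x \<in> I \<Longrightarrow> y \<in> I \<Longrightarrow> x + y \<in> I"
    "\<And>r x. r \<in> integers \<Longrightarrow> x \<in> I \<Longrightarrow> r * x \<in> I"
    using assms by (auto simp: is_ideal_of_def)
  then show "x \<in> I \<Longrightarrow> r \<in> integers \<Longrightarrow> x * r \<in> I" by (simp add: mult.commute)
  have "- y \<in> I" if "y \<in> I" for y
    using *(4)[OF integers_closed(7)[OF integers_closed(2)] that] by simp
  then show "x \<in> I \<Longrightarrow> y \<in> I \<Longrightarrow> x - y \<in> I" using *(3)[of x "- y"] by simp
qed

lemma ideal_integers: "ideal integers"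
  by (auto simp: is_ideal_of_def intro: integers_closed)

lemma ideal_eq_integers: "ideal I \<Longrightarrow> 1 \<in> I \<Longrightarrow> I = integers"
  using idealD(1) idealD(4)[of I _ 1] by auto

lemma ideal_has_int:
  assumes "ideal I" "I \<noteq> {0}"
  obtains m :: int where "m \<noteq> 0" "of_int m \<in> I"
proof -
  obtain x where x: "x \<in> I" "x \<noteq> 0" using assms idealD(2)[OF assms(1)] by blast
  then have xi: "x \<in> F" "algebraic_int x" using idealD(1)[OF assms(1)] by (auto simp: integers_iff)
  obtain y and d :: int where d: "d \<noteq> 0" "algebraic_int y" "x * y = of_int d"
    using xi(2) x(2) by (rule algebraic_int_dvd_int)
  have "y = of_int d / x" using d(3) x(2) by (simp add: field_simps)
  then have "y \<in> F" using subfieldD(8)[OF subfield subfield_of_int[OF subfield] xi(1)] by simp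
  then have "of_int d \<in> I" using idealD(5)[OF assms(1) x(1), of y] d by (simp add: integers_iff)
  then show ?thesis by (rule that[OF d(1)])
qed

text \<open>Reducing the coordinates modulo \<open>m\<close> leaves finitely many values. All later
  finiteness and pigeonhole arguments about ideals start from this.\<close>

lemma finite_residues:
  assumes "m \<noteq> (0 :: int)"
  obtains R where "finite R" "R \<subseteq> integers"
    "\<forall>x\<in>integers. \<exists>r\<in>R. \<exists>u\<in>integers. x - r = of_int m * u"
proof -
  obtain \<omega> where \<omega>: "integral_basis F \<omega>" using ex_integral_basis by blast
  let ?n = "length \<omega>"
  define val where "val = (\<lambda>c :: nat \<Rightarrow> int. \<Sum>i<?n. of_int (c i) * \<omega> ! i)"
  have val: "val c \<in> integers" for c
    unfolding val_def using basis_nth[OF \<omega>] by (intro integers_sum integers_closed(3,6)) auto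
  \<comment> \<open>A symmetric range of coordinates covers either sign of \<open>m\<close>. It
    contains repetitions, which do not matter for a set of representatives that only has to be
    finite.\<close>
  define R where "R = val ` ({..<?n} \<rightarrow>\<^sub>E {- \<bar>m\<bar>..\<bar>m\<bar>})"
  have "finite R" unfolding R_def by (intro finite_imageI finite_PiE) auto
  moreover have "R \<subseteq> integers" using val by (auto simp: R_def)
  moreover have "\<exists>r\<in>R. \<exists>u\<in>integers. x - r = of_int m * u" if "x \<in> integers" for x
  proof -
    obtain c :: "nat \<Rightarrow> int" where c: "x = val c"
      unfolding val_def using \<omega> \<open>x \<in> integers\<close> by (rule basis_span_int)
    have "c i mod m \<in> {- \<bar>m\<bar>..\<bar>m\<bar>}" for i
      using abs_mod_less[OF assms, of "c i"] unfolding atLeastAtMost_iff by linarith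
    then have "restrict (\<lambda>i. c i mod m) {..<?n} \<in> {..<?n} \<rightarrow>\<^sub>E {- \<bar>m\<bar>..\<bar>m\<bar>}" by simp
    moreover have "x - val (restrict (\<lambda>i. c i mod m) {..<?n}) = of_int m * val (\<lambda>i. c i div m)"
    proof -
      have "x - val (restrict (\<lambda>i. c i mod m) {..<?n}) =
          (\<Sum>i<?n. of_int (c i) * \<omega> ! i - of_int (c i mod m) * \<omega> ! i)"
        unfolding c val_def sum_subtractf by simp
      also have "\<dots> = (\<Sum>i<?n. of_int m * (of_int (c i div m) * \<omega> ! i))"
      proof (rule sum.cong[OF refl])
        fix i
        have "of_int (c i) * \<omega> ! i - of_int (c i mod m) * \<omega> ! i = of_int (c i - c i mod m) * \<omega> ! i"
          by (simp only: of_int_diff left_diff_distrib)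
        also have "c i - c i mod m = m * (c i div m)" by (rule minus_mod_eq_mult_div)
        finally show "of_int (c i) * \<omega> ! i - of_int (c i mod m) * \<omega> ! i =
            of_int m * (of_int (c i div m) * \<omega> ! i)" by (simp only: of_int_mult mult.assoc)
      qed
      finally show ?thesis by (simp only: val_def sum_distrib_left)
    qed
    ultimately show ?thesis using val unfolding R_def by blast
  qed
  ultimately show ?thesis using that by blast
qed

text \<open>An ideal containing \<open>m\<close> is determined by the representatives it contains.
  This finiteness yields maximal and minimal ideals as well as a measure for induction.\<close>

lemma finite_ideals:
  assumes "m \<noteq> (0 :: int)" shows "finite {I. ideal I \<and> of_int m \<in> I}"
proof -
  obtain R where R: "finite R" "R \<subseteq> integers"
    "\<forall>x\<in>integers. \<exists>r\<in>R. \<exists>u\<in>integers. x - r = of_int m * u"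
    using assms by (rule finite_residues)
  have sub: "I \<subseteq> I'" if I: "ideal I" "of_int m \<in> I" and I': "ideal I'" "of_int m \<in> I'"
    and eq: "I \<inter> R = I' \<inter> R" for I I'
  proof
    fix x assume x: "x \<in> I"
    then obtain r u where ru: "r \<in> R" "u \<in> integers" "x - r = of_int m * u"
      using R(3) idealD(1)[OF I(1)] by blast
    have "x - of_int m * u \<in> I" by (intro idealD(6)[OF I(1)] x idealD(5)[OF I(1)] I(2) ru(2))
    also have "x - of_int m * u = r" unfolding ru(3)[symmetric] by simp
    finally have "r \<in> I'" using eq ru(1) by blast
    then have "r + of_int m * u \<in> I'" by (intro idealD(3)[OF I'(1)] idealD(5)[OF I'(1)] I'(2) ru(2))
    then show "x \<in> I'" unfolding ru(3)[symmetric] by simp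
  qed
  have "inj_on (\<lambda>I. I \<inter> R) {I. ideal I \<and> of_int m \<in> I}"
    by (rule inj_onI) (use sub in blast)
  moreover have "(\<lambda>I. I \<inter> R) ` {I. ideal I \<and> of_int m \<in> I} \<subseteq> Pow R" by blast
  ultimately show ?thesis using R(1) by (meson finite_Pow_iff finite_subset inj_on_finite)
qed

lemma ideal_add_principal:
  assumes I: "ideal I" and x: "x \<in> integers"
  shows "ideal {j + x * r | j r. j \<in> I \<and> r \<in> integers}"
  unfolding is_ideal_of_def
proof (intro conjI ballI)
  let ?J = "{j + x * r | j r. j \<in> I \<and> r \<in> integers}"
  show "?J \<subseteq> integers" using idealD(1)[OF I] x by (auto intro!: integers_closed)
  have "0 = 0 + x * 0 \<and> 0 \<in> I \<and> 0 \<in> integers" using idealD(2)[OF I] integers_closed(1) by simp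
  then show "0 \<in> ?J" by blast
  fix a b assume "a \<in> ?J" "b \<in> ?J"
  then obtain j r j' r' where jr: "j \<in> I" "r \<in> integers" "j' \<in> I" "r' \<in> integers"
    "a = j + x * r" "b = j' + x * r'" by auto
  have "a + b = (j + j') + x * (r + r')" by (simp add: jr algebra_simps)
  then show "a + b \<in> ?J" using jr idealD(3)[OF I] integers_closed(4) by blast
next
  let ?J = "{j + x * r | j r. j \<in> I \<and> r \<in> integers}"
  fix s a assume s: "s \<in> integers" and "a \<in> ?J"
  then obtain j r where jr: "j \<in> I" "r \<in> integers" "a = j + x * r" by auto
  have "s * a = s * j + x * (s * r)" by (simp add: jr algebra_simps)
  then show "s * a \<in> ?J" using jr s idealD(4)[OF I s] integers_closed(6) by blast
qed

lemma ideal_add_principal_mem: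
  assumes "ideal I" "x \<in> integers"
  shows "I \<subseteq> {j + x * r | j r. j \<in> I \<and> r \<in> integers}" "x \<in> {j + x * r | j r. j \<in> I \<and> r \<in> integers}"
proof -
  show "I \<subseteq> {j + x * r | j r. j \<in> I \<and> r \<in> integers}"
  proof
    fix y assume "y \<in> I"
    then have "y = y + x * 0 \<and> y \<in> I \<and> 0 \<in> integers" using integers_closed(1) by simp
    then show "y \<in> {j + x * r | j r. j \<in> I \<and> r \<in> integers}" by blast
  qed
  show "x \<in> {j + x * r | j r. j \<in> I \<and> r \<in> integers}"
  proof -
    have "x = 0 + x * 1 \<and> 0 \<in> I \<and> 1 \<in> integers"
      using integers_closed(2) idealD(2)[OF assms(1)] by simp
    then show ?thesis by blast
  qed
qed

section \<open>Prime ideals and inverses of proper ideals\<close>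

text \<open>Take \<open>M\<close> maximal among the finitely many proper ideals above
  \<open>I\<close>. If \<open>y\<close> is not in \<open>M\<close>, then
  \<open>1 = j + y * r\<close> with \<open>j\<close> in \<open>M\<close>; multiplying by
  \<open>x\<close> shows that \<open>x * y\<close> in \<open>M\<close> implies \<open>x\<close> in
  \<open>M\<close>.\<close>

lemma ex_prime_ideal:
  assumes I: "ideal I" "1 \<notin> I" and m: "m \<noteq> 0" "of_int m \<in> I"
  obtains M where "ideal M" "I \<subseteq> M" "1 \<notin> M"
    "\<forall>x\<in>integers. \<forall>y\<in>integers. x * y \<in> M \<longrightarrow> x \<in> M \<or> y \<in> M"
proof -
  let ?A = "{M. ideal M \<and> I \<subseteq> M \<and> 1 \<notin> M}"
  have "finite ?A" by (rule finite_subset[OF _ finite_ideals[OF m(1)]]) (use m(2) in blast)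
  moreover have "I \<in> ?A" using I by simp
  ultimately obtain M where M: "M \<in> ?A" and max: "\<forall>N\<in>?A. M \<subseteq> N \<longrightarrow> M = N"
    using finite_has_maximal2[of ?A I] by blast
  have prime: "x \<in> M \<or> y \<in> M" if xy: "x \<in> integers" "y \<in> integers" "x * y \<in> M" for x y
  proof (rule disjCI)
    assume "y \<notin> M"
    let ?N = "{j + y * r | j r. j \<in> M \<and> r \<in> integers}"
    have idM: "ideal M" using M by simp
    note N = ideal_add_principal[OF idM xy(2)] ideal_add_principal_mem[OF idM xy(2)]
    have "1 \<in> ?N"
    proof (rule ccontr)
      assume "1 \<notin> ?N"
      then have "?N \<in> ?A" using N M by blast
      then show False using max N \<open>y \<notin> M\<close> by blast
    qed
    then obtain j r where jr: "1 = j + y * r" "j \<in> M" "r \<in> integers" by auto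
    have "x = x * (j + y * r)" using jr(1) by simp
    also have "\<dots> = x * j + x * y * r" by (simp add: algebra_simps)
    also have "\<dots> \<in> M"
      by (intro idealD(3)[OF idM] idealD(4)[OF idM xy(1)] idealD(5)[OF idM] jr xy(3))
    finally show "x \<in> M" .
  qed
  show ?thesis by (rule that[of M]) (use M prime in auto)
qed

text \<open>The residues of \<open>M\<close> modulo \<open>m\<close> are treated one at a time. The invariant, that \<open>b\<close> is not killed
  modulo \<open>m\<close> by any element outside \<open>M\<close>, means that \<open>b\<close> is non-zero in the localisation at \<open>M\<close>,
  where \<open>x \<in> M\<close> is nilpotent: \<open>x ^ i * (1 - x ^ (j - i))\<close> vanishes modulo \<open>m\<close> for some \<open>i < j\<close>.\<close>

lemma annihilator_step:
  assumes M: "ideal M" "1 \<notin> M"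
    and prime: "\<forall>x\<in>integers. \<forall>y\<in>integers. x * y \<in> M \<longrightarrow> x \<in> M \<or> y \<in> M"
    and m: "m \<noteq> (0 :: int)"
    and b: "b \<in> integers" "\<forall>s\<in>integers - M. s * b \<notin> (*) (of_int m) ` integers"
    and x: "x \<in> M"
  obtains c where "c \<in> integers" "\<forall>s\<in>integers - M. s * (c * b) \<notin> (*) (of_int m) ` integers"
    "x * (c * b) \<in> (*) (of_int m) ` integers"
proof -
  let ?mO = "(*) (of_int m) ` integers"
  have xO: "x \<in> integers" using idealD(1)[OF M(1) x] .
  obtain R where R: "finite R" "R \<subseteq> integers"
    "\<forall>x\<in>integers. \<exists>r\<in>R. \<exists>u\<in>integers. x - r = of_int m * u"
    using m by (rule finite_residues)
  have "\<forall>i. \<exists>r. r \<in> R \<and> x ^ i - r \<in> ?mO" using R(3) integers_closed(8)[OF xO] by blast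
  then obtain f where f: "\<And>i. f i \<in> R" "\<And>i. x ^ i - f i \<in> ?mO" by metis
  \<comment> \<open>There are infinitely many exponents but only finitely many residues, so two
    powers of \<open>x\<close> are congruent modulo \<open>m\<close>.\<close>
  have "\<not> inj f"
  proof
    assume "inj f"
    then have "finite (UNIV :: nat set)" using R(1) f(1) by (metis finite_imageD finite_subset image_subsetI)
    then show False by simp
  qed
  then obtain i j where ij: "i < j" "f i = f j" by (metis injI linorder_neqE_nat)
  define s0 where "s0 = 1 - x ^ (j - i)"
  have "x ^ (j - i) \<in> M"
    using idealD(5)[OF M(1) x integers_closed(8)[OF xO], of "j - i - 1"] ij(1)
    by (simp add: power_Suc[symmetric] Suc_diff_Suc)
  then have s0: "s0 \<in> integers - M"
    using idealD(3)[OF M(1), of s0 "x ^ (j - i)"] M(2) integers_closed(2,5) integers_closed(8)[OF xO]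
    by (auto simp: s0_def)
  obtain u v where uv: "u \<in> integers" "v \<in> integers" "x ^ i - f i = of_int m * u" "x ^ j - f j = of_int m * v"
    using f(2)[of i] f(2)[of j] by blast
  have "s0 * (x ^ i * b) = (x ^ i - x ^ j) * b"
    using ij(1) by (simp add: s0_def algebra_simps power_add[symmetric])
  also have "x ^ i - x ^ j = of_int m * (u - v)"
    using uv(3,4) ij(2) by (simp add: right_diff_distrib algebra_simps)
  finally have "s0 * (x ^ i * b) = of_int m * ((u - v) * b)" by (simp only: mult.assoc)
  moreover have "(u - v) * b \<in> integers" by (intro integers_closed(5,6) uv(1,2) b(1))
  ultimately have bad_i: "s0 * (x ^ i * b) \<in> ?mO" by blast
  \<comment> \<open>The least exponent for which some \<open>s\<close> outside \<open>M\<close>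
    kills \<open>x ^ k * b\<close>. It is positive by the invariant, and
    \<open>s * x ^ (k - 1)\<close> is the required factor: one more \<open>x\<close> kills the
    product, while primality of \<open>M\<close> preserves the invariant.\<close>
  define k where "k = (LEAST k. \<exists>s\<in>integers - M. s * (x ^ k * b) \<in> ?mO)"
  have ex: "\<exists>k. \<exists>s\<in>integers - M. s * (x ^ k * b) \<in> ?mO" using bad_i s0 by blast
  then obtain s where s: "s \<in> integers - M" "s * (x ^ k * b) \<in> ?mO"
    using LeastI_ex[OF ex] unfolding k_def by blast
  have "k \<noteq> 0" using b(2) s by (metis mult_1 power_0)
  then obtain l where l: "k = Suc l" by (cases k) auto
  have good_l: "t * (x ^ l * b) \<notin> ?mO" if "t \<in> integers - M" for t
    using not_less_Least[of l "\<lambda>k. \<exists>s\<in>integers - M. s * (x ^ k * b) \<in> ?mO"] that l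
    unfolding k_def by auto
  show ?thesis
  proof (rule that[of "s * x ^ l"])
    show "s * x ^ l \<in> integers" using s(1) integers_closed(6,8) xO by blast
    show "\<forall>t\<in>integers - M. t * (s * x ^ l * b) \<notin> ?mO"
    proof
      fix t assume t: "t \<in> integers - M"
      have "t * s \<in> integers - M" using t s(1) prime integers_closed(6) by blast
      from good_l[OF this] show "t * (s * x ^ l * b) \<notin> ?mO" by (simp only: mult.assoc not_False_eq_True)
    qed
    show "x * (s * x ^ l * b) \<in> ?mO" using s(2) by (simp add: l mult_ac)
  qed
qed

text \<open>Only the representatives in \<open>R \<inter> M\<close> have to be annihilated, since
  the other elements of \<open>M\<close> differ from them by multiples of \<open>m\<close>. The
  process starts with 1, for which the invariant holds because multiples of \<open>m\<close> lie in
  \<open>M\<close>.\<close>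

lemma ex_annihilator:
  assumes M: "ideal M" "1 \<notin> M"
    and prime: "\<forall>x\<in>integers. \<forall>y\<in>integers. x * y \<in> M \<longrightarrow> x \<in> M \<or> y \<in> M"
    and m: "m \<noteq> (0 :: int)" "of_int m \<in> M"
  obtains b where "b \<in> integers" "b \<notin> (*) (of_int m) ` integers"
    "\<forall>x\<in>M. x * b \<in> (*) (of_int m) ` integers"
proof -
  let ?mO = "(*) (of_int m) ` integers"
  have mO: "of_int m * u \<in> M" if "u \<in> integers" for u using idealD(5)[OF M(1) m(2) that] .
  have closed: "c * y \<in> ?mO" if "c \<in> integers" "y \<in> ?mO" for c y
  proof -
    from that(2) obtain u where "u \<in> integers" "y = of_int m * u" by blast
    then have "c * y = of_int m * (c * u)" "c * u \<in> integers"
      using that(1) integers_closed(6) by (auto simp: mult_ac)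
    then show ?thesis by blast
  qed
  obtain R where R: "finite R" "R \<subseteq> integers"
    "\<forall>x\<in>integers. \<exists>r\<in>R. \<exists>u\<in>integers. x - r = of_int m * u"
    using m(1) by (rule finite_residues)
  have "finite S \<Longrightarrow> S \<subseteq> M \<Longrightarrow> \<exists>b\<in>integers. (\<forall>s\<in>integers - M. s * b \<notin> ?mO) \<and> (\<forall>x\<in>S. x * b \<in> ?mO)" for S
  proof (induction S rule: finite_induct)
    case empty
    have "s * 1 \<notin> ?mO" if "s \<in> integers - M" for s using mO that by auto
    then show ?case using integers_closed(2) by blast
  next
    case (insert x S)
    then obtain b where b: "b \<in> integers" "\<forall>s\<in>integers - M. s * b \<notin> ?mO" "\<forall>y\<in>S. y * b \<in> ?mO"
      by auto
    have x: "x \<in> M" using insert.prems by simp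
    obtain c where c: "c \<in> integers" "\<forall>s\<in>integers - M. s * (c * b) \<notin> ?mO" "x * (c * b) \<in> ?mO"
      by (rule annihilator_step[OF M prime m(1) b(1,2) x])
    have "y * (c * b) \<in> ?mO" if "y \<in> insert x S" for y
    proof (cases "y = x")
      case False
      then have "c * (y * b) \<in> ?mO" using closed c(1) b(3) that by blast
      then show ?thesis by (simp only: mult.left_commute)
    qed (use c(3) in simp)
    then show ?case using c(1,2) b(1) integers_closed(6) by blast
  qed
  from this[of "R \<inter> M"] R(1) obtain b where b: "b \<in> integers"
    "\<forall>s\<in>integers - M. s * b \<notin> ?mO" "\<forall>x\<in>R \<inter> M. x * b \<in> ?mO" by blast
  show ?thesis
  proof (rule that[OF b(1)])
    have "1 \<in> integers - M" using M(2) integers_closed(2) by blast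
    then have "1 * b \<notin> ?mO" using b(2) by blast
    then show "b \<notin> ?mO" by simp
    show "\<forall>x\<in>M. x * b \<in> ?mO"
    proof
      fix x assume x: "x \<in> M"
      then obtain r u where ru: "r \<in> R" "u \<in> integers" "x - r = of_int m * u"
        using R(3) idealD(1)[OF M(1)] by blast
      have "x - of_int m * u \<in> M" using idealD(6)[OF M(1) x mO[OF ru(2)]] .
      also have "x - of_int m * u = r" unfolding ru(3)[symmetric] by simp
      finally obtain v where v: "v \<in> integers" "r * b = of_int m * v" using b(3) ru(1) by blast
      have "x * b = (r + of_int m * u) * b" unfolding ru(3)[symmetric] by simp
      also have "\<dots> = of_int m * (v + u * b)" using v(2) by (simp add: algebra_simps)
      finally show "x * b \<in> ?mO" using v(1) ru(2) b(1) integers_closed(4,6) by blast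
    qed
  qed
qed

text \<open>Enlarge \<open>I\<close> to a prime ideal \<open>M\<close> and divide an element that
  annihilates \<open>M\<close> modulo \<open>m\<close> by \<open>m\<close>. The quotient is not
  integral because the element is non-zero modulo \<open>m\<close>.\<close>

lemma proper_ideal_inverse:
  assumes I: "ideal I" "1 \<notin> I" "I \<noteq> {0}"
  obtains u where "u \<in> ideal_inverse F I" "u \<notin> integers"
proof -
  obtain m :: int where m: "m \<noteq> 0" "of_int m \<in> I" using I(1,3) by (rule ideal_has_int)
  obtain M where M: "ideal M" "I \<subseteq> M" "1 \<notin> M"
    "\<forall>x\<in>integers. \<forall>y\<in>integers. x * y \<in> M \<longrightarrow> x \<in> M \<or> y \<in> M"
    by (rule ex_prime_ideal[OF I(1,2) m])
  have mM: "of_int m \<in> M" using m(2) M(2) by blast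
  obtain b where b: "b \<in> integers" "b \<notin> (*) (of_int m) ` integers"
    "\<forall>x\<in>M. x * b \<in> (*) (of_int m) ` integers"
    by (rule ex_annihilator[OF M(1,3,4) m(1) mM])
  define u where "u = b / of_int m"
  have "u \<in> F" unfolding u_def
    using b(1) subfield_of_int[OF subfield] by (intro subfieldD(8)[OF subfield]) (auto simp: integers_iff)
  moreover have "u * x \<in> integers" if x: "x \<in> I" for x
  proof -
    have "x * b \<in> (*) (of_int m) ` integers" using b(3) M(2) x by blast
    then obtain v where "v \<in> integers" "x * b = of_int m * v" by blast
    then have "u * x = v" using m(1) by (simp add: u_def field_simps)
    then show ?thesis using \<open>v \<in> integers\<close> by simp
  qed
  moreover have "u \<notin> integers"
  proof
    assume "u \<in> integers"
    moreover have "b = of_int m * u" using m(1) by (simp add: u_def)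
    ultimately show False using b(2) by blast
  qed
  ultimately show ?thesis using that[of u] by (simp add: ideal_inverse_def)
qed

end

section \<open>Transversals, invertibility and the ideal norm\<close>

definition transversal :: "'a::ab_group_add set \<Rightarrow> 'a set \<Rightarrow> 'a set \<Rightarrow> bool" where
  "transversal A B S \<longleftrightarrow> finite S \<and> S \<subseteq> A \<and> (\<forall>x\<in>A. \<exists>s\<in>S. x - s \<in> B) \<and>
     (\<forall>s\<in>S. \<forall>t\<in>S. s - t \<in> B \<longrightarrow> s = t)"

text \<open>\<open>R\<close> may lie outside \<open>A\<close>. The chosen representative
  \<open>\<rho> x\<close> depends only on the coset of \<open>x\<close>, so the values of
  \<open>\<rho>\<close> on \<open>A\<close> already occur on the finite set
  \<open>R\<close>.\<close>

lemma ex_transversal: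
  fixes A B :: "'a::comm_ring_1 set"
  assumes B: "int_module.subspace B" and R: "finite R" "\<forall>x\<in>A. \<exists>r\<in>R. x - r \<in> B"
  shows "\<exists>S. transversal A B S"
proof -
  define \<rho> where "\<rho> = (\<lambda>x. SOME y. y \<in> A \<and> x - y \<in> B)"
  have \<rho>: "\<rho> x \<in> A \<and> x - \<rho> x \<in> B" if "x \<in> A" for x
    unfolding \<rho>_def by (rule someI[of _ x]) (use that int_module.subspace_0[OF B] in simp)
  have \<rho>_eq: "\<rho> x = \<rho> z" if xz: "x - z \<in> B" for x z
  proof -
    have "x - y \<in> B \<longleftrightarrow> z - y \<in> B" for y
    proof
      assume "x - y \<in> B"
      from int_module.subspace_diff[OF B this xz] show "z - y \<in> B" by simp
    next
      assume "z - y \<in> B"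
      from int_module.subspace_add[OF B this xz] show "x - y \<in> B" by simp
    qed
    then show ?thesis unfolding \<rho>_def by simp
  qed
  have "\<rho> ` A \<subseteq> \<rho> ` R" using R(2) \<rho>_eq by blast
  then have "finite (\<rho> ` A)" using R(1) finite_subset by blast
  moreover have "\<rho> ` A \<subseteq> A" "\<forall>x\<in>A. \<exists>s\<in>\<rho> ` A. x - s \<in> B" using \<rho> by blast+
  moreover have "\<rho> x = \<rho> z" if x: "x \<in> A" and z: "z \<in> A" and xz: "\<rho> x - \<rho> z \<in> B" for x z
  proof -
    have "(x - \<rho> x) + (\<rho> x - \<rho> z) - (z - \<rho> z) \<in> B"
      by (rule int_module.subspace_diff[OF B int_module.subspace_add[OF B conjunct2[OF \<rho>[OF x]] xz]
          conjunct2[OF \<rho>[OF z]]])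
    then show ?thesis by (intro \<rho>_eq) simp
  qed
  ultimately show ?thesis unfolding transversal_def by blast
qed

context number_field_set
begin

lemma subspace_ideal: "ideal I \<Longrightarrow> int_module.subspace I"
  by (rule int_module.subspaceI) (auto intro: idealD integers_closed)

lemma subspace_ideal_inverse: "int_module.subspace (ideal_inverse F I)"
proof (rule int_module.subspaceI)
  show "0 \<in> ideal_inverse F I"
    using subfieldD(1)[OF subfield] integers_closed(1) by (simp add: ideal_inverse_def)
  fix x y assume "x \<in> ideal_inverse F I" "y \<in> ideal_inverse F I"
  then show "x + y \<in> ideal_inverse F I"
    using subfieldD(3)[OF subfield] integers_closed(4) by (simp add: ideal_inverse_def distrib_right)
next
  fix k x assume "x \<in> ideal_inverse F I"
  then show "of_int k * x \<in> ideal_inverse F I"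
    using subfieldD(4)[OF subfield subfield_of_int[OF subfield]] integers_closed(3,6)
    by (simp add: ideal_inverse_def mult.assoc)
qed

lemma ideal_inverse_mult_integer:
  "x \<in> ideal_inverse F I \<Longrightarrow> r \<in> integers \<Longrightarrow> r * x \<in> ideal_inverse F I"
  using subfieldD(4)[OF subfield] integers_closed(6)
  by (auto simp: ideal_inverse_def mult.assoc integers_iff)

lemma integers_subset_ideal_inverse: "ideal I \<Longrightarrow> integers \<subseteq> ideal_inverse F I"
  using idealD(1) integers_closed(6) by (auto simp: ideal_inverse_def integers_iff)

lemma ideal_inverse_antimono: "I \<subseteq> J \<Longrightarrow> ideal_inverse F J \<subseteq> ideal_inverse F I"
  by (auto simp: ideal_inverse_def)

text \<open>Let \<open>K = J * J\<^sup>-\<^sup>1\<close>. If \<open>u * K\<close> is integral then multiplication by \<open>u\<close> preserves the finitely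
  generated group \<open>J\<^sup>-\<^sup>1\<close>, so \<open>u\<close> is integral; hence \<open>K\<close> is not a proper ideal.\<close>

lemma ideal_mult_inverse:
  assumes J: "ideal J" "J \<noteq> {0}"
  shows "1 \<in> int_module.span {j * y | j y. j \<in> J \<and> y \<in> ideal_inverse F J}"
proof (rule ccontr)
  let ?P = "{j * y | j y. j \<in> J \<and> y \<in> ideal_inverse F J}"
  define K where "K = int_module.span ?P"
  assume "1 \<notin> int_module.span ?P"
  then have oneK: "1 \<notin> K" by (simp add: K_def)
  have PK: "j * y \<in> K" if "j \<in> J" "y \<in> ideal_inverse F J" for j y
    unfolding K_def by (rule int_module.span_base) (use that in blast)
  have one: "1 \<in> ideal_inverse F J" using integers_subset_ideal_inverse[OF J(1)] integers_closed(2) by blast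
  have "?P \<subseteq> integers" by (auto simp: ideal_inverse_def mult.commute)
  then have KO: "K \<subseteq> integers" unfolding K_def by (rule int_module.span_minimal[OF _ subspace_integers])
  have "ideal K"
    unfolding is_ideal_of_def
  proof (intro conjI ballI)
    show "K \<subseteq> integers" by (rule KO)
    show "0 \<in> K" unfolding K_def by (rule int_module.span_zero)
    show "x + y \<in> K" if "x \<in> K" "y \<in> K" for x y
      using that unfolding K_def by (rule int_module.span_add)
    fix r w assume r: "r \<in> integers" and w: "w \<in> K"
    have "r * b \<in> int_module.span ?P" if "b \<in> ?P" for b
    proof -
      from that obtain j y where jy: "b = j * y" "j \<in> J" "y \<in> ideal_inverse F J" by blast
      have "(r * j) * y \<in> K" by (intro PK idealD(4)[OF J(1) r] jy)
      then show ?thesis by (simp add: jy(1) K_def mult.assoc)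
    qed
    then show "r * w \<in> K" using w unfolding K_def by (rule int_span_stableD)
  qed
  moreover have "K \<noteq> {0}"
  proof -
    obtain x where x: "x \<in> J" "x \<noteq> 0" using J idealD(2)[OF J(1)] by blast
    have "x * 1 \<in> K" by (rule PK[OF x(1) one])
    then show ?thesis using x(2) by auto
  qed
  ultimately obtain u where u: "u \<in> ideal_inverse F K" "u \<notin> integers"
    using oneK by (metis proper_ideal_inverse)
  have uF: "u \<in> F" using u(1) by (simp add: ideal_inverse_def)
  have stable: "u * y \<in> ideal_inverse F J" if y: "y \<in> ideal_inverse F J" for y
  proof -
    have "u * y * j \<in> integers" if j: "j \<in> J" for j
    proof -
      have "u * (j * y) \<in> integers" using u(1) PK[OF j y] by (simp add: ideal_inverse_def)
      then show ?thesis by (simp only: mult.assoc mult.commute[of j y])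
    qed
    moreover have "u * y \<in> F" using subfieldD(4)[OF subfield uF] y by (simp add: ideal_inverse_def)
    ultimately show ?thesis by (simp add: ideal_inverse_def)
  qed
  obtain m :: int where m: "m \<noteq> 0" "of_int m \<in> J" using J by (rule ideal_has_int)
  obtain \<omega> where \<omega>: "integral_basis F \<omega>" using ex_integral_basis by blast
  have coords: "\<exists>c :: nat \<Rightarrow> int. of_int m * g = (\<Sum>i<length \<omega>. of_int (c i) * \<omega> ! i)"
    if g: "g \<in> ideal_inverse F J" for g
  proof -
    have "g * of_int m \<in> integers" using g m(2) by (simp add: ideal_inverse_def)
    then have "of_int m * g \<in> integers" by (subst mult.commute)
    then obtain c :: "nat \<Rightarrow> int" where "of_int m * g = (\<Sum>i<length \<omega>. of_int (c i) * \<omega> ! i)"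
      by (rule basis_span_int[OF \<omega>])
    then show ?thesis by blast
  qed
  have indep: "\<forall>i<length \<omega>. c i = 0" if "(\<Sum>i<length \<omega>. of_int (c i) * \<omega> ! i) = 0" for c :: "nat \<Rightarrow> int"
    using basis_independent_int[OF \<omega> that] by blast
  have "\<exists>\<beta> k. int_basis \<beta> k (ideal_inverse F J)"
    by (rule subgroup_basis[OF subspace_ideal_inverse m(1) indep coords])
  then obtain \<beta> k where "int_basis \<beta> k (ideal_inverse F J)" by blast
  note \<beta> = int_basisD(1,3)[OF this]
  have span: "g \<in> int_module.span (\<beta> ` {..<k})" if g: "g \<in> ideal_inverse F J" for g
  proof -
    obtain c :: "nat \<Rightarrow> int" where c: "g = (\<Sum>i<k. of_int (c i) * \<beta> i)" using \<beta>(2)[OF g] by blast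
    show ?thesis unfolding c
      by (intro int_module.span_sum int_module.span_scale int_module.span_base) auto
  qed
  \<comment> \<open>The integrality criterion needs a non-zero generator; one exists because 1 lies
    in the inverse ideal.\<close>
  have "\<exists>i<k. \<beta> i \<noteq> 0"
  proof (rule ccontr)
    assume neg: "\<not> ?thesis"
    obtain c :: "nat \<Rightarrow> int" where c: "1 = (\<Sum>i<k. of_int (c i) * \<beta> i)" using \<beta>(2)[OF one] by blast
    have "(\<Sum>i<k. of_int (c i) * \<beta> i) = 0" by (rule sum.neutral) (use neg in auto)
    with c show False by simp
  qed
  then obtain i where i: "i < k" "\<beta> i \<noteq> 0" by blast
  have "algebraic_int u"
  proof (rule algebraic_int_if_span_stable)
    show "finite (\<beta> ` {..<k})" "\<beta> i \<in> \<beta> ` {..<k}" "\<beta> i \<noteq> 0" using i by auto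
    show "u * b \<in> int_module.span (\<beta> ` {..<k})" if "b \<in> \<beta> ` {..<k}" for b
      using that \<beta>(1) by (intro span stable) auto
  qed
  then show False using u(2) uF by (simp add: integers_iff)
qed

text \<open>Multiply a representation of 1 as a sum of products \<open>j * y\<close> by
  \<open>x\<close> in \<open>J'\<close>: every \<open>y * x\<close> is integral, so the result lies
  in \<open>J\<close>. Hence a strictly larger ideal loses some element of the inverse.\<close>

lemma ideal_subset_if_inverse_subset:
  assumes J: "ideal J" "J \<noteq> {0}" and J': "ideal J'" and sub: "ideal_inverse F J \<subseteq> ideal_inverse F J'"
  shows "J' \<subseteq> J"
proof
  fix x assume x: "x \<in> J'"
  let ?P = "{j * y | j y. j \<in> J \<and> y \<in> ideal_inverse F J}"
  have "w \<in> int_module.span ?P \<Longrightarrow> x * w \<in> J" for w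
  proof (induction rule: int_module.span_induct_alt)
    case base
    then show ?case using idealD(2)[OF J(1)] by simp
  next
    case (step c b w)
    then obtain j y where jy: "b = j * y" "j \<in> J" "y \<in> ideal_inverse F J" by blast
    have "y * x \<in> integers" using sub jy(3) x by (auto simp: ideal_inverse_def)
    from idealD(3)[OF J(1) idealD(4)[OF J(1) integers_closed(3) idealD(5)[OF J(1) jy(2) this]] step(2)]
    have "of_int c * (j * (y * x)) + x * w \<in> J" .
    also have "of_int c * (j * (y * x)) + x * w = x * (of_int c * b + w)"
      by (simp add: jy(1) algebra_simps)
    finally show ?case .
  qed
  from this[OF ideal_mult_inverse[OF J]] show "x \<in> J" by simp
qed

lemma ideal_norm_eq_card:
  assumes J: "ideal J" and T: "transversal integers J T"
  shows "ideal_norm F J = card T"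
proof -
  let ?r = "{(x, y). x \<in> integers \<and> y \<in> integers \<and> x - y \<in> J}"
  have T: "T \<subseteq> integers" "\<forall>x\<in>integers. \<exists>s\<in>T. x - s \<in> J" "\<forall>s\<in>T. \<forall>t\<in>T. s - t \<in> J \<longrightarrow> s = t"
    using T by (auto simp: transversal_def)
  have eq: "?r `` {x} = ?r `` {y}" if xy: "x \<in> integers" "y \<in> integers" "x - y \<in> J" for x y
  proof -
    have "x - z \<in> J \<longleftrightarrow> y - z \<in> J" for z
      using idealD(3)[OF J, of "y - z" "x - y"] idealD(6)[OF J, of "x - z" "x - y"] xy(3) by auto
    then show ?thesis using xy by auto
  qed
  have "bij_betw (\<lambda>t. ?r `` {t}) T (integers // ?r)"
  proof (rule bij_betw_imageI)
    show "inj_on (\<lambda>t. ?r `` {t}) T"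
    proof (rule inj_onI)
      fix s t assume st: "s \<in> T" "t \<in> T" "?r `` {s} = ?r `` {t}"
      have "t \<in> ?r `` {t}" using st(2) T(1) idealD(2)[OF J] by auto
      then have "t \<in> ?r `` {s}" unfolding st(3) .
      then have "s - t \<in> J" by simp
      then show "s = t" using T(3) st by blast
    qed
    show "(\<lambda>t. ?r `` {t}) ` T = integers // ?r"
    proof (intro equalityI subsetI)
      fix c assume "c \<in> (\<lambda>t. ?r `` {t}) ` T"
      then obtain t where t: "t \<in> T" "c = ?r `` {t}" by blast
      show "c \<in> integers // ?r" unfolding t(2) by (rule quotientI) (use t(1) T(1) in blast)
    next
      fix c assume "c \<in> integers // ?r"
      then obtain x where x: "x \<in> integers" "c = ?r `` {x}" by (rule quotientE)
      obtain s where s: "s \<in> T" "x - s \<in> J" using T(2) x(1) by blast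
      have "c = ?r `` {s}" unfolding x(2) by (rule eq) (use x s T(1) in auto)
      then show "c \<in> (\<lambda>t. ?r `` {t}) ` T" using s(1) by blast
    qed
  qed
  then show ?thesis unfolding ideal_norm_def by (rule bij_betw_same_card[symmetric])
qed

text \<open>Induction along a chain of ideals. If \<open>J' = J + x * O\<close> is minimal above \<open>J\<close> and \<open>y\<close> lies in
  \<open>J\<^sup>-\<^sup>1\<close> but not in \<open>J'\<^sup>-\<^sup>1\<close>, then \<open>r * x \<in> J\<close> whenever \<open>r * y \<in> J'\<^sup>-\<^sup>1\<close>; hence \<open>J\<^sup>-\<^sup>1 / J'\<^sup>-\<^sup>1\<close> has at
  least as many elements as \<open>J' / J\<close>.\<close>

lemma inverse_transversal:
  assumes "ideal J" "J \<noteq> {0}"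
  shows "\<exists>T C. transversal integers J T \<and> finite C \<and> C \<subseteq> ideal_inverse F J \<and> card C = card T \<and>
    (\<forall>c\<in>C. \<forall>d\<in>C. c - d \<in> integers \<longrightarrow> c = d)"
  using assms
\<comment> \<open>The ideals above \<open>J\<close> are finite in number, and there are fewer of
  them above a larger ideal.\<close>
proof (induction "card {I. ideal I \<and> J \<subseteq> I}" arbitrary: J rule: less_induct)
  case (less J)
  note J = \<open>ideal J\<close> \<open>J \<noteq> {0}\<close>
  show ?case
  proof (cases "1 \<in> J")
    case True
    then have "J = integers" by (rule ideal_eq_integers[OF J(1)])
    then have "transversal integers J {0}"
      using integers_closed(1) by (auto simp: transversal_def)
    moreover have "0 \<in> ideal_inverse F J" by (rule int_module.subspace_0[OF subspace_ideal_inverse])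
    ultimately show ?thesis by (intro exI[of _ "{0}"]) auto
  next
    case False
    obtain m :: int where m: "m \<noteq> 0" "of_int m \<in> J" using J by (rule ideal_has_int)
    have fin: "finite {I. ideal I \<and> J \<subseteq> I}"
      by (rule finite_subset[OF _ finite_ideals[OF m(1)]]) (use m(2) in blast)
    let ?A = "{I. ideal I \<and> J \<subset> I}"
    have "finite ?A" by (rule finite_subset[OF _ fin]) blast
    moreover have "integers \<in> ?A"
      using ideal_integers idealD(1)[OF J(1)] False integers_closed(2) by blast
    ultimately obtain J' where J'A: "J' \<in> ?A" and min: "\<forall>I\<in>?A. I \<subseteq> J' \<longrightarrow> J' = I"
      using finite_has_minimal2[of ?A integers] by blast
    then have J': "ideal J'" "J \<subset> J'" by auto
    obtain x where x: "x \<in> J'" "x \<notin> J" using J'(2) by blast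
    have xO: "x \<in> integers" using idealD(1)[OF J'(1) x(1)] .
    \<comment> \<open>By minimality of \<open>J'\<close> any of its elements outside
      \<open>J\<close> generates it over \<open>J\<close>. This is used for \<open>x\<close> and, in
      \<open>key\<close>, for multiples of \<open>x\<close>.\<close>
    have gen: "J' = {j + z * r | j r. j \<in> J \<and> r \<in> integers}" if z: "z \<in> J'" "z \<notin> J" for z
    proof -
      have zO: "z \<in> integers" using idealD(1)[OF J'(1) z(1)] .
      let ?N = "{j + z * r | j r. j \<in> J \<and> r \<in> integers}"
      have "?N \<in> ?A"
        using ideal_add_principal[OF J(1) zO] ideal_add_principal_mem[OF J(1) zO] z(2) by blast
      moreover have "?N \<subseteq> J'"
        using J'(2) idealD(3)[OF J'(1)] idealD(5)[OF J'(1) z(1)] by blast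
      ultimately show ?thesis using min by blast
    qed
    have "{I. ideal I \<and> J' \<subseteq> I} \<subset> {I. ideal I \<and> J \<subseteq> I}"
    proof (rule psubsetI)
      show "{I. ideal I \<and> J' \<subseteq> I} \<subseteq> {I. ideal I \<and> J \<subseteq> I}" using J'(2) by blast
      have "J \<in> {I. ideal I \<and> J \<subseteq> I}" using J(1) by simp
      moreover have "J \<notin> {I. ideal I \<and> J' \<subseteq> I}" using J'(2) by blast
      ultimately show "{I. ideal I \<and> J' \<subseteq> I} \<noteq> {I. ideal I \<and> J \<subseteq> I}" by metis
    qed
    then have "card {I. ideal I \<and> J' \<subseteq> I} < card {I. ideal I \<and> J \<subseteq> I}"
      by (rule psubset_card_mono[OF fin])
    moreover have "J' \<noteq> {0}" using J(2) J'(2) idealD(2)[OF J(1)] by blast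
    ultimately obtain T' C' where T': "transversal integers J' T'" and C': "finite C'"
      "C' \<subseteq> ideal_inverse F J'" "card C' = card T'" "\<forall>c\<in>C'. \<forall>d\<in>C'. c - d \<in> integers \<longrightarrow> c = d"
      using less.hyps[of J'] J'(1) by blast
    obtain R where R: "finite R" "R \<subseteq> integers"
      "\<forall>x\<in>integers. \<exists>r\<in>R. \<exists>u\<in>integers. x - r = of_int m * u"
      using m(1) by (rule finite_residues)
    have "\<forall>x\<in>J'. \<exists>r\<in>R. x - r \<in> J"
    proof
      fix z assume "z \<in> J'"
      then have "z \<in> integers" by (rule idealD(1)[OF J'(1)])
      then obtain r u where ru: "r \<in> R" "u \<in> integers" "z - r = of_int m * u" using R(3) by blast
      have "z - r \<in> J" unfolding ru(3) by (rule idealD(5)[OF J(1) m(2) ru(2)])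
      then show "\<exists>r\<in>R. z - r \<in> J" using ru(1) by blast
    qed
    then obtain S where S: "transversal J' J S"
      using ex_transversal[OF subspace_ideal[OF J(1)] R(1)] by blast
    have "\<not> ideal_inverse F J \<subseteq> ideal_inverse F J'"
      using ideal_subset_if_inverse_subset[OF J J'(1)] J'(2) by blast
    then obtain y where y: "y \<in> ideal_inverse F J" "y \<notin> ideal_inverse F J'" by blast
    have yF: "y \<in> F" and yJ: "\<And>j. j \<in> J \<Longrightarrow> y * j \<in> integers" using y(1) by (auto simp: ideal_inverse_def)
    have key: "r * x \<in> J" if r: "r \<in> integers" and ry: "r * y \<in> ideal_inverse F J'" for r
    proof (rule ccontr)
      assume "r * x \<notin> J"
      moreover have "r * x \<in> J'" by (rule idealD(4)[OF J'(1) r x(1)])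
      ultimately have J'_eq: "J' = {j + r * x * s | j s. j \<in> J \<and> s \<in> integers}" by (intro gen)
      have "y * z \<in> integers" if z: "z \<in> J'" for z
      proof -
        obtain j s where js: "z = j + r * x * s" "j \<in> J" "s \<in> integers" using z J'_eq by blast
        have "r * y * x \<in> integers" using ry x(1) by (simp add: ideal_inverse_def)
        from integers_closed(4)[OF yJ[OF js(2)] integers_closed(6)[OF this js(3)]]
        have "y * j + r * y * x * s \<in> integers" .
        also have "y * j + r * y * x * s = y * z" by (simp add: js(1) algebra_simps)
        finally show ?thesis .
      qed
      then show False using y(2) yF by (simp add: ideal_inverse_def)
    qed
    have "\<forall>s. \<exists>r. s \<in> S \<longrightarrow> r \<in> integers \<and> s - x * r \<in> J"
    proof (intro allI)
      fix s
      show "\<exists>r. s \<in> S \<longrightarrow> r \<in> integers \<and> s - x * r \<in> J"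
      proof (cases "s \<in> S")
        case True
        then have "s \<in> J'" using S by (auto simp: transversal_def)
        then obtain j r where "s = j + x * r" "j \<in> J" "r \<in> integers" using gen[OF x] by blast
        then show ?thesis by auto
      qed auto
    qed
    then obtain \<rho> where \<rho>: "\<And>s. s \<in> S \<Longrightarrow> \<rho> s \<in> integers" "\<And>s. s \<in> S \<Longrightarrow> s - x * \<rho> s \<in> J"
      by metis
    have Tr: "finite T'" "T' \<subseteq> integers" "\<forall>x\<in>integers. \<exists>s\<in>T'. x - s \<in> J'" "\<forall>s\<in>T'. \<forall>t\<in>T'. s - t \<in> J' \<longrightarrow> s = t"
      using T' unfolding transversal_def by blast+
    have Sr: "finite S" "S \<subseteq> J'" "\<forall>x\<in>J'. \<exists>s\<in>S. x - s \<in> J" "\<forall>s\<in>S. \<forall>t\<in>S. s - t \<in> J \<longrightarrow> s = t"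
      using S unfolding transversal_def by blast+
    \<comment> \<open>Two parallel families of equal size: a representative \<open>s\<close> of
      \<open>J'\<close> modulo \<open>J\<close>, congruent to \<open>x * \<rho> s\<close>, is added
      on the side of the integers and contributes \<open>\<rho> s * y\<close> on the side of the
      inverse.\<close>
    define f where "f = (\<lambda>(t, s). t + s :: 'k)"
    define g where "g = (\<lambda>(c, s). c + \<rho> s * y)"
    have f_eq: "(t, s) = (t', s')"
      if ts: "t \<in> T'" "s \<in> S" "t' \<in> T'" "s' \<in> S" and diff: "(t + s) - (t' + s') \<in> J" for t s t' s'
    proof -
      have "s \<in> J'" "s' \<in> J'" using ts Sr(2) by auto
      note s = idealD(6)[OF J'(1) this]
      have "(t + s) - (t' + s') \<in> J'" using diff J'(2) by blast
      from idealD(6)[OF J'(1) this s] have "((t + s) - (t' + s')) - (s - s') \<in> J'" .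
      then have "t - t' \<in> J'" by (simp add: algebra_simps)
      then have "t = t'" using Tr(4) ts by blast
      then have "s - s' \<in> J" using diff by simp
      then show ?thesis using Sr(4) ts \<open>t = t'\<close> by blast
    qed
    have g_eq: "(c, s) = (c', s')"
      if cs: "c \<in> C'" "s \<in> S" "c' \<in> C'" "s' \<in> S"
        and diff: "(c + \<rho> s * y) - (c' + \<rho> s' * y) \<in> integers" for c s c' s'
    proof -
      \<comment> \<open>The inverse of \<open>J'\<close> contains both the integers and
        \<open>C'\<close>, so only the difference of the multiples of \<open>y\<close> remains;
        \<open>key\<close> turns it into a congruence of \<open>s\<close> and \<open>s'\<close>
        modulo \<open>J\<close>.\<close>
      have "(c + \<rho> s * y) - (c' + \<rho> s' * y) \<in> ideal_inverse F J'"
        using diff integers_subset_ideal_inverse[OF J'(1)] by blast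
      moreover have "c - c' \<in> ideal_inverse F J'"
        using cs C'(2) by (intro int_module.subspace_diff[OF subspace_ideal_inverse]) auto
      ultimately have "((c + \<rho> s * y) - (c' + \<rho> s' * y)) - (c - c') \<in> ideal_inverse F J'"
        by (rule int_module.subspace_diff[OF subspace_ideal_inverse])
      then have "(\<rho> s - \<rho> s') * y \<in> ideal_inverse F J'" by (simp add: algebra_simps)
      then have "(\<rho> s - \<rho> s') * x \<in> J" using \<rho>(1) cs by (intro key integers_closed(5)) auto
      from idealD(6)[OF J(1) idealD(3)[OF J(1) \<rho>(2)[OF cs(2)] this] \<rho>(2)[OF cs(4)]]
      have "(s - x * \<rho> s) + (\<rho> s - \<rho> s') * x - (s' - x * \<rho> s') \<in> J" .
      then have "s - s' \<in> J" by (simp add: algebra_simps)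
      then have "s = s'" using Sr(4) cs by blast
      then show ?thesis using diff C'(4) cs by simp
    qed
    have inj_f: "inj_on f (T' \<times> S)"
    proof (rule inj_onI)
      fix a b assume ab: "a \<in> T' \<times> S" "b \<in> T' \<times> S" "f a = f b"
      obtain t s t' s' where [simp]: "a = (t, s)" "b = (t', s')" by (cases a, cases b)
      have "(t + s) - (t' + s') = 0" using ab by (simp add: f_def)
      then show "a = b" using f_eq[of t s t' s'] ab idealD(2)[OF J(1)] by simp
    qed
    have inj_g: "inj_on g (C' \<times> S)"
    proof (rule inj_onI)
      fix a b assume ab: "a \<in> C' \<times> S" "b \<in> C' \<times> S" "g a = g b"
      obtain t s t' s' where [simp]: "a = (t, s)" "b = (t', s')" by (cases a, cases b)
      have "(t + \<rho> s * y) - (t' + \<rho> s' * y) = 0" using ab by (simp add: g_def)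
      then show "a = b" using g_eq[of t s t' s'] ab integers_closed(1) by simp
    qed
    have "transversal integers J (f ` (T' \<times> S))"
      unfolding transversal_def
    proof (intro conjI ballI impI)
      show "finite (f ` (T' \<times> S))" using Tr(1) Sr(1) by simp
      show "f ` (T' \<times> S) \<subseteq> integers"
        using Tr(2) Sr(2) idealD(1)[OF J'(1)] by (auto simp: f_def intro!: integers_closed(4))
      show "\<exists>s\<in>f ` (T' \<times> S). z - s \<in> J" if z: "z \<in> integers" for z
      proof -
        obtain t where t: "t \<in> T'" "z - t \<in> J'" using Tr(3) z by blast
        obtain s where s: "s \<in> S" "z - t - s \<in> J" using Sr(3) t(2) by blast
        have "z - f (t, s) \<in> J" using s(2) by (simp add: f_def diff_diff_eq)
        then show ?thesis using t(1) s(1) by blast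
      qed
      fix a b assume a: "a \<in> f ` (T' \<times> S)" and b: "b \<in> f ` (T' \<times> S)" and ab: "a - b \<in> J"
      obtain t s where ts: "t \<in> T'" "s \<in> S" "a = t + s" using a by (auto simp: f_def)
      obtain t' s' where ts': "t' \<in> T'" "s' \<in> S" "b = t' + s'" using b by (auto simp: f_def)
      show "a = b" using f_eq[OF ts(1,2) ts'(1,2)] ab ts(3) ts'(3) by simp
    qed
    moreover have "finite (g ` (C' \<times> S))" using C'(1) Sr(1) by simp
    moreover have "g ` (C' \<times> S) \<subseteq> ideal_inverse F J"
    proof -
      have "c + \<rho> s * y \<in> ideal_inverse F J" if "c \<in> C'" "s \<in> S" for c s
        using that C'(2) ideal_inverse_antimono[of J J'] J'(2)
        by (intro int_module.subspace_add[OF subspace_ideal_inverse] ideal_inverse_mult_integer y(1) \<rho>(1)) auto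
      then show ?thesis by (auto simp: g_def)
    qed
    moreover have "card (g ` (C' \<times> S)) = card (f ` (T' \<times> S))"
      using C'(3) by (simp add: card_image[OF inj_f] card_image[OF inj_g] card_cartesian_product)
    moreover have "\<forall>c\<in>g ` (C' \<times> S). \<forall>d\<in>g ` (C' \<times> S). c - d \<in> integers \<longrightarrow> c = d"
    proof (intro ballI impI)
      fix a b assume a: "a \<in> g ` (C' \<times> S)" and b: "b \<in> g ` (C' \<times> S)" and ab: "a - b \<in> integers"
      obtain t s where ts: "t \<in> C'" "s \<in> S" "a = t + \<rho> s * y" using a by (auto simp: g_def)
      obtain t' s' where ts': "t' \<in> C'" "s' \<in> S" "b = t' + \<rho> s' * y" using b by (auto simp: g_def)
      show "a = b" using g_eq[OF ts(1,2) ts'(1,2)] ab ts(3) ts'(3) by simp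
    qed
    ultimately show ?thesis by blast
  qed
qed

lemma ideal_inverse_large:
  assumes "ideal J" "J \<noteq> {0}"
  obtains C where "finite C" "C \<subseteq> ideal_inverse F J" "card C = ideal_norm F J"
    "\<forall>c\<in>C. \<forall>d\<in>C. c - d \<in> integers \<longrightarrow> c = d"
proof -
  obtain T C where "transversal integers J T" "finite C" "C \<subseteq> ideal_inverse F J" "card C = card T"
    "\<forall>c\<in>C. \<forall>d\<in>C. c - d \<in> integers \<longrightarrow> c = d"
    using inverse_transversal[OF assms] by blast
  then show ?thesis using that ideal_norm_eq_card[OF assms(1)] by simp
qed

end

section \<open>Small linear polynomials\<close>

lemma bieval_lin_bipoly: "bieval (lin_bipoly b1 b2 b3) x y = b1 * x + b2 * y + b3"
  by (simp add: bieval_def lin_bipoly_def algebra_simps)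

lemma map_lin_bipoly:
  assumes "\<phi> 0 = 0"
  shows "map_bipoly \<phi> (lin_bipoly b1 b2 b3) = lin_bipoly (\<phi> b1) (\<phi> b2) (\<phi> b3)"
proof -
  have 1: "map_poly \<phi> [:c, d:] = [:\<phi> c, \<phi> d:]" for c d
    by (rule poly_eqI) (simp add: coeff_map_poly assms coeff_pCons split: nat.split)
  have 2: "map_poly (map_poly \<phi>) [:p, q:] = [:map_poly \<phi> p, map_poly \<phi> q:]" for p q
    by (rule poly_eqI) (simp add: coeff_map_poly coeff_pCons split: nat.split)
  show ?thesis
    unfolding map_bipoly_def lin_bipoly_def 2 1 using 1[of b2 0] assms by simp
qed

section \<open>Block matrices and sums over blocks\<close>

text \<open>With \<open>k = 3\<close> and \<open>A\<close> the conjugates of an integral basis, this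
  maps the coordinates of three field elements to all their conjugates.\<close>

definition block_diag :: "nat \<Rightarrow> nat \<Rightarrow> (nat \<Rightarrow> nat \<Rightarrow> 'a) \<Rightarrow> 'a::idom mat" where
  "block_diag k n A = mat (k * n) (k * n)
     (\<lambda>(p, q). if p div n = q div n then A (p mod n) (q mod n) else 0)"

lemma det_block_diag:
  fixes A :: "nat \<Rightarrow> nat \<Rightarrow> 'a::idom"
  shows "det (block_diag k n A) = det (mat n n (\<lambda>(i, j). A i j)) ^ k"
proof (induction k)
  case 0
  have "block_diag 0 n A \<in> carrier_mat 0 0" by (simp add: block_diag_def)
  then show ?case by simp
next
  case (Suc k)
  let ?V = "mat n n (\<lambda>(i, j). A i j)"
  have div_mod: "p div n = k \<and> p mod n = p - k * n" if "k * n \<le> p" "p < Suc k * n" for p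
  proof -
    have "p div n = k" using that by (intro div_nat_eqI) (auto simp: mult.commute)
    then show ?thesis by (metis minus_mult_div_eq_mod mult.commute)
  qed
  have lt: "p div n < k" if "p < k * n" for p using that by (simp add: less_mult_imp_div_less)
  have "block_diag (Suc k) n A = four_block_mat (block_diag k n A) (0\<^sub>m (k * n) n) (0\<^sub>m n (k * n)) ?V"
  proof (rule eq_matI)
    fix p q
    assume "p < dim_row (four_block_mat (block_diag k n A) (0\<^sub>m (k * n) n) (0\<^sub>m n (k * n)) ?V)"
      "q < dim_col (four_block_mat (block_diag k n A) (0\<^sub>m (k * n) n) (0\<^sub>m n (k * n)) ?V)"
    then have pq: "p < Suc k * n" "q < Suc k * n" by (auto simp: block_diag_def)
    consider "p < k * n" "q < k * n" | "p < k * n" "k * n \<le> q" | "k * n \<le> p" "q < k * n"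
      | "k * n \<le> p" "k * n \<le> q" by linarith
    then show "block_diag (Suc k) n A $$ (p, q) =
        four_block_mat (block_diag k n A) (0\<^sub>m (k * n) n) (0\<^sub>m n (k * n)) ?V $$ (p, q)"
    proof cases
      case 1
      then show ?thesis using pq by (simp add: block_diag_def)
    next
      case 2
      then show ?thesis using pq lt[of p] div_mod[of q] by (auto simp: block_diag_def)
    next
      case 3
      then show ?thesis using pq lt[of q] div_mod[of p] by (auto simp: block_diag_def)
    next
      case 4
      then show ?thesis using pq div_mod[of p] div_mod[of q] by (auto simp: block_diag_def)
    qed
  qed (auto simp: block_diag_def)
  also have "det \<dots> = det (block_diag k n A) * det ?V"
    by (rule det_four_block_mat_lower_left_zero) (auto simp: block_diag_def)
  finally show ?case by (simp add: Suc.IH)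
qed

lemma sum_blocks:
  fixes f :: "nat \<Rightarrow> 'a::comm_monoid_add"
  shows "(\<Sum>q<k * n. f q) = (\<Sum>l<k. \<Sum>i<n. f (l * n + i))"
proof -
  have "(\<Sum>q<k * n. f q) = (\<Sum>l<k. sum f {l * n..<l * n + n})"
    by (rule sum.nat_group[symmetric])
  also have "\<dots> = (\<Sum>l<k. \<Sum>i<n. f (l * n + i))"
  proof (rule sum.cong[OF refl])
    fix l
    show "sum f {l * n..<l * n + n} = (\<Sum>i<n. f (l * n + i))"
      using sum.shift_bounds_nat_ivl[of f 0 "l * n" n] by (simp add: add.commute lessThan_atLeast0)
  qed
  finally show ?thesis .
qed

lemma prod_blocks:
  fixes f :: "nat \<Rightarrow> 'a::comm_monoid_mult"
  shows "(\<Prod>q<k * n. f (q div n)) = (\<Prod>l<k. f l ^ n)"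
proof -
  have "(\<Prod>q<k * n. f (q div n)) = (\<Prod>l<k. \<Prod>q = l * n..<l * n + n. f (q div n))"
    by (rule prod.nat_group[symmetric])
  also have "\<dots> = (\<Prod>l<k. \<Prod>q = l * n..<l * n + n. f l)"
  proof (intro prod.cong refl)
    fix l q assume "q \<in> {l * n..<l * n + n}"
    then have "q div n = l" by (intro div_nat_eqI) (auto simp: mult.commute)
    then show "f (q div n) = f l" by simp
  qed
  finally show ?thesis by simp
qed

lemma block_index:
  fixes l :: nat
  assumes "l < k" "i < n" shows "l * n + i < k * n"
proof -
  have "l * n + i < Suc l * n" using assms by simp
  also have "\<dots> \<le> k * n" using assms by (intro mult_right_mono) auto
  finally show ?thesis .
qed

context number_field_set
begin

section \<open>Integrality and size of linear values\<close>

lemma integer_eq_0_if_small: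
  assumes z: "z \<in> integers" and small: "\<And>\<phi>. \<phi> \<in> embeddings F \<Longrightarrow> cmod (\<phi> z) < 1"
  shows "z = 0"
proof (rule algebraic_int_eq_0_if_small)
  show "algebraic_int z" using z by (simp add: integers_iff)
  fix \<Lambda> :: "'k \<Rightarrow> complex" assume \<Lambda>: "hom_on {x. algebraic x} \<Lambda>"
  have "hom_on F \<Lambda>"
    using \<Lambda> number_field_algebraic[OF number_field] unfolding hom_on_def by blast
  then have "restrict \<Lambda> F \<in> embeddings F" by (rule embeddingsI[OF subfield])
  from small[OF this] show "cmod (\<Lambda> z) < 1" using z by (simp add: integers_iff)
qed

lemma cnj_embedding:
  assumes "\<phi> \<in> embeddings F" shows "restrict (cnj \<circ> \<phi>) F \<in> embeddings F"
proof (rule embeddingsI[OF subfield])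
  show "hom_on F (cnj \<circ> \<phi>)" using embeddings_hom_on[OF assms] by (simp add: hom_on_def)
qed

text \<open>Recovers from the product form of the coefficient condition that each single coefficient
  lies in the inverse ideal.\<close>

lemma inverse_ideal_bipoly_coeff:
  assumes g: "g \<in> inverse_ideal_bipolys F J"
  shows "coeff (coeff g j) i \<in> ideal_inverse F J"
proof -
  from g obtain n f h where g: "g = (\<Sum>l<(n::nat). f l * h l)"
    and fh: "\<forall>l<n. f l \<in> (\<lambda>c. [:[:c:]:]) ` ideal_inverse F J \<and> h l \<in> bipolys integers"
    unfolding inverse_ideal_bipolys_def sums_of_products_def by auto
  have "coeff (coeff (f l * h l) j) i \<in> ideal_inverse F J" if l: "l < n" for l
  proof -
    obtain c where c: "c \<in> ideal_inverse F J" "f l = [:[:c:]:]" using fh l by blast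
    have "coeff (coeff (h l) j) i * c \<in> ideal_inverse F J"
      using fh l by (intro ideal_inverse_mult_integer c) (auto simp: bipolys_def)
    then show ?thesis by (simp add: c(2) mult.commute)
  qed
  then show ?thesis
    unfolding g coeff_sum by (intro int_module.subspace_sum[OF subspace_ideal_inverse]) auto
qed

lemma lin_bipoly_in_inverse_ideal_bipolys:
  assumes "b1 \<in> ideal_inverse F J" "b2 \<in> ideal_inverse F J" "b3 \<in> ideal_inverse F J"
  shows "lin_bipoly b1 b2 b3 \<in> inverse_ideal_bipolys F J"
proof -
  let ?f = "\<lambda>l::nat. [:[:if l = 0 then b1 else if l = 1 then b2 else b3:]:]"
  let ?h = "\<lambda>l::nat. if l = 0 then [:[:0, 1:]:] else if l = 1 then [:0, 1:] else 1"
  have "lin_bipoly b1 b2 b3 = (\<Sum>l<3. ?f l * ?h l)"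
    by (simp add: lin_bipoly_def eval_nat_numeral)
  moreover have "?f l \<in> (\<lambda>c. [:[:c:]:]) ` ideal_inverse F J" for l using assms by auto
  moreover have "?h l \<in> bipolys integers" for l
    using integers_closed(1,2)
    by (auto simp: bipolys_def coeff_pCons coeff_1 split: nat.splits)
  ultimately show ?thesis
    unfolding inverse_ideal_bipolys_def sums_of_products_def
    by (intro CollectI exI[of _ 3] exI[of _ ?f] exI[of _ ?h] conjI allI impI) blast+
qed

lemma lin_bipoly_congruent_iff:
  "lin_bipoly b1 b2 b3 - [:[:b1:]:] * lin_bipoly 1 t a \<in> bipolys integers \<longleftrightarrow>
     b2 - b1 * t \<in> integers \<and> b3 - b1 * a \<in> integers" (is "?g \<in> _ \<longleftrightarrow> _")
proof -
  have g: "?g = [:[:b3 - b1 * a:], [:b2 - b1 * t:]:]"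
    by (simp add: lin_bipoly_def)
  have "?g \<in> bipolys integers \<longleftrightarrow> (\<forall>j i. coeff (coeff [:[:b3 - b1 * a:], [:b2 - b1 * t:]:] j) i \<in> integers)"
    unfolding g bipolys_def by auto
  also have "\<dots> \<longleftrightarrow> b2 - b1 * t \<in> integers \<and> b3 - b1 * a \<in> integers"
  proof
    assume *: "\<forall>j i. coeff (coeff [:[:b3 - b1 * a:], [:b2 - b1 * t:]:] j) i \<in> integers"
    show "b2 - b1 * t \<in> integers \<and> b3 - b1 * a \<in> integers"
      using *[rule_format, of 0 0] *[rule_format, of "Suc 0" 0] by simp
  qed (auto simp: coeff_pCons integers_closed(1) split: nat.splits)
  finally show ?thesis .
qed

text \<open>The value equals
  \<open>b1 * (x + t * y + a) + (b2 - b1 * t) * y + (b3 - b1 * a)\<close>. In the first summand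
  \<open>b1\<close> is absorbed by the factors from \<open>J\<close>; the others are integral by the
  congruences.\<close>

lemma linear_value_integral:
  assumes b1: "b1 \<in> ideal_inverse F J" and c: "b2 - b1 * t \<in> integers" "b3 - b1 * a \<in> integers"
    and xy: "algebraic_int x" "algebraic_int y" "x + t * y + a \<in> sums_of_products J alg_integers"
  shows "algebraic_int (b1 * x + b2 * y + b3)"
proof -
  obtain n f g where fg: "x + t * y + a = (\<Sum>l<(n::nat). f l * g l)"
    "\<And>l. l < n \<Longrightarrow> f l \<in> J \<and> g l \<in> alg_integers"
    using xy(3) unfolding sums_of_products_def by auto
  have "algebraic_int (b1 * f l * g l)" if l: "l < n" for l
  proof -
    have "b1 * f l \<in> integers" using b1 fg(2)[OF l] by (simp add: ideal_inverse_def)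
    then show ?thesis using fg(2)[OF l] by (intro algebraic_int_mult[of "b1 * f l"]) (auto simp: integers_iff alg_integers_def)
  qed
  then have "algebraic_int (\<Sum>l<n. b1 * f l * g l)" by (intro algebraic_int_sum) auto
  also have "(\<Sum>l<n. b1 * f l * g l) = b1 * (x + t * y + a)"
    unfolding fg(1) by (simp add: sum_distrib_left mult.assoc)
  finally have "algebraic_int (b1 * (x + t * y + a) + (b2 - b1 * t) * y + (b3 - b1 * a))"
    using c xy by (intro algebraic_int_add algebraic_int_mult[of "b2 - b1 * t" y]) (auto simp: integers_iff)
  also have "b1 * (x + t * y + a) + (b2 - b1 * t) * y + (b3 - b1 * a) = b1 * x + b2 * y + b3"
    by (simp add: algebra_simps)
  finally show ?thesis .
qed

text \<open>Each of the three summands is allowed one third; strictness is taken from the constant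
  term.\<close>

lemma linear_value_bound:
  fixes u1 u2 u3 x y :: complex
  assumes X: "X > 0" and Y: "Y > 0"
    and u: "cmod u1 < 1 / (3 * X)" "cmod u2 < 1 / (3 * Y)" "cmod u3 < 1 / 3"
    and xy: "cmod x \<le> X" "cmod y \<le> Y"
  shows "cmod (u1 * x + u2 * y + u3) < 1"
proof -
  have "cmod (u1 * x) \<le> 1 / (3 * X) * X"
    unfolding norm_mult by (intro mult_mono) (use assms in auto)
  moreover have "cmod (u2 * y) \<le> 1 / (3 * Y) * Y"
    unfolding norm_mult by (intro mult_mono) (use assms in auto)
  moreover have "1 / (3 * X) * X = 1 / 3" "1 / (3 * Y) * Y = 1 / 3" using X Y by auto
  moreover have "cmod (u1 * x + u2 * y + u3) \<le> cmod (u1 * x) + cmod (u2 * y) + cmod u3"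
    using norm_triangle_ineq[of "u1 * x + u2 * y" u3] norm_triangle_ineq[of "u1 * x" "u2 * y"] by linarith
  ultimately show ?thesis using u(3) by linarith
qed

text \<open>Minkowski's theorem for the group of all triples \<open>(b, t * b + r, a * b + s)\<close> with
  \<open>b \<in> J\<^sup>-\<^sup>1\<close> and \<open>r, s\<close> integral, which contains at least \<open>N(J)\<close> cosets of the triples of
  integers. Position \<open>l * n + i\<close> of a vector is the \<open>i\<close>-th coordinate of the \<open>l\<close>-th entry.\<close>

lemma ex_small_triple:
  fixes r :: "nat \<Rightarrow> real"
  assumes J: "ideal J" "J \<noteq> {0}" and r: "\<And>l. l < 3 \<Longrightarrow> r l > 0"
    and ta: "t \<in> integers" "a \<in> integers" and disc: "field_disc F \<noteq> 0"
    and large: "cmod (field_disc F) powr (3 / 2) < real (ideal_norm F J) *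
      (\<Prod>l<3. r l) ^ field_degree F * (pi / 2) ^ (3 * card (complex_places F))"
  shows "\<exists>b1 b2 b3. b1 \<in> ideal_inverse F J \<and> b2 - b1 * t \<in> integers \<and> b3 - b1 * a \<in> integers \<and>
    (b1 \<noteq> 0 \<or> b2 \<noteq> 0 \<or> b3 \<noteq> 0) \<and>
    (\<forall>\<phi>\<in>embeddings F. cmod (\<phi> b1) < r 0 \<and> cmod (\<phi> b2) < r 1 \<and> cmod (\<phi> b3) < r 2)"
proof -
  define n where "n = field_degree F"
  define \<omega> where "\<omega> = (SOME \<omega>. integral_basis F \<omega>)"
  define \<sigma> where "\<sigma> = (SOME \<sigma>. distinct \<sigma> \<and> set \<sigma> = embeddings F)"
  define A where "A = (\<lambda>i j. (\<sigma> ! i) (\<omega> ! j))"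
  define V where "V = mat n n (\<lambda>(i, j). A i j)"
  have \<omega>: "integral_basis F \<omega>" unfolding \<omega>_def by (rule someI_ex[OF ex_integral_basis])
  have len\<omega>: "length \<omega> = n" using basis_length[OF \<omega>] by (simp add: n_def)
  have "\<exists>\<sigma>. distinct \<sigma> \<and> set \<sigma> = embeddings F"
    using finite_distinct_list[OF embeddings_number_field(1)[OF number_field]] by blast
  then have \<sigma>: "distinct \<sigma>" "set \<sigma> = embeddings F" unfolding \<sigma>_def by (rule someI2_ex, blast)+
  have len\<sigma>: "length \<sigma> = n"
    using distinct_card[OF \<sigma>(1)] \<sigma>(2) embeddings_number_field(2)[OF number_field] by (simp add: n_def)
  have emb: "\<sigma> ! i \<in> embeddings F" if "i < n" for i using that \<sigma>(2) len\<sigma> nth_mem by blast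
  note hom = embeddings_hom_on[OF emb]
  have emb_ex: "\<exists>i<n. \<phi> = \<sigma> ! i" if "\<phi> \<in> embeddings F" for \<phi>
    using that unfolding \<sigma>(2)[symmetric] in_set_conv_nth len\<sigma> by metis
  have \<omega>F: "\<omega> ! j \<in> F" if "j < n" for j
    using basis_nth[OF \<omega>, of j] that by (simp add: len\<omega> integers_iff)
  have disc_eq: "field_disc F = (det V)\<^sup>2"
    unfolding field_disc_def Let_def V_def A_def n_def \<omega>_def \<sigma>_def ..
  then have detV: "det V \<noteq> 0" using disc by auto
  have n0: "n > 0"
  proof (rule ccontr)
    assume "\<not> n > 0"
    obtain c :: "nat \<Rightarrow> int" where "1 = (\<Sum>i<length \<omega>. of_int (c i) * \<omega> ! i)"
      using \<omega> integers_closed(2) by (rule basis_span_int)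
    then show False using len\<omega> \<open>\<not> n > 0\<close> by simp
  qed

  have "\<forall>i. \<exists>j. i < n \<longrightarrow> j < n \<and> \<sigma> ! j = restrict (cnj \<circ> \<sigma> ! i) F"
    using emb_ex[OF cnj_embedding[OF emb]] by metis
  then obtain c0 where c0: "\<And>i. i < n \<Longrightarrow> c0 i < n" "\<And>i. i < n \<Longrightarrow> \<sigma> ! c0 i = restrict (cnj \<circ> \<sigma> ! i) F"
    by metis
  have \<sigma>_inj: "i = j" if "i < n" "j < n" "\<sigma> ! i = \<sigma> ! j" for i j
    using that \<sigma>(1) len\<sigma> by (simp add: nth_eq_iff_index_eq)
  have c0_c0: "c0 (c0 i) = i" if i: "i < n" for i
  proof (rule \<sigma>_inj)
    show "\<sigma> ! c0 (c0 i) = \<sigma> ! i"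
    proof (rule extensionalityI)
      show "\<sigma> ! c0 (c0 i) \<in> extensional F" "\<sigma> ! i \<in> extensional F"
        using emb c0(1) i by (auto simp: embeddings_def)
      show "(\<sigma> ! c0 (c0 i)) x = (\<sigma> ! i) x" if "x \<in> F" for x
        using that c0 i by simp
    qed
  qed (use c0(1) i in auto)
  have A_c0: "A (c0 i) j = cnj (A i j)" if "i < n" "j < n" for i j
    using c0(2)[OF that(1)] \<omega>F[OF that(2)] by (simp add: A_def)
  \<comment> \<open>One index from each pair of conjugate embeddings, hence one for every complex
    place.\<close>
  define P where "P = {i. i < n \<and> i < c0 i}"
  have "bij_betw (\<lambda>i. {\<sigma> ! i, \<sigma> ! c0 i}) P (complex_places F)"
  proof (rule bij_betw_imageI)
    show "inj_on (\<lambda>i. {\<sigma> ! i, \<sigma> ! c0 i}) P"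
    proof (rule inj_onI)
      fix i j assume ij: "i \<in> P" "j \<in> P" "{\<sigma> ! i, \<sigma> ! c0 i} = {\<sigma> ! j, \<sigma> ! c0 j}"
      then have lt: "i < n" "j < n" "i < c0 i" "j < c0 j" by (auto simp: P_def)
      consider "\<sigma> ! i = \<sigma> ! j" | "\<sigma> ! i = \<sigma> ! c0 j" using ij(3) by blast
      then show "i = j"
      proof cases
        case 1
        then show ?thesis using \<sigma>_inj lt by blast
      next
        case 2
        then have "i = c0 j" using \<sigma>_inj lt c0(1) by blast
        then have "c0 i = j" using c0_c0 lt by simp
        then show ?thesis using lt \<open>i = c0 j\<close> by linarith
      qed
    qed
    have real_iff: "\<sigma> ! i ` F \<subseteq> \<real> \<longleftrightarrow> c0 i = i" if i: "i < n" for i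
    proof
      assume real: "\<sigma> ! i ` F \<subseteq> \<real>"
      have "\<sigma> ! c0 i = \<sigma> ! i"
      proof (rule extensionalityI)
        show "\<sigma> ! c0 i \<in> extensional F" "\<sigma> ! i \<in> extensional F"
          using emb c0(1) i by (auto simp: embeddings_def)
        fix x assume "x \<in> F"
        then have "(\<sigma> ! i) x \<in> \<real>" using real by blast
        then show "(\<sigma> ! c0 i) x = (\<sigma> ! i) x"
          using c0(2)[OF i] \<open>x \<in> F\<close> by (simp add: Reals_cnj_iff)
      qed
      then show "c0 i = i" using \<sigma>_inj c0(1) i by blast
    next
      assume "c0 i = i"
      then have eq: "\<sigma> ! i = restrict (cnj \<circ> \<sigma> ! i) F" using c0(2)[OF i] by simp
      show "\<sigma> ! i ` F \<subseteq> \<real>"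
      proof
        fix y assume "y \<in> \<sigma> ! i ` F"
        then obtain x where x: "x \<in> F" "y = (\<sigma> ! i) x" by blast
        have "(\<sigma> ! i) x = cnj ((\<sigma> ! i) x)" using fun_cong[OF eq, of x] x(1) by simp
        then show "y \<in> \<real>" unfolding x(2) by (metis Reals_cnj_iff)
      qed
    qed
    show "(\<lambda>i. {\<sigma> ! i, \<sigma> ! c0 i}) ` P = complex_places F"
    proof (intro equalityI subsetI)
      fix p assume "p \<in> (\<lambda>i. {\<sigma> ! i, \<sigma> ! c0 i}) ` P"
      then obtain i where i: "i < n" "i < c0 i" "p = {\<sigma> ! i, \<sigma> ! c0 i}" by (auto simp: P_def)
      have "p = {\<sigma> ! i, restrict (cnj \<circ> \<sigma> ! i) F}" using i(3) c0(2)[OF i(1)] by simp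
      moreover have "\<not> \<sigma> ! i ` F \<subseteq> \<real>" using real_iff[OF i(1)] i(2) by simp
      ultimately show "p \<in> complex_places F" unfolding complex_places_def using emb[OF i(1)] by blast
    next
      fix p assume "p \<in> complex_places F"
      then obtain \<phi> where \<phi>: "p = {\<phi>, restrict (cnj \<circ> \<phi>) F}" "\<phi> \<in> embeddings F" "\<not> \<phi> ` F \<subseteq> \<real>"
        unfolding complex_places_def by blast
      obtain i where i: "i < n" "\<phi> = \<sigma> ! i" using emb_ex[OF \<phi>(2)] by blast
      have p: "p = {\<sigma> ! i, \<sigma> ! c0 i}" using \<phi>(1) c0(2)[OF i(1)] i(2) by simp
      have ne: "c0 i \<noteq> i" using \<phi>(3) real_iff[OF i(1)] i(2) by blast
      show "p \<in> (\<lambda>i. {\<sigma> ! i, \<sigma> ! c0 i}) ` P"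
      proof (cases "i < c0 i")
        case True
        then show ?thesis using p i(1) by (auto simp: P_def)
      next
        case False
        then have "c0 i \<in> P" using ne c0(1) c0_c0 i(1) by (auto simp: P_def)
        moreover have "p = {\<sigma> ! c0 i, \<sigma> ! c0 (c0 i)}" using p c0_c0[OF i(1)] by auto
        ultimately show ?thesis by blast
      qed
    qed
  qed
  then have cardP: "card P = card (complex_places F)" by (rule bij_betw_same_card)

  \<comment> \<open>Conjugation permutes the embeddings within each of the three blocks.\<close>
  define c where "c = (\<lambda>p. (p div n) * n + c0 (p mod n))"
  define S where "S = block_diag 3 n A"
  have S: "S \<in> carrier_mat (3 * n) (3 * n)" by (simp add: S_def block_diag_def)
  have S_eq: "S $$ (p, q) = (if p div n = q div n then A (p mod n) (q mod n) else 0)"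
    if "p < 3 * n" "q < 3 * n" for p q
    using that by (simp add: S_def block_diag_def)
  have detS: "det S = det V ^ 3" unfolding S_def V_def by (rule det_block_diag)
  have pm: "p mod n < n" for p using n0 by simp
  have pd: "p div n < 3" if "p < 3 * n" for p using that by (simp add: less_mult_imp_div_less)
  have c_eq: "c p = p div n * n + c0 (p mod n)" for p by (simp add: c_def)
  have c_div: "c p div n = p div n" and c_mod: "c p mod n = c0 (p mod n)" for p
    using c0(1)[OF pm, of p] by (simp_all add: c_def)
  have card_c: "card {p. p < 3 * n \<and> p < c p} = 3 * card (complex_places F)"
  proof -
    have "{p. p < 3 * n \<and> p < c p} = (\<lambda>(l, i). l * n + i) ` ({..<3} \<times> P)"
    proof (intro equalityI subsetI)
      fix p assume "p \<in> {p. p < 3 * n \<and> p < c p}"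
      then have p: "p < 3 * n" "p < c p" by auto
      have "p = (p div n) * n + p mod n" by simp
      moreover from this have "p mod n < c0 (p mod n)" using p(2) unfolding c_def by linarith
      ultimately show "p \<in> (\<lambda>(l, i). l * n + i) ` ({..<3} \<times> P)"
        using pd[OF p(1)] pm by (intro image_eqI[of _ _ "(p div n, p mod n)"]) (auto simp: P_def)
    next
      fix p assume "p \<in> (\<lambda>(l, i). l * n + i) ` ({..<3} \<times> P)"
      then obtain l i where li: "p = l * n + i" "l < 3" "i < n" "i < c0 i" by (auto simp: P_def)
      then show "p \<in> {p. p < 3 * n \<and> p < c p}" using block_index[of l 3 i n] by (simp add: c_def)
    qed
    moreover have "inj_on (\<lambda>(l, i). l * n + i) ({..<3} \<times> P)"
    proof (rule inj_onI, clarify)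
      fix l i l' i' assume li: "i \<in> P" "i' \<in> P" and eq: "l * n + i = l' * n + i'"
      have "(l * n + i) div n = l" "(l * n + i) mod n = i"
        "(l' * n + i') div n = l'" "(l' * n + i') mod n = i'" using li by (auto simp: P_def)
      then show "l = l' \<and> i = i'" using eq by metis
    qed
    ultimately show ?thesis by (simp add: card_image card_cartesian_product cardP)
  qed

  obtain C0 where C0: "finite C0" "C0 \<subseteq> ideal_inverse F J" "card C0 = ideal_norm F J"
    "\<forall>b\<in>C0. \<forall>d\<in>C0. b - d \<in> integers \<longrightarrow> b = d" using J by (rule ideal_inverse_large)
  have "\<forall>f. \<exists>k. f \<in> F \<longrightarrow> f = (\<Sum>i<n. of_rat (k i) * \<omega> ! i)"
    using basis_span_rat[OF \<omega>] unfolding len\<omega> by metis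
  then obtain \<kappa> where \<kappa>: "\<And>f. f \<in> F \<Longrightarrow> f = (\<Sum>i<n. of_rat (\<kappa> f i) * \<omega> ! i)" by metis
  \<comment> \<open>A class \<open>b\<close> is represented by the triple
    \<open>(b, t * b, a * b)\<close>, so the congruences for \<open>b2\<close> and \<open>b3\<close>
    are built in.\<close>
  define w where "w = (\<lambda>l :: nat. if l = 0 then 1 else if l = 1 then t else a)"
  have w: "w l \<in> integers" for l using ta integers_closed(2) by (simp add: w_def)
  have wF: "w l * b \<in> F" if "b \<in> C0" for l b
    using that C0(2) w[of l] by (intro subfieldD(4)[OF subfield]) (auto simp: ideal_inverse_def integers_iff)
  define vec_of where "vec_of = (\<lambda>b p. real_of_rat (\<kappa> (w (p div n) * b) (p mod n)))"
  \<comment> \<open>The first block, of weight 1, already separates the classes: integral coordinate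
    differences there would make \<open>b - d\<close> an integer of \<open>F\<close>.\<close>
  have incong0: "\<exists>p<n. vec_of b p - vec_of d p \<notin> \<int>" if bd: "b \<in> C0" "d \<in> C0" "b \<noteq> d" for b d
  proof (rule ccontr)
    assume neg: "\<not> ?thesis"
    have "\<exists>k :: int. \<kappa> b i - \<kappa> d i = of_int k" if i: "i < n" for i
    proof -
      have "real_of_rat (\<kappa> b i - \<kappa> d i) \<in> \<int>"
        using neg i by (auto simp: vec_of_def w_def of_rat_diff)
      then obtain k where "real_of_rat (\<kappa> b i - \<kappa> d i) = of_int k" by (auto elim: Ints_cases)
      then have "real_of_rat (\<kappa> b i - \<kappa> d i) = real_of_rat (of_int k)" by simp
      then show ?thesis by (metis of_rat_eq_iff)
    qed
    then obtain k :: "nat \<Rightarrow> int" where k: "\<And>i. i < n \<Longrightarrow> \<kappa> b i - \<kappa> d i = of_int (k i)" by metis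
    have "b \<in> F" "d \<in> F" using wF[of _ 0] bd by (auto simp: w_def)
    then have "b - d = (\<Sum>i<n. of_rat (\<kappa> b i - \<kappa> d i) * \<omega> ! i)"
      using \<kappa>[of b] \<kappa>[of d] by (simp add: of_rat_diff left_diff_distrib sum_subtractf)
    also have "\<dots> = (\<Sum>i<n. of_int (k i) * \<omega> ! i)" by (rule sum.cong) (auto simp: k)
    also have "\<dots> \<in> integers"
      using basis_nth[OF \<omega>] len\<omega> by (intro integers_sum integers_closed(6) integers_closed(3)) auto
    finally show False using C0(4) bd by blast
  qed
  have inj: "inj_on vec_of C0"
  proof (rule inj_onI, rule ccontr)
    fix b d assume bd: "b \<in> C0" "d \<in> C0" "vec_of b = vec_of d" "b \<noteq> d"
    then show False using incong0[of b d] by simp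
  qed
  show ?thesis
  proof (rule minkowski_linear_forms[where S = S and m = "3 * n" and c = c and
        r = "\<lambda>p. r (p div n)" and C = "vec_of ` C0"])
    show "S \<in> carrier_mat (3 * n) (3 * n)" by (rule S)
    show "det S \<noteq> 0" using detV by (simp add: detS)
    show "c p < 3 * n" if "p < 3 * n" for p
      unfolding c_def by (rule block_index[OF pd[OF that] c0(1)[OF pm]])
    show "c (c p) = p" for p
      unfolding c_eq[of "c p"] c_div c_mod using c0_c0[OF pm, of p] by simp
    show "S $$ (c p, q) = cnj (S $$ (p, q))" if "p < 3 * n" "q < 3 * n" for p q
    proof -
      have "c p < 3 * n" unfolding c_eq by (rule block_index[OF pd[OF that(1)] c0(1)[OF pm]])
      then show ?thesis
        using that by (simp add: S_eq c_div c_mod A_c0[OF pm pm])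
    qed
    show "0 < r (p div n)" if "p < 3 * n" for p using r pd[OF that] .
    show "r (c p div n) = r (p div n)" for p by (simp add: c_div)
    show "finite (vec_of ` C0)" using C0(1) by simp
    show "\<exists>p<3 * n. u p - v p \<notin> \<int>" if "u \<in> vec_of ` C0" "v \<in> vec_of ` C0" "u \<noteq> v" for u v
    proof -
      from that obtain b d where "b \<in> C0" "d \<in> C0" "b \<noteq> d" "u = vec_of b" "v = vec_of d" by blast
      then obtain p where "p < n" "u p - v p \<notin> \<int>" using incong0 by blast
      then show ?thesis by (intro exI[of _ p]) simp
    qed
    \<comment> \<open>The discriminant is the square of \<open>det V\<close>, whereas
      \<open>S\<close> consists of three blocks \<open>V\<close>.\<close>
    have "cmod (field_disc F) powr (3 / 2) = cmod (det V) ^ 3"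
    proof -
      have "cmod (field_disc F) powr (3 / 2) = (cmod (det V) powr 2) powr (3 / 2)"
        using detV by (simp add: disc_eq norm_power)
      also have "\<dots> = cmod (det V) powr 3" unfolding powr_powr by simp
      also have "\<dots> = cmod (det V) ^ 3" using detV by simp
      finally show ?thesis .
    qed
    moreover have "(\<Prod>p<3 * n. r (p div n)) = (\<Prod>l<3. r l) ^ n"
      unfolding prod_blocks by (simp add: prod_power_distrib)
    ultimately show "cmod (det S) < real (card (vec_of ` C0)) * (\<Prod>p<3 * n. r (p div n)) *
        (pi / 2) ^ card {p. p < 3 * n \<and> p < c p}"
      using large[folded n_def] by (simp add: detS norm_power card_image[OF inj] C0(3) card_c)
  next
    fix u v and z :: "nat \<Rightarrow> int"
    assume uv: "u \<in> vec_of ` C0" "v \<in> vec_of ` C0"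
      and ne: "\<exists>p<3 * n. u p - v p + of_int (z p) \<noteq> 0"
      and small: "\<And>p. p < 3 * n \<Longrightarrow>
        cmod (\<Sum>q<3 * n. S $$ (p, q) * complex_of_real (u q - v q + of_int (z q))) < r (p div n)"
    obtain b where b: "b \<in> C0" "u = vec_of b" using uv(1) by blast
    obtain d where d: "d \<in> C0" "v = vec_of d" using uv(2) by blast
    define e where "e = (\<lambda>l i. \<kappa> (w l * b) i - \<kappa> (w l * d) i + of_int (z (l * n + i)))"
    \<comment> \<open>The triple found, recovered from its coordinates. It differs from
      \<open>w l * (b - d)\<close> by the integers \<open>x l\<close>, which gives membership in the
      inverse ideal and both congruences.\<close>
    define B where "B = (\<lambda>l. \<Sum>i<n. of_rat (e l i) * \<omega> ! i)"
    define x where "x = (\<lambda>l. \<Sum>i<n. of_int (z (l * n + i)) * \<omega> ! i)"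
    have e: "u (l * n + i) - v (l * n + i) + of_int (z (l * n + i)) = real_of_rat (e l i)" if "i < n" for l i
      using that by (simp add: b(2) d(2) vec_of_def e_def of_rat_add of_rat_diff)
    have x: "x l \<in> integers" for l
      unfolding x_def using basis_nth[OF \<omega>] len\<omega>
      by (intro integers_sum integers_closed(6) integers_closed(3)) auto
    have Bx: "B l = w l * (b - d) + x l" for l
    proof -
      have "B l = (\<Sum>i<n. of_rat (\<kappa> (w l * b) i) * \<omega> ! i) - (\<Sum>i<n. of_rat (\<kappa> (w l * d) i) * \<omega> ! i) + x l"
        unfolding B_def x_def e_def
        by (simp add: of_rat_add of_rat_diff distrib_right left_diff_distrib sum.distrib sum_subtractf)
      also have "\<dots> = w l * b - w l * d + x l"
        using \<kappa>[OF wF[OF b(1)], of l] \<kappa>[OF wF[OF d(1)], of l] by simp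
      finally show ?thesis by (simp add: right_diff_distrib)
    qed
    have conj: "(\<sigma> ! i) (B l) = (\<Sum>j<n. A i j * of_rat (e l j))" if i: "i < n" for i l
    proof -
      have summand: "of_rat (e l j) * \<omega> ! j \<in> F" if "j < n" for j
        by (intro subfieldD(4)[OF subfield] subfield_of_rat[OF subfield] \<omega>F that)
      have "(\<sigma> ! i) (B l) = (\<Sum>j<n. (\<sigma> ! i) (of_rat (e l j) * \<omega> ! j))"
        unfolding B_def by (rule hom_on_sum[OF subfield hom[OF i]]) (use summand in auto)
      also have "\<dots> = (\<Sum>j<n. A i j * of_rat (e l j))"
      proof (rule sum.cong[OF refl])
        fix j assume "j \<in> {..<n}"
        then have "\<omega> ! j \<in> F" using \<omega>F by simp
        then show "(\<sigma> ! i) (of_rat (e l j) * \<omega> ! j) = A i j * of_rat (e l j)"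
          using hom_onD(3)[OF hom[OF i] subfield_of_rat[OF subfield]] hom_on_of_rat[OF subfield hom[OF i]]
          by (simp add: A_def mult.commute)
      qed
      finally show ?thesis .
    qed
    have bound: "cmod ((\<sigma> ! i) (B l)) < r l" if i: "i < n" and l: "l < 3" for i l
    proof -
      let ?p = "l * n + i"
      have p: "?p < 3 * n" using block_index[OF l i] .
      have of_rat: "complex_of_real (real_of_rat q) = of_rat q" for q
        by (cases q) (simp add: of_rat_rat)
      have "(\<Sum>q<3 * n. S $$ (?p, q) * complex_of_real (u q - v q + of_int (z q))) =
          (\<Sum>l'<3. \<Sum>j<n. if l' = l then A i j * of_rat (e l j) else 0)"
        unfolding sum_blocks
      proof (intro sum.cong refl)
        fix l' j assume lj: "l' \<in> {..<3::nat}" "j \<in> {..<n}"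
        then have q: "l' * n + j < 3 * n" by (intro block_index) auto
        have "S $$ (?p, l' * n + j) = (if l' = l then A i j else 0)"
          using p q lj(2) i by (simp add: S_eq)
        then show "S $$ (?p, l' * n + j) *
            complex_of_real (u (l' * n + j) - v (l' * n + j) + of_int (z (l' * n + j))) =
            (if l' = l then A i j * of_rat (e l j) else 0)"
          using e[of j l'] lj(2) of_rat by simp
      qed
      also have "\<dots> = (\<Sum>l'<3. if l' = l then (\<sigma> ! i) (B l) else 0)"
        by (rule sum.cong) (simp_all add: conj[OF i])
      also have "\<dots> = (\<sigma> ! i) (B l)" using l by simp
      finally show ?thesis using small[OF p] i by simp
    qed
    have ne': "\<exists>l<3. B l \<noteq> 0"
    proof -
      obtain p where p: "p < 3 * n" "u p - v p + of_int (z p) \<noteq> 0" using ne by blast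
      have "real_of_rat (e (p div n) (p mod n)) \<noteq> 0" using e[OF pm, of "p div n" p] p(2) by simp
      then have "e (p div n) (p mod n) \<noteq> 0" by auto
      then have "B (p div n) \<noteq> 0"
        using basis_independent_rat[OF \<omega>, of "e (p div n)" "p mod n"] pm len\<omega> unfolding B_def by auto
      then show ?thesis using pd[OF p(1)] by blast
    qed
    have "B 0 \<in> ideal_inverse F J"
      unfolding Bx using b(1) d(1) C0(2) x[of 0] integers_subset_ideal_inverse[OF J(1)]
      by (intro int_module.subspace_add[OF subspace_ideal_inverse]
          int_module.subspace_diff[OF subspace_ideal_inverse] ideal_inverse_mult_integer w) auto
    moreover have "B 1 - B 0 * t \<in> integers"
    proof -
      have "B 1 - B 0 * t = x 1 - x 0 * t" unfolding Bx by (simp add: w_def algebra_simps)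
      then show ?thesis using x ta by (simp add: integers_closed(5,6))
    qed
    moreover have "B 2 - B 0 * a \<in> integers"
    proof -
      have "B 2 - B 0 * a = x 2 - x 0 * a" unfolding Bx by (simp add: w_def algebra_simps)
      then show ?thesis using x ta by (simp add: integers_closed(5,6))
    qed
    moreover have "B 0 \<noteq> 0 \<or> B 1 \<noteq> 0 \<or> B 2 \<noteq> 0"
    proof -
      obtain l where "l < 3" "B l \<noteq> 0" using ne' by blast
      then have "l = 0 \<or> l = 1 \<or> l = 2" by linarith
      then show ?thesis using \<open>B l \<noteq> 0\<close> by blast
    qed
    moreover have "\<forall>\<phi>\<in>embeddings F. cmod (\<phi> (B 0)) < r 0 \<and> cmod (\<phi> (B 1)) < r 1 \<and> cmod (\<phi> (B 2)) < r 2"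
    proof
      fix \<phi> assume "\<phi> \<in> embeddings F"
      then obtain i where "i < n" "\<phi> = \<sigma> ! i" using emb_ex by blast
      then show "cmod (\<phi> (B 0)) < r 0 \<and> cmod (\<phi> (B 1)) < r 1 \<and> cmod (\<phi> (B 2)) < r 2"
        using bound[of i] by simp
    qed
    ultimately show ?thesis by blast
  qed
qed

end

theorem theorem2p1:
  fixes F J :: "'k::{alg_closed_field, field_char_0} set"
    and t a :: 'k
    and X Y :: real
  assumes F: "number_field F"
    and J: "is_ideal_of (ring_of_integers F) J" "J \<noteq> {0}"
    and ta: "t \<in> ring_of_integers F" "a \<in> ring_of_integers F"
    and J_t: "{j + t * u | j u. j \<in> J \<and> u \<in> ring_of_integers F} = ring_of_integers F"
    and XY: "X > 0" "Y > 1 / 3"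
    and bound:
      "(pi / 2) ^ (3 * card (complex_places F))
         * 3 powi (- 3 * int (field_degree F))
         * cmod (field_disc F) powr (- 3 / 2)
         * real (ideal_norm F J)
       > (X * Y) ^ field_degree F"
  shows "(\<exists>b1 b2 b3. admissible F J t a X Y b1 b2 b3) \<and>
    (\<forall>b1 b2 b3. admissible F J t a X Y b1 b2 b3 \<longrightarrow>
       (\<forall>x \<in> alg_integers. \<forall>y \<in> alg_integers.
          x + t * y + a \<in> sums_of_products J alg_integers \<longrightarrow>
          bieval (lin_bipoly b1 b2 b3) x y \<in> alg_integers) \<and>
       (\<forall>x' y' :: complex. \<forall>\<phi> \<in> embeddings F.
          cmod x' \<le> X \<and> cmod y' \<le> Y \<longrightarrow>
          cmod (bieval (map_bipoly \<phi> (lin_bipoly b1 b2 b3)) x' y') < 1))"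
proof -
  interpret number_field_set F by unfold_locales (rule F)
  let ?n = "field_degree F"
  have Y: "Y > 0" using XY by linarith
  define r where "r = (\<lambda>l :: nat. if l = 0 then 1 / (3 * X) else if l = 1 then 1 / (3 * Y) else 1 / 3)"
  have "\<exists>b1 b2 b3. b1 \<in> ideal_inverse F J \<and> b2 - b1 * t \<in> integers \<and> b3 - b1 * a \<in> integers \<and>
    (b1 \<noteq> 0 \<or> b2 \<noteq> 0 \<or> b3 \<noteq> 0) \<and>
    (\<forall>\<phi>\<in>embeddings F. cmod (\<phi> b1) < r 0 \<and> cmod (\<phi> b2) < r 1 \<and> cmod (\<phi> b3) < r 2)"
  proof (rule ex_small_triple[OF J _ ta])
    show "r l > 0" for l using XY Y by (simp add: r_def)
    let ?D = "cmod (field_disc F)"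
    have XYn: "(X * Y) ^ ?n > 0" using XY Y by simp
    \<comment> \<open>As \<open>0 powr s\<close> is 0, a vanishing discriminant would make the left
      side of the bound 0, below a positive number.\<close>
    show disc: "field_disc F \<noteq> 0"
    proof
      assume "field_disc F = 0"
      then have "(X * Y) ^ ?n < 0" using bound by simp
      then show False using XYn by linarith
    qed
    have D: "?D powr (3 / 2) > 0" using disc by simp
    have "(\<Prod>l<3. r l) = 1 / (27 * (X * Y))" by (simp add: r_def eval_nat_numeral)
    then have R: "(\<Prod>l<3. r l) ^ ?n = 1 / (27 ^ ?n * (X * Y) ^ ?n)"
      by (simp add: power_divide power_mult_distrib)
    have three: "(3 :: real) powi (- 3 * int ?n) = 1 / 27 ^ ?n"
    proof -
      have "(3 :: real) powi (- 3 * int ?n) = inverse (3 ^ (3 * ?n))"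
        by (simp add: power_int_def nat_mult_distrib power_one_over inverse_eq_divide)
      also have "(3 :: real) ^ (3 * ?n) = 27 ^ ?n" by (simp add: power_mult)
      finally show ?thesis by (simp add: divide_inverse)
    qed
    have inv: "?D powr (- 3 / 2) = 1 / ?D powr (3 / 2)"
      using powr_minus_divide[of ?D "3 / 2"] by (simp only: minus_divide_left)
    have "(X * Y) ^ ?n < (pi / 2) ^ (3 * card (complex_places F)) * (1 / 27 ^ ?n) *
        (1 / ?D powr (3 / 2)) * real (ideal_norm F J)"
      using bound unfolding three inv .
    \<comment> \<open>Here \<open>Z\<close> stands for the power of \<open>X * Y\<close>,
      \<open>E\<close> for that of 27, \<open>q\<close> for that of the discriminant,
      \<open>G\<close> for that of \<open>pi / 2\<close>, and \<open>N\<close> for the norm.\<close>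
    moreover have swap: "q < N * (1 / (E * Z)) * G"
      if "Z < G * (1 / E) * (1 / q) * N" "Z > 0" "E > 0" "q > 0" for Z G E q N :: real
    proof -
      have "Z < G * N / (E * q)" using that(1) by simp
      then have "Z * (E * q) < G * N" using that by (simp only: pos_less_divide_eq mult_pos_pos)
      then have "q * (E * Z) < G * N" by (simp only: ac_simps)
      then have "q < G * N / (E * Z)" using that by (simp only: pos_less_divide_eq mult_pos_pos)
      then show ?thesis by (simp add: mult.commute)
    qed
    ultimately show "?D powr (3 / 2) < real (ideal_norm F J) * (\<Prod>l<3. r l) ^ ?n *
        (pi / 2) ^ (3 * card (complex_places F))"
      unfolding R using XYn D by (intro swap) simp_all
  qed
  then obtain b1 b2 b3 where b1: "b1 \<in> ideal_inverse F J"
    and cong: "b2 - b1 * t \<in> integers" "b3 - b1 * a \<in> integers"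
    and ne: "b1 \<noteq> 0 \<or> b2 \<noteq> 0 \<or> b3 \<noteq> 0"
    and small: "\<forall>\<phi>\<in>embeddings F. cmod (\<phi> b1) < 1 / (3 * X) \<and> cmod (\<phi> b2) < 1 / (3 * Y) \<and> cmod (\<phi> b3) < 1 / 3"
    unfolding r_def by auto
  have "admissible F J t a X Y b1 b2 b3"
    unfolding admissible_def
  proof (intro conjI ballI impI)
    have inv: "b \<in> ideal_inverse F J" if "b - b1 * s \<in> integers" "s \<in> integers" for b s
    proof -
      have "(b - b1 * s) + s * b1 \<in> ideal_inverse F J"
        using that integers_subset_ideal_inverse[OF J(1)]
        by (intro int_module.subspace_add[OF subspace_ideal_inverse] ideal_inverse_mult_integer b1) auto
      then show ?thesis by (simp add: mult.commute)
    qed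
    show "lin_bipoly b1 b2 b3 \<in> inverse_ideal_bipolys F J"
      by (intro lin_bipoly_in_inverse_ideal_bipolys b1 inv[OF cong(1) ta(1)] inv[OF cong(2) ta(2)])
    show "cmod (\<phi> b1) < 1 / (3 * X)" "cmod (\<phi> b2) < 1 / (3 * Y)" "cmod (\<phi> b3) < 1 / 3"
      if "\<phi> \<in> embeddings F" for \<phi> using small that by auto
    show "b1 \<noteq> 0"
    proof
      assume "b1 = 0"
      then have "b2 \<in> integers" "b3 \<in> integers" using cong by simp_all
      moreover have "1 / (3 * Y) < 1" using XY by (simp add: field_simps)
      then have "cmod (\<phi> b2) < 1" "cmod (\<phi> b3) < 1" if "\<phi> \<in> embeddings F" for \<phi>
        using small that by force+
      ultimately have "b2 = 0" "b3 = 0" using integer_eq_0_if_small by blast+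
      then show False using ne \<open>b1 = 0\<close> by blast
    qed
    show "lin_bipoly b1 b2 b3 - [:[:b1:]:] * lin_bipoly 1 t a \<in> bipolys integers"
      unfolding lin_bipoly_congruent_iff using cong by blast
    fix x y :: 'k
    assume x: "x \<in> alg_integers" and y: "y \<in> alg_integers"
      and xy: "x + t * y + a \<in> sums_of_products J alg_integers \<and>
        (\<forall>\<phi>\<in>embeddings (alg_integers :: 'k set). cmod (\<phi> x) \<le> X \<and> cmod (\<phi> y) \<le> Y)"
    have "b1 * x + b2 * y + b3 = 0"
    proof (rule algebraic_int_eq_0_if_small)
      have xy_int: "algebraic_int x" "algebraic_int y" using x y by (auto simp: alg_integers_def)
      show "algebraic_int (b1 * x + b2 * y + b3)"
        by (rule linear_value_integral[OF b1 cong xy_int]) (use xy in blast)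
      \<comment> \<open>One embedding of the field of algebraic numbers supplies both kinds of
        bounds: its restriction to \<open>F\<close> those on the coefficients, its restriction to
        \<open>alg_integers\<close> those on \<open>x\<close> and \<open>y\<close>.\<close>
      fix \<Lambda> :: "'k \<Rightarrow> complex" assume \<Lambda>: "hom_on {x. algebraic x} \<Lambda>"
      have alg: "algebraic z" if "z \<in> F" for z using number_field_algebraic[OF F that] .
      have "hom_on F \<Lambda>" using \<Lambda> alg unfolding hom_on_def by blast
      then have "restrict \<Lambda> F \<in> embeddings F" by (rule embeddingsI[OF subfield])
      note small' = small[rule_format, OF this]
      obtain K where K: "is_subfield K" "K = {x :: 'k. algebraic x}"
        using is_subfieldI_algebraic[of "{x :: 'k. algebraic x}"] algebraic_add_mult by auto
      have "inj_on \<Lambda> {x. algebraic x}" using hom_on_inj[OF K(1), of \<Lambda>] \<Lambda> K(2) by simp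
      then have "inj_on \<Lambda> alg_integers"
        by (rule inj_on_subset) (auto simp: alg_integers_def algebraic_int_imp_algebraic)
      then have "restrict \<Lambda> alg_integers \<in> embeddings alg_integers"
        using \<Lambda> unfolding embeddings_def hom_on_def
        by (auto simp: inj_on_def alg_integers_def algebraic_int_imp_algebraic algebraic_int_add algebraic_int_mult)
      then have XY': "cmod (\<Lambda> x) \<le> X" "cmod (\<Lambda> y) \<le> Y" using xy x y by force+
      have bF: "b1 \<in> F" "b2 \<in> F" "b3 \<in> F"
        using b1 inv[OF cong(1) ta(1)] inv[OF cong(2) ta(2)] by (auto simp: ideal_inverse_def)
      have xy_alg: "algebraic x" "algebraic y" using xy_int by auto
      have "\<Lambda> (b1 * x + b2 * y + b3) = \<Lambda> b1 * \<Lambda> x + \<Lambda> b2 * \<Lambda> y + \<Lambda> b3"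
        using alg[OF bF(1)] alg[OF bF(2)] alg[OF bF(3)] xy_alg
        by (simp add: hom_onD[OF \<Lambda>] algebraic_add_mult)
      also have "cmod \<dots> < 1"
        using small' bF by (intro linear_value_bound[OF XY(1) Y _ _ _ XY']) auto
      finally show "cmod (\<Lambda> (b1 * x + b2 * y + b3)) < 1" .
    qed
    then show "bieval (lin_bipoly b1 b2 b3) x y = 0" by (simp only: bieval_lin_bipoly)
  qed
  moreover have "bieval (lin_bipoly b1 b2 b3) x y \<in> alg_integers"
    if adm: "admissible F J t a X Y b1 b2 b3" and xy: "x \<in> alg_integers" "y \<in> alg_integers"
      "x + t * y + a \<in> sums_of_products J alg_integers" for b1 b2 b3 x y
  proof -
    have "lin_bipoly b1 b2 b3 \<in> inverse_ideal_bipolys F J" using adm by (simp add: admissible_def)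
    \<comment> \<open>The indices select the coefficient of \<open>x ^ 1 * y ^ 0\<close>, which is
      \<open>b1\<close>.\<close>
    from inverse_ideal_bipoly_coeff[OF this, of 0 1]
    have "b1 \<in> ideal_inverse F J" by (simp add: lin_bipoly_def)
    moreover have "b2 - b1 * t \<in> integers \<and> b3 - b1 * a \<in> integers"
      using adm unfolding admissible_def lin_bipoly_congruent_iff by blast
    ultimately show ?thesis
      using linear_value_integral[of b1 J b2 t b3 a x y] xy by (simp add: bieval_lin_bipoly alg_integers_def)
  qed
  moreover have "cmod (bieval (map_bipoly \<phi> (lin_bipoly b1 b2 b3)) x' y') < 1"
    if adm: "admissible F J t a X Y b1 b2 b3" and \<phi>: "\<phi> \<in> embeddings F"
      and xy: "cmod x' \<le> X" "cmod y' \<le> Y" for b1 b2 b3 x' y' \<phi>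
  proof -
    have "\<phi> 0 = 0" by (rule hom_on_zero[OF subfield embeddings_hom_on[OF \<phi>]])
    moreover have "cmod (\<phi> b1) < 1 / (3 * X)" "cmod (\<phi> b2) < 1 / (3 * Y)" "cmod (\<phi> b3) < 1 / 3"
      using adm \<phi> by (auto simp: admissible_def)
    ultimately show ?thesis
      using linear_value_bound[OF XY(1) Y _ _ _ xy] by (simp add: map_lin_bipoly bieval_lin_bipoly)
  qed
  ultimately show ?thesis by blast
qed

end
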